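(* (i) A query $q\in\mathcal Q_p[\bigcirc,\Diamond_r](\mathcal{ELI})$ is uniquely characterisable within $\mathcal Q_p[\bigcirc,\Diamond_r](\mathcal{ELI})$ if and only if $q$ is safe. (ii) Those queries that are uniquely characterisable within $\mathcal Q_p[\bigcirc,\Diamond_r](\mathcal{ELI})$ are actually polynomially characterisable within $\mathcal Q_p[\bigcirc,\Diamond_r](\mathcal{ELI})$: there is a polynomial $f$ such that each such $q$ is uniquely characterised within $\mathcal Q_p[\bigcirc,\Diamond_r](\mathcal{ELI})$ by some example set $E$ with $|E|\le f(|q|)$. (iii) The class $\mathcal Q_p[\bigcirc,\Diamond_r](\mathcal{ELI})$ is polynomially characterisable for bounded query size. (iv) The class $\mathcal Q_p[\bigcirc,\Diamond](\mathcal{ELI})$ is polynomially characterisable (within itself).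
   Context: **Data.** A data instance $\mathcal A$ is a finite set of facts $A(a)$, $P(a,b)$ with unary predicate symbols $A$, binary predicate symbols $P$ and individual names $a,b$; we write $P^-(a,b)\in\mathcal A$ iff $P(b,a)\in\mathcal A$. $\mathrm{ind}(\mathcal A)$ is the set of individual names in $\mathcal A$. A temporal data instance is a finite sequence $\mathcal D=\mathcal A_0,\dots,\mathcal A_n$, with $\mathcal A_\ell=\emptyset$ for $\ell>n$; $\mathrm{ind}(\mathcal D)=\bigcup_i\mathrm{ind}(\mathcal A_i)$, $|\mathcal D|=\sum_i|\mathcal A_i|$. **Queries.** $\mathcal{ELI}$-queries are built from $\top$ and unary symbols $A$ using $\wedge$ and $\exists S.r$, where $S$ is $P$ or $P^-$ for a binary symbol $P$. For $\Phi\subseteq\{\bigcirc,\Diamond,\Diamond_r\}$, $\mathcal Q_p[\Phi](\mathcal{ELI})$ is the class of queries $r_0\wedge o_1(r_1\wedge o_2(r_2\wedge\dots\wedge o_nr_n))$ with $n\ge 0$, $o_i\in\Phi$ and $\mathcal{ELI}$-queries $r_i$. Truth: $\mathcal D,a,\ell\models A$ iff $A(a)\in\mathcal A_\ell$; $\mathcal D,a,\ell\models\exists S.r$ iff there is $b\in\mathrm{ind}(\mathcal A_\ell)$ with $S(a,b)\in\mathcal A_\ell$ and $\mathcal D,b,\ell\models r$; $\bigcirc q$ is true at $(a,\ell)$ iff $q$ is true at $(a,\ell+1)$; $\Diamond q$ iff $q$ is true at $(a,m)$ for some $m>\ell$; $\Diamond_rq$ iff $q$ is true at $(a,m)$ for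 some $m\ge\ell$; $\top,\wedge$ as usual. $q\models q'$ means truth of $q$ at any $(\mathcal D,a,\ell)$ implies truth of $q'$ there; $\equiv$ is mutual entailment. Since $\Diamond q\equiv\bigcirc\Diamond_rq$, $\Diamond$ may also be used in representing queries in $\mathcal Q_p[\bigcirc,\Diamond_r](\mathcal{ELI})$. $|q|$ is the number of symbols in $q$. **Characterisability.** An example set is a pair $E=(E^+,E^-)$ of finite sets of pointed temporal data instances $(\mathcal D,a)$, $a\in\mathrm{ind}(\mathcal D)$; $|E|$ is the sum of the $|\mathcal D|$. $q$ fits $E$ if $\mathcal D,a,0\models q$ for $(\mathcal D,a)\in E^+$ and $\mathcal D,a,0\not\models q$ for $(\mathcal D,a)\in E^-$. $E$ uniquely characterises $q$ within $\mathcal Q$ if $q$ fits $E$ and $q\equiv q'$ for all $q'\in\mathcal Q$ fitting $E$; $q$ is uniquely characterisable within $\mathcal Q$ if such an $E$ exists. $\mathcal Q$ is polynomially characterisable (within itself) if there is a polynomial $f$ such that each $q\in\mathcal Q$ is uniquely characterised within $\mathcal Q$ by some $E$ with $|E|\le f(|q|)$. $\mathcal Q$ is polynomially characterisable for bounded query size if there is a polynomial $f$ such that for all $n$ every $q\in\mathcal Q^n$ is uniquely characterised within $\mathcal Q^n$ by some $E$ with $|E|\le f(n)$, where $\mathcal Q^n=\{q\in\mathcal Q: |q|\le n\}$. **Normal form and safety.** A query in $\mathcal Q_p[\bigcirc,\Diamond,\Diamond_r](\mathcal{ELI})$ is represented as a sequence $r_0(t_0),R_1(t_0,t_1),r_1(t_1),\dots,R_n(t_{n-1},t_n),r_n(t_n)$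 with $R_i\in\{\mathit{suc},<,\le\}$ according to $o_i=\bigcirc,\Diamond,\Diamond_r$. Divide it as $q_0\mathcal R_1q_1\dots\mathcal R_nq_n$, where each block $q_i$ is a maximal $\mathit{suc}$-chain $r^i_0,\dots,r^i_{k_i}$ ($k_i\ge0$) and each $\mathcal R_i$ is a nonempty sequence of relations from $\{<,\le\}$ from the last point of $q_{i-1}$ to the first point of $q_i$ with intermediate points labelled by $\top$. A block is primitive if $k_i=0$. A lone conjunct is a primitive block $q_i=r^i_0$ with $i>0$ such that $r^i_0$ is equivalent to some $p_1\wedge p_2$ with $\mathcal{ELI}$-queries $p_1,p_2$ such that $p_1\not\models r^i_0$ and $p_2\not\models r^i_0$. The query is in normal form if: (n1) $r^i_0\not\equiv\top$ if $i>0$, and $r^i_{k_i}\not\equiv\top$ if $i>0$ or $k_i>0$; (n2) each $\mathcal R_i$ is a single $\le$ or a sequence of $<$; (n3) $r^i_{k_i}\not\models r^{i+1}_0$ if $q_{i+1}$ is primitive and $\mathcal R_{i+1}$ is $\le$; (n4) $r^{i+1}_0\not\models r^i_{k_i}$ if $i>0$, $q_i$ is primitive and $\mathcal R_{i+1}$ is $\le$. A query is safe if it is equivalent to a query in normal form without lone conjuncts. *)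

theory Defs
  imports
    "HOL-Computational_Algebra.Polynomial"
    "HOL-Library.Infinite_Typeclass"
begin

section \<open>Temporal data instances\<close>

text \<open>
  The type parameters \<open>'u\<close> and \<open>'b\<close> are the supplies of unary and binary predicate symbols.
  Individual names are natural numbers, so that there are countably infinitely many of them.
\<close>

type_synonym individual = nat

datatype ('u, 'b) assertion =
    Unary 'u individual
  | Binary 'b individual individual

datatype 'b role = Rel 'b | Inv 'b

type_synonym ('u, 'b) data_instance = "('u, 'b) assertion set"

type_synonym ('u, 'b) temporal_data = "('u, 'b) data_instance list"

fun assertion_inds :: "('u, 'b) assertion \<Rightarrow> individual set" where
  "assertion_inds (Unary A a) = {a}"
| "assertion_inds (Binary P a b) = {a, b}"

definition inds :: "('u, 'b) data_instance \<Rightarrow> individual set" where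
  "inds \<A> = (\<Union>\<alpha>\<in>\<A>. assertion_inds \<alpha>)"

fun role_in :: "('u, 'b) data_instance \<Rightarrow> 'b role \<Rightarrow> individual \<Rightarrow> individual \<Rightarrow> bool" where
  "role_in \<A> (Rel P) a b \<longleftrightarrow> Binary P a b \<in> \<A>"
| "role_in \<A> (Inv P) a b \<longleftrightarrow> Binary P b a \<in> \<A>"

definition is_temporal_data :: "('u, 'b) temporal_data \<Rightarrow> bool" where
  "is_temporal_data \<D> \<longleftrightarrow> \<D> \<noteq> [] \<and> (\<forall>\<A>\<in>set \<D>. finite \<A>)"

definition at_time :: "('u, 'b) temporal_data \<Rightarrow> nat \<Rightarrow> ('u, 'b) data_instance" where
  "at_time \<D> l = (if l < length \<D> then \<D> ! l else {})"

definition temporal_inds :: "('u, 'b) temporal_data \<Rightarrow> individual set" where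
  "temporal_inds \<D> = (\<Union>\<A>\<in>set \<D>. inds \<A>)"

definition data_size :: "('u, 'b) temporal_data \<Rightarrow> nat" where
  "data_size \<D> = (\<Sum>\<A>\<leftarrow>\<D>. card \<A>)"


section \<open>Queries\<close>

datatype ('u, 'b) eli =
    Top
  | Atom 'u
  | And "('u, 'b) eli" "('u, 'b) eli"
  | Exists "'b role" "('u, 'b) eli"

text \<open>\<open>Next\<close> is \<open>\<circle>\<close>, \<open>Dia\<close> is the strict and \<open>DiaR\<close> the reflexive diamond.\<close>

datatype temporal_op = Next | Dia | DiaR

text \<open>
  The path query \<open>r\<^sub>0 \<and> o\<^sub>1(r\<^sub>1 \<and> o\<^sub>2(r\<^sub>2 \<and> \<dots> \<and> o\<^sub>n r\<^sub>n))\<close> is the pair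
  \<open>(r\<^sub>0, [(o\<^sub>1, r\<^sub>1), \<dots>, (o\<^sub>n, r\<^sub>n)])\<close>. Reading \<open>Next\<close>, \<open>Dia\<close>, \<open>DiaR\<close> as the relations
  \<open>suc\<close>, \<open><\<close>, \<open>\<le>\<close>, the same pair is the representation of the query as a sequence
  \<open>r\<^sub>0(t\<^sub>0), R\<^sub>1(t\<^sub>0,t\<^sub>1), r\<^sub>1(t\<^sub>1), \<dots>\<close>.
\<close>

type_synonym ('u, 'b) path_query = "('u, 'b) eli \<times> (temporal_op \<times> ('u, 'b) eli) list"

definition path_queries :: "temporal_op set \<Rightarrow> ('u, 'b) path_query set" where
  "path_queries \<Phi> = {(r, ps). fst ` set ps \<subseteq> \<Phi>}"

fun eli_holds :: "('u, 'b) data_instance \<Rightarrow> individual \<Rightarrow> ('u, 'b) eli \<Rightarrow> bool" where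
  "eli_holds \<A> a Top \<longleftrightarrow> True"
| "eli_holds \<A> a (Atom A) \<longleftrightarrow> Unary A a \<in> \<A>"
| "eli_holds \<A> a (And r s) \<longleftrightarrow> eli_holds \<A> a r \<and> eli_holds \<A> a s"
| "eli_holds \<A> a (Exists S r) \<longleftrightarrow> (\<exists>b\<in>inds \<A>. role_in \<A> S a b \<and> eli_holds \<A> b r)"

fun op_reaches :: "temporal_op \<Rightarrow> nat \<Rightarrow> nat \<Rightarrow> bool" where
  "op_reaches Next l m \<longleftrightarrow> m = l + 1"
| "op_reaches Dia l m \<longleftrightarrow> l < m"
| "op_reaches DiaR l m \<longleftrightarrow> l \<le> m"

fun path_holds :: "('u, 'b) temporal_data \<Rightarrow> individual \<Rightarrow> nat \<Rightarrow>
    ('u, 'b) eli \<Rightarrow> (temporal_op \<times> ('u, 'b) eli) list \<Rightarrow> bool" where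
  "path_holds \<D> a l r [] \<longleftrightarrow> eli_holds (at_time \<D> l) a r"
| "path_holds \<D> a l r ((opr, s) # ps) \<longleftrightarrow>
     eli_holds (at_time \<D> l) a r \<and> (\<exists>m. op_reaches opr l m \<and> path_holds \<D> a m s ps)"

definition holds :: "('u, 'b) temporal_data \<Rightarrow> individual \<Rightarrow> nat \<Rightarrow> ('u, 'b) path_query \<Rightarrow> bool" where
  "holds \<D> a l q \<longleftrightarrow> path_holds \<D> a l (fst q) (snd q)"

definition entails :: "('u, 'b) path_query \<Rightarrow> ('u, 'b) path_query \<Rightarrow> bool" where
  "entails q q' \<longleftrightarrow> (\<forall>\<D> a l. is_temporal_data \<D> \<longrightarrow> holds \<D> a l q \<longrightarrow> holds \<D> a l q')"

definition equivalent :: "('u, 'b) path_query \<Rightarrow> ('u, 'b) path_query \<Rightarrow> bool" where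
  "equivalent q q' \<longleftrightarrow> entails q q' \<and> entails q' q"

abbreviation eli_entails :: "('u, 'b) eli \<Rightarrow> ('u, 'b) eli \<Rightarrow> bool" where
  "eli_entails r s \<equiv> entails (r, []) (s, [])"

abbreviation eli_equivalent :: "('u, 'b) eli \<Rightarrow> ('u, 'b) eli \<Rightarrow> bool" where
  "eli_equivalent r s \<equiv> equivalent (r, []) (s, [])"

text \<open>Brackets are not counted, and an inverse role \<open>P\<^sup>-\<close> counts as one symbol.\<close>

fun eli_size :: "('u, 'b) eli \<Rightarrow> nat" where
  "eli_size Top = 1"
| "eli_size (Atom A) = 1"
| "eli_size (And r s) = eli_size r + 1 + eli_size s"
| "eli_size (Exists S r) = 2 + eli_size r"

text \<open>Each pair \<open>(o, r)\<close> contributes, besides \<open>r\<close>, the operator \<open>o\<close> and the \<open>\<and>\<close> in front of it.\<close>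

definition query_size :: "('u, 'b) path_query \<Rightarrow> nat" where
  "query_size q = eli_size (fst q) + (\<Sum>(opr, r)\<leftarrow>snd q. 2 + eli_size r)"


section \<open>Unique characterisability\<close>

type_synonym ('u, 'b) pointed_data = "('u, 'b) temporal_data \<times> individual"

type_synonym ('u, 'b) examples = "('u, 'b) pointed_data set \<times> ('u, 'b) pointed_data set"

definition is_example_set :: "('u, 'b) examples \<Rightarrow> bool" where
  "is_example_set E \<longleftrightarrow> finite (fst E) \<and> finite (snd E) \<and>
     (\<forall>(\<D>, a)\<in>fst E \<union> snd E. is_temporal_data \<D> \<and> a \<in> temporal_inds \<D>)"

definition examples_size :: "('u, 'b) examples \<Rightarrow> nat" where
  "examples_size E = (\<Sum>(\<D>, a)\<in>fst E. data_size \<D>) + (\<Sum>(\<D>, a)\<in>snd E. data_size \<D>)"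

definition fits :: "('u, 'b) path_query \<Rightarrow> ('u, 'b) examples \<Rightarrow> bool" where
  "fits q E \<longleftrightarrow> (\<forall>(\<D>, a)\<in>fst E. holds \<D> a 0 q) \<and> (\<forall>(\<D>, a)\<in>snd E. \<not> holds \<D> a 0 q)"

definition uniquely_characterises ::
    "('u, 'b) examples \<Rightarrow> ('u, 'b) path_query \<Rightarrow> ('u, 'b) path_query set \<Rightarrow> bool" where
  "uniquely_characterises E q \<Q> \<longleftrightarrow>
     is_example_set E \<and> fits q E \<and> (\<forall>q'\<in>\<Q>. fits q' E \<longrightarrow> equivalent q q')"

definition uniquely_characterisable ::
    "('u, 'b) path_query \<Rightarrow> ('u, 'b) path_query set \<Rightarrow> bool" where
  "uniquely_characterisable q \<Q> \<longleftrightarrow> (\<exists>E. uniquely_characterises E q \<Q>)"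

definition polynomially_characterisable :: "('u, 'b) path_query set \<Rightarrow> bool" where
  "polynomially_characterisable \<Q> \<longleftrightarrow>
     (\<exists>f :: nat poly. \<forall>q\<in>\<Q>. \<exists>E. uniquely_characterises E q \<Q> \<and>
        examples_size E \<le> poly f (query_size q))"

definition bounded_queries :: "('u, 'b) path_query set \<Rightarrow> nat \<Rightarrow> ('u, 'b) path_query set" where
  "bounded_queries \<Q> n = {q\<in>\<Q>. query_size q \<le> n}"

definition polynomially_characterisable_bounded :: "('u, 'b) path_query set \<Rightarrow> bool" where
  "polynomially_characterisable_bounded \<Q> \<longleftrightarrow>
     (\<exists>f :: nat poly. \<forall>n. \<forall>q\<in>bounded_queries \<Q> n. \<exists>E.
        uniquely_characterises E q (bounded_queries \<Q> n) \<and> examples_size E \<le> poly f n)"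


section \<open>Blocks, normal form and safety\<close>

text \<open>
  A division \<open>q\<^sub>0 \<R>\<^sub>1 q\<^sub>1 \<dots> \<R>\<^sub>n q\<^sub>n\<close> is given by the list \<open>bs\<close> of the \<open>n + 1\<close> blocks (each the
  nonempty list of the labels along its \<open>suc\<close>-chain) and the list \<open>Rs\<close> of the \<open>n\<close> relation
  sequences. List indexing starts at 0, so \<open>bs ! i\<close> is \<open>q\<^sub>i\<close> and \<open>Rs ! i\<close> is \<open>\<R>\<^bsub>i+1\<^esub>\<close>.

  \<open>attach R b\<close> lists what follows the last point of the preceding block: the relations \<open>R\<close>,
  leading through intermediate points labelled \<open>Top\<close> to the first point of \<open>b\<close>, and the rest
  of the chain \<open>b\<close>.
\<close>

definition attach :: "temporal_op list \<Rightarrow> ('u, 'b) eli list \<Rightarrow> (temporal_op \<times> ('u, 'b) eli) list" where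
  "attach R b = zip R (replicate (length R - 1) Top @ [hd b]) @ map (Pair Next) (tl b)"

text \<open>As no \<open>Next\<close> occurs in the lists in \<open>Rs\<close>, the blocks are maximal \<open>suc\<close>-chains.\<close>

definition divides_into ::
    "('u, 'b) path_query \<Rightarrow> ('u, 'b) eli list list \<Rightarrow> temporal_op list list \<Rightarrow> bool" where
  "divides_into q bs Rs \<longleftrightarrow>
     length bs = length Rs + 1 \<and>
     (\<forall>b\<in>set bs. b \<noteq> []) \<and>
     (\<forall>R\<in>set Rs. R \<noteq> [] \<and> set R \<subseteq> {Dia, DiaR}) \<and>
     q = (hd (hd bs), map (Pair Next) (tl (hd bs)) @ concat (map2 attach Rs (tl bs)))"

definition primitive_block :: "('u, 'b) eli list \<Rightarrow> bool" where
  "primitive_block b \<longleftrightarrow> length b = 1"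

definition lone_conjunct :: "('u, 'b) eli list list \<Rightarrow> nat \<Rightarrow> bool" where
  "lone_conjunct bs i \<longleftrightarrow>
     0 < i \<and> i < length bs \<and> primitive_block (bs ! i) \<and>
     (\<exists>p1 p2. eli_equivalent (hd (bs ! i)) (And p1 p2) \<and>
        \<not> eli_entails p1 (hd (bs ! i)) \<and> \<not> eli_entails p2 (hd (bs ! i)))"

definition normal_division :: "('u, 'b) eli list list \<Rightarrow> temporal_op list list \<Rightarrow> bool" where
  "normal_division bs Rs \<longleftrightarrow>
     (\<forall>i<length bs.
        (0 < i \<longrightarrow> \<not> eli_equivalent (hd (bs ! i)) Top) \<and>
        (0 < i \<or> 1 < length (bs ! i) \<longrightarrow> \<not> eli_equivalent (last (bs ! i)) Top)) \<and>
     (\<forall>R\<in>set Rs. R = [DiaR] \<or> set R = {Dia}) \<and>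
     (\<forall>i<length Rs. primitive_block (bs ! (i + 1)) \<and> Rs ! i = [DiaR] \<longrightarrow>
        \<not> eli_entails (last (bs ! i)) (hd (bs ! (i + 1)))) \<and>
     (\<forall>i<length Rs. 0 < i \<and> primitive_block (bs ! i) \<and> Rs ! i = [DiaR] \<longrightarrow>
        \<not> eli_entails (hd (bs ! (i + 1))) (last (bs ! i)))"

text \<open>
  The witnessing query \<open>q'\<close> may use all three temporal operators.
  A \<open>Top\<close>-labelled point between two relations from \<open><\<close>, \<open>\<le>\<close> could be read both as an
  intermediate point and as a primitive block, but a normal form has no block starting with a
  tautology after the first block. This excludes the second reading, so that a query
  has at most one division satisfying the conditions of the normal form.
\<close>

definition safe :: "('u, 'b) path_query \<Rightarrow> bool" where
  "safe q \<longleftrightarrow>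
     (\<exists>q' bs Rs. equivalent q q' \<and> divides_into q' bs Rs \<and> normal_division bs Rs \<and>
        \<not> (\<exists>i. lone_conjunct bs i))"

end

theory Submission
  imports Defs
begin

text \<open>
  Positive examples are words in which the blocks of a query \<open>q\<close> in normal form are far apart, except
  that two consecutive blocks, or all of them, are put at their least distance; the word with all
  blocks close together bounds the rigid part of any fitting query. Negative examples replace one block
  by several weaker pieces far apart, or put two blocks one step too close. Normal form makes \<open>q\<close> rigid:
  its only embedding into the word of its separated blocks is the identity, so that \<open>q\<close> is false on the
  negative examples. Conversely, embed a fitting query in normal form into the word of \<open>q\<close>. If
  one of its blocks is missing, too short, or too weak, the embedding can be redirected into the pieces of
  a negative example.

  Weakening a label \<open>r\<close> takes a frontier of \<open>r\<close>: polynomially many instances falsifying \<open>r\<close> such that each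
  strictly weaker query holds in one of them. In a primitive block a fitting query may have a
  sequence of strictly weaker labels, so the negative example needs all frontier instances, repeated as
  often as the fitting query is long. A single instance is enough if \<open>r\<close> is not a conjunction of
  two weaker queries. If \<open>r\<close> is equivalent to \<open>p\<^sub>1 \<and> p\<^sub>2\<close> with weaker \<open>p\<^sub>1\<close>, \<open>p\<^sub>2\<close>, then a long chain
  \<open>p\<^sub>1 \<le> p\<^sub>2 \<le> p\<^sub>1 \<le> \<dots>\<close> in place of \<open>r\<close> cannot be told apart from \<open>r\<close> by short data.
\<close>

section \<open>Canonical trees of \<open>\<E>\<L>\<I>\<close>-queries\<close>

text \<open>Segments of a word are separated by \<open>N = total_size x ps\<close> empty letters,
  and this has to suffice for the blocks and distances of a fitting query of unknown size. It does:
  on the positive example \<open>flatten x ps\<close>, which has at most \<open>N\<close> letters, a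
  query in normal form has no room for longer blocks or distances. Only the number of its blocks
  stays free, and that number matters in one place alone, the weakening of primitive blocks. Hence
  one construction, \<open>characterised\<close>, serves all positive claims: the number of blocks
  is harmless without lone conjuncts, bounded by assumption for bounded query size, and bounded by
  \<open>flatten x ps\<close> if all distances are strict. A single frontier instance suffices
  without lone conjuncts because a finite conjunction of strictly weaker queries is then still
  strictly weaker. A second obstacle is that an example must mention its distinguished individual,
  which a word of weakened letters need not do; a final letter with a fresh symbol repairs this.
  Queries with only tautological labels are treated separately.\<close>

fun rename :: "(individual \<Rightarrow> individual) \<Rightarrow> ('u, 'b) assertion \<Rightarrow> ('u, 'b) assertion" where
  "rename f (Unary A a) = Unary A (f a)"
| "rename f (Binary P a b) = Binary P (f a) (f b)"

definition hom :: "(individual \<Rightarrow> individual) \<Rightarrow> ('u, 'b) data_instance \<Rightarrow> ('u, 'b) data_instance \<Rightarrow> bool" where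
  "hom f I J \<longleftrightarrow> (\<forall>\<alpha>\<in>I. rename f \<alpha> \<in> J)"

fun edge :: "'b role \<Rightarrow> individual \<Rightarrow> individual \<Rightarrow> ('u, 'b) assertion" where
  "edge (Rel P) a b = Binary P a b"
| "edge (Inv P) a b = Binary P b a"

lemma role_in_edge: "role_in I S a b \<longleftrightarrow> edge S a b \<in> I"
  by (cases S) auto

lemma rename_edge: "rename f (edge S a b) = edge S (f a) (f b)"
  by (cases S) auto

lemma inds_edge: "assertion_inds (edge S a b) = {a, b}"
  by (cases S) auto

lemma inds_Un: "inds (I \<union> J) = inds I \<union> inds J"
  by (auto simp: inds_def)

lemma inds_insert: "inds (insert \<alpha> J) = assertion_inds \<alpha> \<union> inds J"
  by (auto simp: inds_def)

lemma edge_in_inds: "edge S a b \<in> I \<Longrightarrow> a \<in> inds I \<and> b \<in> inds I"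
  unfolding inds_def by (cases S) force+

lemma inds_empty [simp]: "inds {} = {}"
  by (auto simp: inds_def)

lemma eli_holds_Exists:
  "eli_holds I a (Exists S r) \<longleftrightarrow> (\<exists>b. edge S a b \<in> I \<and> eli_holds I b r)"
proof -
  have "b \<in> inds I" if "edge S a b \<in> I" for b
    using edge_in_inds[OF that] by simp
  thus ?thesis unfolding eli_holds.simps role_in_edge by blast
qed

declare eli_holds.simps(4) [simp del]

lemma eli_holds_hom:
  assumes "hom f I J" "eli_holds I a r"
  shows "eli_holds J (f a) r"
  using assms(2)
proof (induction r arbitrary: a)
  case (Atom A)
  then show ?case using assms(1) by (force simp: hom_def)
next
  case (Exists S r)
  then show ?case using assms(1) unfolding eli_holds_Exists hom_def
    by (metis rename_edge)
qed auto

lemma rename_id [simp]: "rename (\<lambda>a. a) \<alpha> = \<alpha>"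
  by (cases \<alpha>) auto

lemma rename_rename: "rename f (rename g \<alpha>) = rename (\<lambda>a. f (g a)) \<alpha>"
  by (cases \<alpha>) auto

lemma rename_cong: "(\<And>a. a \<in> assertion_inds \<alpha> \<Longrightarrow> f a = g a) \<Longrightarrow> rename f \<alpha> = rename g \<alpha>"
  by (cases \<alpha>) auto

lemma assertion_inds_rename: "assertion_inds (rename f \<alpha>) = f ` assertion_inds \<alpha>"
  by (cases \<alpha>) auto

lemma eli_holds_mono: "I \<subseteq> J \<Longrightarrow> eli_holds I a r \<Longrightarrow> eli_holds J a r"
  using eli_holds_hom[of "\<lambda>a. a" I J a r] by (auto simp: hom_def)

fun num_exists :: "('u, 'b) eli \<Rightarrow> nat" where
  "num_exists Top = 0"
| "num_exists (Atom A) = 0"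
| "num_exists (And r s) = num_exists r + num_exists s"
| "num_exists (Exists S r) = Suc (num_exists r)"

text \<open>The facts of the tree of \<open>r\<close> with root \<open>v\<close>; the other nodes are numbered in preorder from \<open>k\<close>.\<close>

fun tree_facts :: "('u, 'b) eli \<Rightarrow> individual \<Rightarrow> nat \<Rightarrow> ('u, 'b) data_instance" where
  "tree_facts Top v k = {}"
| "tree_facts (Atom A) v k = {Unary A v}"
| "tree_facts (And r s) v k = tree_facts r v k \<union> tree_facts s v (k + num_exists r)"
| "tree_facts (Exists S r) v k = insert (edge S v k) (tree_facts r k (Suc k))"

definition canonical :: "('u, 'b) eli \<Rightarrow> ('u, 'b) data_instance" where
  "canonical r = tree_facts r 0 1"

lemma finite_tree_facts: "finite (tree_facts r v k)"
  by (induction r v k rule: tree_facts.induct) auto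

lemma card_tree_facts: "card (tree_facts r v k) \<le> eli_size r"
proof (induction r v k rule: tree_facts.induct)
  case (3 r s v k)
  then show ?case
    using card_Un_le[of "tree_facts r v k" "tree_facts s v (k + num_exists r)"] by simp
next
  case (4 S r v k)
  then show ?case by (simp add: card_insert_if finite_tree_facts)
qed auto

lemma inds_tree_facts: "inds (tree_facts r v k) \<subseteq> insert v {k..<k + num_exists r}"
proof (induction r v k rule: tree_facts.induct)
  case (4 S r v k)
  then show ?case by (auto simp: inds_insert inds_edge)
qed (fastforce simp: inds_Un inds_insert)+

lemma tree_facts_holds: "eli_holds (tree_facts r v k) v r"
proof (induction r v k rule: tree_facts.induct)
  case (3 r s v k)
  then show ?case by (auto intro: eli_holds_mono[rotated])
next
  case (4 S r v k)
  then show ?case unfolding eli_holds_Exists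
    by (intro exI[of _ k]) (auto intro: eli_holds_mono[rotated])
qed auto

text \<open>The clause that \<open>f\<close> agrees with \<open>g\<close> off the interval of new
  nodes makes the induction compose: in the \<open>And\<close> case the map for \<open>s\<close>
  changes nothing on the nodes of \<open>r\<close>, so the homomorphism found for \<open>r\<close>
  survives.\<close>

lemma tree_facts_hom:
  assumes "eli_holds J (g v) r" "v < k"
  shows "\<exists>f. hom f (tree_facts r v k) J \<and> (\<forall>a. a \<notin> {k..<k + num_exists r} \<longrightarrow> f a = g a)"
  using assms
proof (induction r arbitrary: g v k)
  case (And r s)
  obtain f where f: "hom f (tree_facts r v k) J" "\<And>a. a \<notin> {k..<k + num_exists r} \<Longrightarrow> f a = g a"
    using And.IH(1)[of g v k] And.prems by auto
  have fv: "f v = g v" using f(2)[of v] And.prems by auto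
  obtain f' where f': "hom f' (tree_facts s v (k + num_exists r)) J"
      "\<And>a. a \<notin> {k + num_exists r..<k + num_exists r + num_exists s} \<Longrightarrow> f' a = f a"
    using And.IH(2)[of f v "k + num_exists r"] And.prems fv by auto
  have "rename f' \<alpha> \<in> J" if "\<alpha> \<in> tree_facts r v k" for \<alpha>
  proof -
    have "assertion_inds \<alpha> \<subseteq> insert v {k..<k + num_exists r}"
      using inds_tree_facts[of r v k] that by (auto simp: inds_def)
    hence "rename f' \<alpha> = rename f \<alpha>"
      using And.prems(2) by (intro rename_cong f'(2)) auto
    thus ?thesis using f(1) that by (simp add: hom_def)
  qed
  hence "hom f' (tree_facts (And r s) v k) J" using f'(1) by (auto simp: hom_def)
  moreover have "f' a = g a" if "a \<notin> {k..<k + num_exists (And r s)}" for a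
    using that f(2)[of a] f'(2)[of a] by auto
  ultimately show ?case by blast
next
  case (Exists S r)
  obtain b where b: "edge S (g v) b \<in> J" "eli_holds J b r"
    using Exists.prems by (auto simp: eli_holds_Exists)
  obtain f where f: "hom f (tree_facts r k (Suc k)) J"
      "\<And>a. a \<notin> {Suc k..<Suc k + num_exists r} \<Longrightarrow> f a = (g(k := b)) a"
    using Exists.IH[of "g(k := b)" k "Suc k"] b by auto
  have "f v = g v" "f k = b" using f(2)[of v] f(2)[of k] Exists.prems by auto
  hence "hom f (tree_facts (Exists S r) v k) J"
    using f(1) b by (auto simp: hom_def rename_edge)
  moreover have "f a = g a" if "a \<notin> {k..<k + num_exists (Exists S r)}" for a
    using that f(2)[of a] by auto
  ultimately show ?case by blast
qed (auto simp: hom_def)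

lemma canonical_hom:
  assumes "eli_holds J a r"
  obtains f where "hom f (canonical r) J" "f 0 = a"
  using tree_facts_hom[of J "\<lambda>_. a" 0 r 1] assms by (auto simp: canonical_def)

lemma canonical_holds: "eli_holds (canonical r) 0 r"
  by (simp add: canonical_def tree_facts_holds)

lemma finite_canonical: "finite (canonical r)"
  by (simp add: canonical_def finite_tree_facts)

lemma card_canonical: "card (canonical r) \<le> eli_size r"
  by (simp add: canonical_def card_tree_facts)

lemma canonical_Top [simp]: "canonical Top = {}"
  by (simp add: canonical_def)

lemma eli_entails_iff_canonical: "eli_entails r s \<longleftrightarrow> eli_holds (canonical r) 0 s"
proof
  assume "eli_entails r s"
  moreover have "is_temporal_data [canonical r]"
    by (simp add: is_temporal_data_def finite_canonical)
  moreover have "holds [canonical r] 0 0 (r, [])"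
    by (simp add: holds_def at_time_def canonical_holds)
  ultimately have "holds [canonical r] 0 0 (s, [])"
    unfolding entails_def by blast
  thus "eli_holds (canonical r) 0 s" by (simp add: holds_def at_time_def)
next
  assume s: "eli_holds (canonical r) 0 s"
  show "eli_entails r s"
    unfolding entails_def holds_def
  proof (simp, intro allI impI)
    fix \<D> a l assume "eli_holds (at_time \<D> l) a r"
    then obtain f where "hom f (canonical r) (at_time \<D> l)" "f 0 = a" by (rule canonical_hom)
    thus "eli_holds (at_time \<D> l) a s" using eli_holds_hom s by metis
  qed
qed

lemma eli_entailsD: "eli_entails r s \<Longrightarrow> eli_holds I a r \<Longrightarrow> eli_holds I a s"
  by (metis canonical_hom eli_entails_iff_canonical eli_holds_hom)

lemma eli_entails_refl: "eli_entails r r"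
  by (simp add: entails_def)

lemma eli_entails_trans: "eli_entails r s \<Longrightarrow> eli_entails s t \<Longrightarrow> eli_entails r t"
  by (auto simp: entails_def)

lemma eli_entails_Top: "eli_entails r Top"
  by (simp add: eli_entails_iff_canonical)

lemma eli_entails_And: "eli_entails r (And s t) \<longleftrightarrow> eli_entails r s \<and> eli_entails r t"
  by (simp add: eli_entails_iff_canonical)

lemma And_eli_entails: "eli_entails (And s t) s" "eli_entails (And s t) t"
  using eli_entails_And eli_entails_refl by blast+

text \<open>At an individual without facts only \<open>Top\<close> and conjunctions of it can be
  true. This is what forces the non-tautological labels of a query onto nonempty letters of a
  word.\<close>

lemma eli_holds_isolated:
  assumes "eli_holds I a r" "a \<notin> inds I"
  shows "eli_entails s r"
  using assms
proof (induction r)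
  case (Atom A)
  then show ?case by (force simp: inds_def)
next
  case (Exists S r)
  then show ?case using edge_in_inds by (auto simp: eli_holds_Exists)
qed (auto simp: eli_entails_Top eli_entails_And)

lemma eli_holds_empty: "eli_holds {} a r \<Longrightarrow> eli_entails s r"
  using eli_holds_isolated by fastforce

lemma eli_equivalent_Top: "eli_equivalent r Top \<longleftrightarrow> eli_entails Top r"
  by (auto simp: equivalent_def eli_entails_Top)

section \<open>Frontiers\<close>

fun is_binary :: "('u, 'b) assertion \<Rightarrow> bool" where
  "is_binary (Unary A a) = False"
| "is_binary (Binary P a b) = True"

text \<open>Nodes are numbered in preorder, so the larger end of an edge is the child: an edge is
  named by its child.\<close>

fun top_ind :: "('u, 'b) assertion \<Rightarrow> individual" where
  "top_ind (Unary A a) = a"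
| "top_ind (Binary P a b) = max a b"

text \<open>Every \<open>Exists\<close> opens a new child, and the two conjuncts of an
  \<open>And\<close> number theirs from disjoint intervals, so each edge is determined by its
  child.\<close>

lemma tree_facts_binary:
  fixes r :: "('a, 'b) eli"
  shows "v < k \<Longrightarrow> inj_on top_ind {\<alpha> \<in> tree_facts r v k. is_binary \<alpha>} \<and>
    (\<forall>P a b. Binary P a b \<in> tree_facts r v k \<longrightarrow> a \<noteq> b \<and> max a b \<in> {k..<k + num_exists r})"
proof (induction r v k rule: tree_facts.induct)
  case (3 r s v k)
  note IH = 3(1)[OF 3(3)] 
  have "v < k + num_exists r" using 3(3) by simp
  note IH' = 3(2)[OF this]
  have i: "top_ind \<alpha> \<in> {k..<k + num_exists r}" if "\<alpha> \<in> tree_facts r v k" "is_binary \<alpha>" for \<alpha>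
    using IH that by (cases \<alpha>) auto
  have i': "top_ind \<alpha> \<in> {k + num_exists r..<k + num_exists r + num_exists s}"
    if "\<alpha> \<in> tree_facts s v (k + num_exists r)" "is_binary \<alpha>" for \<alpha>
    using IH' that by (cases \<alpha>) auto
  have "inj_on top_ind ({\<alpha> \<in> tree_facts r v k. is_binary \<alpha>} \<union>
      {\<alpha> \<in> tree_facts s v (k + num_exists r). is_binary \<alpha>})"
    unfolding inj_on_Un using IH IH' i i' by fastforce
  moreover have "{\<alpha> \<in> tree_facts (And r s) v k. is_binary \<alpha>} = {\<alpha> \<in> tree_facts r v k. is_binary \<alpha>} \<union>
      {\<alpha> \<in> tree_facts s v (k + num_exists r). is_binary \<alpha>}" by auto
  ultimately show ?case using IH IH' by fastforce
next
  case (4 S r v k)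
  note IH = 4(1)[OF lessI]
  have e: "is_binary (edge S v k :: ('a, 'b) assertion)" "top_ind (edge S v k :: ('a, 'b) assertion) = k"
    using 4(2) by (cases S; simp)+
  have i: "top_ind \<alpha> > k" if "\<alpha> \<in> tree_facts r k (Suc k)" "is_binary \<alpha>" for \<alpha>
    using IH that by (cases \<alpha>) fastforce+
  have "{\<alpha> \<in> tree_facts (Exists S r) v k. is_binary \<alpha>} =
      insert (edge S v k) {\<alpha> \<in> tree_facts r k (Suc k). is_binary \<alpha>}"
    using e by auto
  moreover have "top_ind (edge S v k :: ('a, 'b) assertion) \<noteq> top_ind \<alpha>"
    if "\<alpha> \<in> {\<alpha> \<in> tree_facts r k (Suc k). is_binary \<alpha>} - {edge S v k}" for \<alpha>
    using that i[of \<alpha>] unfolding e(2) by simp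
  hence "top_ind (edge S v k :: ('a, 'b) assertion) \<notin> top_ind ` ({\<alpha> \<in> tree_facts r k (Suc k). is_binary \<alpha>} - {edge S v k})"
    by (auto simp only: image_iff)
  hence "inj_on top_ind (insert (edge S v k) {\<alpha> \<in> tree_facts r k (Suc k). is_binary \<alpha>})"
    unfolding inj_on_insert using conjunct1[OF IH] by (rule conjI[rotated])
  moreover have "a \<noteq> b \<and> max a b \<in> {k..<k + num_exists (Exists S r)}"
    if B: "Binary P a b \<in> tree_facts (Exists S r) v k" for P a b
  proof -
    consider "Binary P a b = (edge S v k :: ('a, 'b) assertion)" | "Binary P a b \<in> tree_facts r k (Suc k)"
      using B by auto
    thus ?thesis
    proof cases
      case 1
      thus ?thesis using 4(2) by (cases S) auto
    next
      case 2
      thus ?thesis using IH by fastforce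
    qed
  qed
  ultimately show ?case by simp
qed (auto simp: inj_on_def)

text \<open>\<open>down X I v z\<close>: the subtree of \<open>X\<close> below \<open>v\<close> maps into \<open>I\<close> with \<open>v\<close> going to \<open>z\<close>.\<close>

inductive down :: "('u, 'b) data_instance \<Rightarrow> ('u, 'b) data_instance \<Rightarrow> individual \<Rightarrow> individual \<Rightarrow> bool"
  for X I where
  downI: "\<lbrakk>\<And>A. Unary A v \<in> X \<Longrightarrow> Unary A z \<in> I;
    \<And>P c. Binary P v c \<in> X \<Longrightarrow> v < c \<Longrightarrow> \<exists>z'. Binary P z z' \<in> I \<and> down X I c z';
    \<And>P c. Binary P c v \<in> X \<Longrightarrow> v < c \<Longrightarrow> \<exists>z'. Binary P z' z \<in> I \<and> down X I c z'\<rbrakk>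
   \<Longrightarrow> down X I v z"

text \<open>Steps lead from a node to a larger one only, that is from parent to child; closure under
  all edges follows later from the tree structure.\<close>

inductive_set reach :: "('u, 'b) data_instance \<Rightarrow> individual set" for X where
  reach0: "0 \<in> reach X"
| reach1: "v \<in> reach X \<Longrightarrow> Binary P v c \<in> X \<Longrightarrow> v < c \<Longrightarrow> c \<in> reach X"
| reach2: "v \<in> reach X \<Longrightarrow> Binary P c v \<in> X \<Longrightarrow> v < c \<Longrightarrow> c \<in> reach X"

text \<open>\<open>X\<close> plays the role of the core of the canonical tree of \<open>r\<close>.\<close>

locale core_tree =
  fixes X :: "('u, 'b) data_instance" and r :: "('u, 'b) eli"
  assumes sub: "X \<subseteq> canonical r"
    and X_holds: "eli_holds X 0 r"
    and minimal: "Y \<subseteq> X \<Longrightarrow> eli_holds Y 0 r \<Longrightarrow> Y = X"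
begin

lemma finite_X: "finite X"
  using sub finite_canonical finite_subset by blast

lemma binary_neq: "Binary P a b \<in> X \<Longrightarrow> a \<noteq> b"
  using tree_facts_binary[of 0 1 r] sub by (auto simp: canonical_def)

lemma binary_inj: "inj_on top_ind {\<alpha> \<in> X. is_binary \<alpha>}"
  using tree_facts_binary[of 0 1 r] sub
  by (auto simp: canonical_def intro: inj_on_subset)

lemma binary_unique: "\<alpha> \<in> X \<Longrightarrow> \<beta> \<in> X \<Longrightarrow> is_binary \<alpha> \<Longrightarrow> is_binary \<beta> \<Longrightarrow> top_ind \<alpha> = top_ind \<beta> \<Longrightarrow> \<alpha> = \<beta>"
  using binary_inj by (auto simp: inj_on_def)

lemma reach_parent:
  assumes "c \<in> reach X" "c \<noteq> 0"
  obtains f u where "f \<in> X" "is_binary f" "top_ind f = c" "assertion_inds f = {u, c}" "u < c" "u \<in> reach X"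
  using assms(1)
proof cases
  case (reach1 v P)
  then show ?thesis using that[of "Binary P v c" v] by (auto simp: max_def)
next
  case (reach2 v P)
  then show ?thesis using that[of "Binary P c v" v] by (auto simp: max_def)
qed (use assms in auto)

text \<open>An edge towards a smaller number leads to the parent, since the edge with a given child
  is unique; and the parent of a reachable node was reached before it.\<close>

lemma reach_edge: 
  assumes "edge S v w \<in> X" "v \<in> reach X"
  shows "w \<in> reach X"
proof (cases "v < w")
  case True
  then show ?thesis using assms by (cases S) (auto intro: reach1 reach2)
next
  case False
  have "v \<noteq> w" using assms(1) binary_neq by (cases S) auto
  hence "w < v" using False by simp
  hence "v \<noteq> 0" by simp
  then obtain f u where f: "f \<in> X" "is_binary f" "top_ind f = v" "assertion_inds f = {u, v}" "u < v" "u \<in> reach X"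
    using reach_parent assms(2) by blast
  have "f = edge S v w"
    using \<open>w < v\<close> by (intro binary_unique f assms) (use f in \<open>cases S; simp\<close>)+
  hence "u = w" using f(4,5) \<open>w < v\<close> by (auto simp: inds_edge doubleton_eq_iff)
  thus ?thesis using f by simp
qed

text \<open>The facts on reachable nodes alone satisfy \<open>r\<close> at the root, since
  evaluation never leaves these nodes. By minimality they are all of \<open>X\<close>.\<close>

lemma inds_reach: "inds X \<subseteq> reach X"
proof -
  define Y where "Y = {\<alpha> \<in> X. assertion_inds \<alpha> \<subseteq> reach X}"
  have "eli_holds Y v s" if "eli_holds X v s" "v \<in> reach X" for v s
    using that
  proof (induction s arbitrary: v)
    case (Atom A)
    then show ?case by (auto simp: Y_def)
  next
    case (Exists S s)
    then obtain w where w: "edge S v w \<in> X" "eli_holds X w s"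
      by (auto simp: eli_holds_Exists)
    hence "w \<in> reach X" using reach_edge Exists.prems by blast
    hence "eli_holds Y w s" "edge S v w \<in> Y"
      using Exists w by (auto simp: Y_def inds_edge)
    then show ?case by (auto simp: eli_holds_Exists)
  qed auto
  hence "eli_holds Y 0 r" using X_holds reach0 by blast
  hence "Y = X" using minimal by (auto simp: Y_def)
  thus ?thesis by (auto simp: Y_def inds_def)
qed

text \<open>Nodes are placed in increasing order. The only edge from node \<open>Suc n\<close> to
  smaller nodes is the one to its parent, whose image already satisfies \<open>down\<close>, so a
  suitable image of \<open>Suc n\<close> exists.\<close>

lemma down_hom:
  assumes "down X I 0 b"
  obtains m where "hom m X I" "m 0 = b"
proof -
  have "\<exists>m. m 0 = b \<and> (\<forall>c\<le>n. c \<in> reach X \<longrightarrow> down X I c (m c)) \<and> (\<forall>f\<in>X. top_ind f \<le> n \<longrightarrow> rename m f \<in> I)" for n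
  proof (induction n)
    case 0
    have "rename (\<lambda>_. b) f \<in> I" if "f \<in> X" "top_ind f \<le> 0" for f
    proof (cases f)
      case (Unary A a)
      then show ?thesis using assms that by (auto elim: down.cases)
    next
      case (Binary P x y)
      then show ?thesis using that binary_neq[of P x y] by auto
    qed
    then show ?case using assms by (intro exI[of _ "\<lambda>_. b"]) auto
  next
    case (Suc n)
    then obtain m where m: "m 0 = b" "\<And>c. c \<le> n \<Longrightarrow> c \<in> reach X \<Longrightarrow> down X I c (m c)"
      "\<And>f. f \<in> X \<Longrightarrow> top_ind f \<le> n \<Longrightarrow> rename m f \<in> I" by blast
    show ?case
    proof (cases "Suc n \<in> reach X")
      case False
      have "top_ind f \<in> assertion_inds f" for f :: "('u, 'b) assertion"
        by (cases f) (auto simp: max_def)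
      hence "\<forall>f\<in>X. top_ind f \<noteq> Suc n" using False inds_reach by (force simp: inds_def)
      thus ?thesis using m False by (metis le_SucE)
    next
      case True
      then obtain f u where f: "f \<in> X" "is_binary f" "top_ind f = Suc n" "assertion_inds f = {u, Suc n}"
        "u < Suc n" "u \<in> reach X"
        using reach_parent[of "Suc n"] by blast
      have du: "down X I u (m u)" using m(2) f by auto
      have "\<exists>z. rename (m(Suc n := z)) f \<in> I \<and> down X I (Suc n) z"
      proof (cases f)
        case (Binary P x y)
        then consider "x = u" "y = Suc n" | "x = Suc n" "y = u"
          using f(4,5) by (auto simp: doubleton_eq_iff)
        thus ?thesis
        proof cases
          case 1
          thus ?thesis using du f Binary by (auto elim!: down.cases)
        next
          case 2
          thus ?thesis using du f Binary by (auto elim!: down.cases)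
        qed
      qed (use f in auto)
      then obtain z where z: "rename (m(Suc n := z)) f \<in> I" "down X I (Suc n) z" by blast
      let ?m = "m(Suc n := z)"
      have "rename ?m g \<in> I" if "g \<in> X" "top_ind g \<le> Suc n" for g
      proof (cases "top_ind g = Suc n")
        case True
        show ?thesis
        proof (cases g)
          case (Unary A a)
          then show ?thesis using True z(2) that by (auto elim: down.cases)
        next
          case (Binary P a b)
          hence "g = f" using binary_unique[of g f] that f True by auto
          then show ?thesis using z by simp
        qed
      next
        case False
        hence "rename ?m g = rename m g" using that(2) by (intro rename_cong) (cases g; auto)
        thus ?thesis using m(3)[of g] that False by simp
      qed
      moreover have "down X I c (?m c)" if "c \<le> Suc n" "c \<in> reach X" for c
        using that z(2) m(2)[of c] by (auto simp: le_Suc_eq)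
      moreover have "?m 0 = b" using m(1) by simp
      ultimately show ?thesis by blast
    qed
  qed
  from this[of "Max (top_ind ` X)"] obtain m where m: "m 0 = b"
    "\<forall>f\<in>X. top_ind f \<le> Max (top_ind ` X) \<longrightarrow> rename m f \<in> I" by blast
  hence "hom m X I" using finite_X by (auto simp: hom_def)
  thus ?thesis using that m by blast
qed

lemma down_holds: "down X I 0 b \<Longrightarrow> eli_holds I b r"
  by (metis X_holds down_hom eli_holds_hom)

text \<open>
  In the frontier instance the node \<open>(v, Some f)\<close> is a copy of \<open>v\<close> giving up the incident fact \<open>f\<close>,
  and \<open>(0, None)\<close> is a copy of the root giving up only the distinction of being the root.
  A binary fact survives between two copies unless both of them give it up.
\<close>

definition nodes :: "(individual \<times> ('u, 'b) assertion option) set" where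
  "nodes = insert (0, None) {(v, Some f) | v f. f \<in> X \<and> v \<in> assertion_inds f}"

lemma finite_nodes: "finite nodes"
proof -
  have "nodes \<subseteq> insert (0, None) (\<Union>f\<in>X. (\<lambda>v. (v, Some f)) ` assertion_inds f)"
    by (auto simp: nodes_def)
  moreover have "finite (assertion_inds f)" for f :: "('u, 'b) assertion" by (cases f) auto
  hence "finite (insert (0, None) (\<Union>f\<in>X. (\<lambda>v. (v, Some f)) ` assertion_inds f))"
    using finite_X by simp
  ultimately show ?thesis by (rule finite_subset)
qed

context
  fixes e :: "individual \<times> ('u, 'b) assertion option \<Rightarrow> individual"
  assumes e: "inj_on e nodes"
begin

text \<open>Individuals are natural numbers, so the copies \<open>(v, g)\<close> enter the instance
  through the injection \<open>e\<close>.\<close>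

definition split_facts :: "('u, 'b) data_instance" where
  "split_facts = {Unary A (e (v, g)) | A v g. Unary A v \<in> X \<and> (v, g) \<in> nodes \<and> g \<noteq> Some (Unary A v)} \<union>
    {Binary P (e (u, g)) (e (v, h)) | P u v g h. Binary P u v \<in> X \<and> (u, g) \<in> nodes \<and> (v, h) \<in> nodes \<and>
       \<not> (g = Some (Binary P u v) \<and> h = Some (Binary P u v))}"

text \<open>A fact of the instance is determined by a fact of \<open>X\<close> and, for each of its
  at most two ends, by what the copy gives up: nothing or a fact of \<open>X\<close>.\<close>

lemma card_split_facts: "finite split_facts" "card split_facts \<le> card X * (card X + 1)\<^sup>2"
proof -
  let ?G = "insert None (Some ` X)"
  let ?F = "\<lambda>(f, g, h). case f of Unary A v \<Rightarrow> Unary A (e (v, g)) | Binary P u v \<Rightarrow> Binary P (e (u, g)) (e (v, h))"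
  have 1: "split_facts \<subseteq> ?F ` (X \<times> ?G \<times> ?G)"
  proof
    fix \<alpha> assume "\<alpha> \<in> split_facts"
    then consider (1) A v g where "\<alpha> = Unary A (e (v, g))" "Unary A v \<in> X" "(v, g) \<in> nodes"
      | (2) P u v g h where "\<alpha> = Binary P (e (u, g)) (e (v, h))" "Binary P u v \<in> X" "(u, g) \<in> nodes" "(v, h) \<in> nodes"
      unfolding split_facts_def by blast
    thus "\<alpha> \<in> ?F ` (X \<times> ?G \<times> ?G)"
    proof cases
      case 1
      then show ?thesis by (intro image_eqI[of _ _ "(Unary A v, g, None)"]) (auto simp: nodes_def)
    next
      case 2
      then show ?thesis by (intro image_eqI[of _ _ "(Binary P u v, g, h)"]) (auto simp: nodes_def)
    qed
  qed
  have fin: "finite (X \<times> ?G \<times> ?G)" using finite_X by auto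
  show "finite split_facts" using 1 fin finite_subset by blast
  have "card ?G \<le> card X + 1"
    using card_image_le[OF finite_X, of Some] card_insert_le_m1[of "card X + 1" "Some ` X" None] by simp
  hence "card (X \<times> ?G \<times> ?G) \<le> card X * ((card X + 1) * (card X + 1))"
    by (simp only: card_cartesian_product) (intro mult_le_mono; simp)
  moreover have "card split_facts \<le> card (X \<times> ?G \<times> ?G)"
    using 1 fin by (meson card_image_le card_mono finite_imageI le_trans)
  ultimately show "card split_facts \<le> card X * (card X + 1)\<^sup>2"
    by (simp add: power2_eq_square)
qed

lemma split_facts_Unary:
  "Unary A n \<in> split_facts \<longleftrightarrow> (\<exists>v g. n = e (v, g) \<and> Unary A v \<in> X \<and> (v, g) \<in> nodes \<and> g \<noteq> Some (Unary A v))"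
  by (auto simp: split_facts_def)

lemma split_facts_Binary:
  "Binary P n m \<in> split_facts \<longleftrightarrow> (\<exists>u v g h. n = e (u, g) \<and> m = e (v, h) \<and> Binary P u v \<in> X \<and>
     (u, g) \<in> nodes \<and> (v, h) \<in> nodes \<and> \<not> (g = Some (Binary P u v) \<and> h = Some (Binary P u v)))"
  by (auto simp: split_facts_def)

text \<open>
  A homomorphism of \<open>r\<close> into the frontier instance would induce an automorphism of \<open>X\<close> and a choice,
  injective on nodes, of an incident binary fact; but a tree has fewer edges than nodes.
\<close>

lemma split_facts_not_holds:
  assumes f0: "f0 \<in> X" "0 \<in> assertion_inds f0"
  shows "\<not> eli_holds split_facts (e (0, Some f0)) r"
proof
  assume "eli_holds split_facts (e (0, Some f0)) r"
  then obtain k where k: "hom k (canonical r) split_facts" "k 0 = e (0, Some f0)"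
    by (rule canonical_hom)
  have kX: "rename k \<alpha> \<in> split_facts" if "\<alpha> \<in> X" for \<alpha>
    using k(1) sub that by (auto simp: hom_def)
  define dec where "dec = inv_into nodes e"
  \<comment> \<open>An individual of the instance codes a pair: \<open>\<pi>\<close> reads off the
    node that is copied and \<open>g\<close> the fact that is given up.\<close>
  define \<pi> where "\<pi> v = fst (dec (k v))" for v
  define g where "g v = snd (dec (k v))" for v
  have dec: "dec (e x) = x" if "x \<in> nodes" for x
    using e that by (simp add: dec_def)
  have n0: "(0, Some f0) \<in> nodes" using f0 by (auto simp: nodes_def)
  have U: "Unary A (\<pi> v) \<in> X \<and> g v \<noteq> Some (Unary A (\<pi> v)) \<and> (\<pi> v, g v) \<in> nodes"
    if "Unary A v \<in> X" for A v
    using kX[OF that] dec by (auto simp: split_facts_Unary \<pi>_def g_def)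
  have B: "Binary P (\<pi> u) (\<pi> v) \<in> X \<and> (\<pi> u, g u) \<in> nodes \<and> (\<pi> v, g v) \<in> nodes \<and>
     \<not> (g u = Some (Binary P (\<pi> u) (\<pi> v)) \<and> g v = Some (Binary P (\<pi> u) (\<pi> v)))"
    if "Binary P u v \<in> X" for P u v
    using kX[OF that] dec by (fastforce simp: split_facts_Binary \<pi>_def g_def)
  have \<pi>0: "\<pi> 0 = 0" "g 0 = Some f0" using dec[OF n0] k(2) by (auto simp: \<pi>_def g_def)
  have hom: "rename \<pi> \<alpha> \<in> X" if "\<alpha> \<in> X" for \<alpha>
    using U B that by (cases \<alpha>) auto
  \<comment> \<open>Here minimality enters: the image of \<open>X\<close> under \<open>\<pi>\<close>
    lies in \<open>X\<close> and satisfies \<open>r\<close> at the root, so it is all of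
    \<open>X\<close>.\<close>
  have "hom \<pi> X (rename \<pi> ` X)" by (auto simp: hom_def)
  hence "eli_holds (rename \<pi> ` X) 0 r" using eli_holds_hom[OF _ X_holds] \<pi>0 by metis
  hence img: "rename \<pi> ` X = X" using minimal hom by (metis image_subsetI)
  hence "\<pi> ` inds X = inds X"
    unfolding inds_def image_UN by (metis (no_types, lifting) SUP_cong assertion_inds_rename image_image)
  moreover have fin: "finite (inds X)"
  proof -
    have "finite (assertion_inds f)" for f :: "('u, 'b) assertion" by (cases f) auto
    thus ?thesis using finite_X by (auto simp: inds_def)
  qed
  ultimately have inj: "inj_on \<pi> (inds X)" by (simp add: eq_card_imp_inj_on)
  have nd: "(\<pi> v, g v) \<in> nodes" if v: "v \<in> inds X" for v
  proof -
    obtain \<alpha> where "\<alpha> \<in> X" "v \<in> assertion_inds \<alpha>" using v unfolding inds_def by blast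
    thus ?thesis using U B by (cases \<alpha>) auto
  qed
  have i0: "0 \<in> inds X" using f0 by (auto simp: inds_def)
  \<comment> \<open>Only a copy of the root could give up \<open>None\<close>, but \<open>k\<close>
    sends the root to the copy giving up \<open>f0\<close>. A unary fact is not given up either: it
    is the image of a unary fact at \<open>v\<close>, and that image must survive.\<close>
  have "\<exists>f. g v = Some f \<and> f \<in> X \<and> \<pi> v \<in> assertion_inds f \<and> is_binary f" if v: "v \<in> inds X" for v
  proof -
    have "g v \<noteq> None"
    proof
      assume "g v = None"
      hence "\<pi> v = 0" using nd[OF v] by (auto simp: nodes_def)
      hence "v = 0" using inj v i0 \<pi>0 by (metis inj_onD)
      thus False using \<open>g v = None\<close> \<pi>0 by simp
    qed
    then obtain f where f: "g v = Some f" "f \<in> X" "\<pi> v \<in> assertion_inds f"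
      using nd[OF v] by (auto simp: nodes_def)
    have "is_binary f"
    proof (cases f)
      case (Unary A a)
      hence a: "a = \<pi> v" using f by simp
      obtain \<alpha> where \<alpha>: "\<alpha> \<in> X" "rename \<pi> \<alpha> = f" using f(2) img by force
      then obtain w where w: "\<alpha> = Unary A w" "\<pi> w = \<pi> v" using Unary a by (cases \<alpha>) auto
      have "w \<in> inds X" using \<alpha> w by (force simp: inds_def)
      hence "w = v" using inj v w by (meson inj_onD)
      thus ?thesis using U[of A v] \<alpha> w f Unary a by auto
    qed auto
    thus ?thesis using f by blast
  qed
  then obtain c where c: "\<And>v. v \<in> inds X \<Longrightarrow> g v = Some (c v) \<and> c v \<in> X \<and> \<pi> v \<in> assertion_inds (c v) \<and> is_binary (c v)"
    by metis
  \<comment> \<open>Two nodes giving up the same edge are mapped to its two ends. Then the edge of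
    \<open>X\<close> between these nodes would be mapped to an edge that both copies give up, and
    such an edge does not survive.\<close>
  have "inj_on c (inds X)"
  proof (rule inj_onI, rule ccontr)
    fix v w assume vw: "v \<in> inds X" "w \<in> inds X" "c v = c w" "v \<noteq> w"
    have ne: "\<pi> v \<noteq> \<pi> w" using inj vw by (meson inj_onD)
    obtain P x y where P: "c v = Binary P x y" using c[OF vw(1)] by (cases "c v") auto
    have xy: "(x = \<pi> v \<and> y = \<pi> w) \<or> (x = \<pi> w \<and> y = \<pi> v)"
    proof -
      have "\<pi> v \<in> {x, y}" "\<pi> w \<in> {x, y}"
        using c[OF vw(1)] c[OF vw(2)] unfolding vw(3)[symmetric] P by auto
      thus ?thesis using ne by auto
    qed
    obtain \<alpha> where \<alpha>: "\<alpha> \<in> X" "rename \<pi> \<alpha> = c v" using c[OF vw(1)] img by force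
    then obtain x' y' where \<alpha>': "\<alpha> = Binary P x' y'" "\<pi> x' = x" "\<pi> y' = y" using P by (cases \<alpha>) auto
    have "x' \<in> inds X" "y' \<in> inds X" using \<alpha> \<alpha>' by (force simp: inds_def)+
    hence "(x' = v \<and> y' = w) \<or> (x' = w \<and> y' = v)" using xy \<alpha>' inj vw by (metis inj_onD)
    thus False using B[of P x' y'] \<alpha> \<alpha>' P c[OF vw(1)] c[OF vw(2)] vw(3) by auto
  qed
  hence "card (inds X) \<le> card {\<alpha> \<in> X. is_binary \<alpha>}"
    using c finite_X by (intro card_inj_on_le) auto
  \<comment> \<open>Each edge is counted by its child, and the root is no child; so there are fewer
    edges than nodes.\<close>
  moreover have "card {\<alpha> \<in> X. is_binary \<alpha>} \<le> card (inds X - {0})"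
  proof (rule card_inj_on_le[OF binary_inj])
    show "top_ind ` {\<alpha> \<in> X. is_binary \<alpha>} \<subseteq> inds X - {0}"
    proof safe
      fix \<alpha> assume \<alpha>: "\<alpha> \<in> X" "is_binary \<alpha>"
      then obtain P a b where ab: "\<alpha> = Binary P a b" by (cases \<alpha>) auto
      show "top_ind \<alpha> \<in> inds X" using \<alpha> ab by (force simp: inds_def max_def)
      show "top_ind \<alpha> = 0 \<Longrightarrow> False" using \<alpha> ab binary_neq[of P a b] by auto
    qed
  qed (use fin in auto)
  moreover have "card (inds X - {0}) < card (inds X)" using fin i0 by (meson card_Diff1_less)
  ultimately show False by simp
qed

text \<open>
  A node gives up a fact failing below it if there is one, and the edge to its parent otherwise.
  If a node gives up the edge to a child, then something fails below the child, so the child does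
  not give up that edge as well.
\<close>

lemma split_facts_hom:
  assumes h: "hom h I X" "h b = 0" and nr: "\<not> eli_holds I b r"
  obtains f0 k where "f0 \<in> X" "0 \<in> assertion_inds f0" "hom k I split_facts" "k b = e (0, Some f0)"
proof -
  \<comment> \<open>\<open>fails v z f\<close> means that the fact \<open>f\<close> at
    \<open>v\<close>, with the subtree below it, cannot be matched at \<open>z\<close>.\<close>
  define fails where "fails v z f \<longleftrightarrow> f \<in> X \<and>
    ((\<exists>A. f = Unary A v \<and> Unary A z \<notin> I) \<or>
     (\<exists>P c. f = Binary P v c \<and> v < c \<and> \<not> (\<exists>z'. Binary P z z' \<in> I \<and> down X I c z')) \<or>
     (\<exists>P c. f = Binary P c v \<and> v < c \<and> \<not> (\<exists>z'. Binary P z' z \<in> I \<and> down X I c z')))" for v z f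
  have ex: "\<exists>f. fails v z f" if nd: "\<not> down X I v z" for v z
  proof (rule ccontr)
    assume "\<not> ?thesis"
    hence "down X I v z" unfolding fails_def by (intro downI) blast+
    thus False using nd by contradiction
  qed
  have "\<exists>g. (\<not> down X I (h z) z \<longrightarrow> (\<exists>f. g = Some f \<and> fails (h z) z f)) \<and>
     (down X I (h z) z \<longrightarrow> h z \<in> reach X \<longrightarrow>
        (if h z = 0 then g = None else \<exists>f\<in>X. g = Some f \<and> is_binary f \<and> top_ind f = h z \<and> h z \<in> assertion_inds f))" for z
    using ex[of "h z" z] reach_parent[of "h z"]
    by (cases "down X I (h z) z"; cases "h z = 0") (simp; metis insertCI)+
  then obtain g where g: "\<And>z. \<not> down X I (h z) z \<Longrightarrow> \<exists>f. g z = Some f \<and> fails (h z) z f"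
     "\<And>z. down X I (h z) z \<Longrightarrow> h z \<in> reach X \<Longrightarrow> h z = 0 \<Longrightarrow> g z = None"
     "\<And>z. down X I (h z) z \<Longrightarrow> h z \<in> reach X \<Longrightarrow> h z \<noteq> 0 \<Longrightarrow>
        \<exists>f\<in>X. g z = Some f \<and> is_binary f \<and> top_ind f = h z \<and> h z \<in> assertion_inds f"
    by metis
  have node: "(h z, g z) \<in> nodes" if "h z \<in> reach X" for z
  proof (cases "down X I (h z) z")
    case True
    then show ?thesis using g(2,3)[OF True that] by (cases "h z = 0") (auto simp: nodes_def)
  next
    case False
    then show ?thesis using g(1)[OF False] by (auto simp: nodes_def fails_def)
  qed
  define k where "k z = e (h z, g z)" for z
  \<comment> \<open>Here \<open>h z\<close> is the parent and \<open>h z'\<close> the child, and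
    both copies give up the edge between them. The parent does so only because the subtree below
    \<open>h z'\<close> does not map; but then the child gives up a failing fact below it, which the
    edge to its parent is not.\<close>
  have up: False if B: "Binary P u v \<in> X" and r: "h z \<in> reach X" "h z' \<in> reach X" and zz: "{h z, h z'} = {u, v}" "h z < h z'"
      and I: "Binary P (if u = h z then z else z') (if u = h z then z' else z) \<in> I"
      and "g z = Some (Binary P u v)" "g z' = Some (Binary P u v)" for P u v z z'
  proof -
    have uv: "(u = h z \<and> v = h z') \<or> (u = h z' \<and> v = h z)" using zz by (auto simp: doubleton_eq_iff)
    have "\<not> down X I (h z) z"
    proof
      assume d: "down X I (h z) z"
      hence "top_ind (Binary P u v) = h z" using g(2,3)[OF d r(1)] that by (cases "h z = 0") auto
      thus False using uv zz(2) by auto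
    qed
    hence "fails (h z) z (Binary P u v)" using g(1) that by fastforce
    hence "\<not> down X I (h z') z'" using uv I zz(2) by (auto simp: fails_def split: if_splits)
    hence "fails (h z') z' (Binary P u v)" using g(1) that by fastforce
    thus False using uv zz(2) by (auto simp: fails_def)
  qed
  have "rename k \<alpha> \<in> split_facts" if \<alpha>: "\<alpha> \<in> I" for \<alpha>
  proof (cases \<alpha>)
    case (Unary A z)
    hence X: "Unary A (h z) \<in> X" using h(1) \<alpha> by (force simp: hom_def)
    hence r: "h z \<in> reach X" using inds_reach by (force simp: inds_def)
    have "g z \<noteq> Some (Unary A (h z))"
    proof
      assume a: "g z = Some (Unary A (h z))"
      have "\<not> down X I (h z) z"
      proof
        assume d: "down X I (h z) z"
        show False using g(2,3)[OF d r] a by (cases "h z = 0") auto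
      qed
      thus False using g(1)[of z] a Unary \<alpha> by (auto simp: fails_def)
    qed
    thus ?thesis using Unary X node[OF r] by (auto simp: split_facts_Unary k_def)
  next
    case (Binary P z z')
    hence X: "Binary P (h z) (h z') \<in> X" using h(1) \<alpha> by (force simp: hom_def)
    hence r: "h z \<in> reach X" "h z' \<in> reach X" using inds_reach by (force simp: inds_def)+
    have ne: "h z \<noteq> h z'" using X binary_neq by blast
    have "\<not> (g z = Some (Binary P (h z) (h z')) \<and> g z' = Some (Binary P (h z) (h z')))"
    proof (cases "h z < h z'")
      case True
      thus ?thesis using up[OF X r] Binary \<alpha> by auto
    next
      case False
      thus ?thesis using up[OF X r(2,1)] ne Binary \<alpha> by (auto simp: insert_commute)
    qed
    thus ?thesis using Binary X node[OF r(1)] node[OF r(2)]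
      unfolding Binary rename.simps split_facts_Binary k_def by blast
  qed
  hence "hom k I split_facts" by (simp add: hom_def)
  moreover have "\<not> down X I (h b) b" using nr down_holds h(2) by metis
  then obtain f0 where "g b = Some f0" "fails 0 b f0" using g(1)[of b] h(2) by auto
  moreover from this have "f0 \<in> X" "0 \<in> assertion_inds f0" by (auto simp: fails_def)
  ultimately show ?thesis using that h(2) by (auto simp: k_def)
qed

end

end

section \<open>Existence of frontiers of polynomial size\<close>

definition frontier :: "('u, 'b) eli \<Rightarrow> ('u, 'b) data_instance set \<Rightarrow> bool" where
  "frontier r F \<longleftrightarrow> finite F \<and> card F \<le> eli_size r \<and>
     (\<forall>\<phi>\<in>F. finite \<phi> \<and> card \<phi> \<le> eli_size r * (eli_size r + 1)\<^sup>2 \<and> \<not> eli_holds \<phi> 0 r) \<and>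
     (\<forall>p. eli_entails r p \<longrightarrow> \<not> eli_entails p r \<longrightarrow> (\<exists>\<phi>\<in>F. eli_holds \<phi> 0 p))"

text \<open>The canonical tree is finite, hence has a minimal part \<open>X\<close> satisfying
  \<open>r\<close> at the root. There is one instance for each fact \<open>f0\<close> at the root of
  \<open>X\<close>, namely \<open>split_facts\<close> seen from the root copy that gives up
  \<open>f0\<close>.\<close>

lemma frontier_exists: "\<exists>F. frontier r F"
proof -
  have "finite {X. X \<subseteq> canonical r \<and> eli_holds X 0 r}"
    by (rule finite_subset[of _ "Pow (canonical r)"]) (auto simp: finite_canonical)
  moreover have "canonical r \<in> {X. X \<subseteq> canonical r \<and> eli_holds X 0 r}"
    by (simp add: canonical_holds)
  ultimately obtain X where X: "X \<in> {X. X \<subseteq> canonical r \<and> eli_holds X 0 r}"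
     "\<And>Y. Y \<in> {X. X \<subseteq> canonical r \<and> eli_holds X 0 r} \<Longrightarrow> Y \<subseteq> X \<Longrightarrow> Y = X"
    by (metis (no_types, lifting) empty_iff finite_has_minimal)
  interpret core_tree X r
    using X by unfold_locales auto
  obtain e :: "_ \<Rightarrow> nat" where e: "inj_on e nodes"
    using finite_imp_inj_to_nat_seg[OF finite_nodes] by metis
  let ?F = "split_facts e"
  \<comment> \<open>All instances are to have the root \<open>0\<close>. Swapping two individuals is
    its own inverse, hence a homomorphism in both directions.\<close>
  define sw where "sw f0 = (\<lambda>n. if n = e (0, Some f0) then 0 else if n = 0 then e (0, Some f0) else n)" for f0
  have sw: "sw f0 (sw f0 n) = n" "sw f0 (e (0, Some f0)) = 0" "sw f0 0 = e (0, Some f0)" for f0 n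
    by (auto simp: sw_def)
  define F where "F = (\<lambda>f0. rename (sw f0) ` ?F) ` {f0 \<in> X. 0 \<in> assertion_inds f0}"
  have cX: "card X \<le> eli_size r"
    using sub finite_canonical card_canonical by (meson card_mono le_trans)
  have h1: "hom (sw f0) ?F (rename (sw f0) ` ?F)" for f0 by (simp add: hom_def)
  have h2: "hom (sw f0) (rename (sw f0) ` ?F) ?F" for f0 by (auto simp: hom_def rename_rename sw)
  have "finite F" using finite_X by (simp add: F_def)
  moreover have "card F \<le> eli_size r"
  proof -
    have "card F \<le> card {f0 \<in> X. 0 \<in> assertion_inds f0}"
      unfolding F_def using finite_X by (intro card_image_le) auto
    also have "\<dots> \<le> card X" using finite_X by (intro card_mono) auto
    finally show ?thesis using cX by simp
  qed
  moreover have "finite \<phi> \<and> card \<phi> \<le> eli_size r * (eli_size r + 1)\<^sup>2 \<and> \<not> eli_holds \<phi> 0 r" if \<phi>: "\<phi> \<in> F" for \<phi>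
  proof -
    obtain f0 where f0: "f0 \<in> X" "0 \<in> assertion_inds f0" "\<phi> = rename (sw f0) ` ?F"
      using \<phi> by (auto simp: F_def)
    have "card \<phi> \<le> card ?F" using f0 card_split_facts(1)[OF e] by (simp add: card_image_le)
    also have "\<dots> \<le> card X * (card X + 1)\<^sup>2" by (rule card_split_facts(2)[OF e])
    also have "\<dots> \<le> eli_size r * (eli_size r + 1)\<^sup>2"
      using cX by (intro mult_le_mono power_mono) auto
    finally have "card \<phi> \<le> eli_size r * (eli_size r + 1)\<^sup>2" .
    moreover have "finite \<phi>" using f0(3) card_split_facts(1)[OF e] by simp
    moreover have "\<not> eli_holds \<phi> 0 r"
      using split_facts_not_holds[OF e f0(1,2)] eli_holds_hom[OF h2[of f0], of 0 r]
      unfolding f0(3) sw(3) by blast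
    ultimately show ?thesis by blast
  qed
  moreover have "\<exists>\<phi>\<in>F. eli_holds \<phi> 0 p" if p: "eli_entails r p" "\<not> eli_entails p r" for p
  proof -
    have "eli_holds X 0 p" using p X_holds eli_entailsD by blast
    then obtain h where "hom h (canonical p) X" "h 0 = 0" by (rule canonical_hom)
    moreover have "\<not> eli_holds (canonical p) 0 r" using p eli_entails_iff_canonical by blast
    ultimately obtain f0 k where k: "f0 \<in> X" "0 \<in> assertion_inds f0" "hom k (canonical p) ?F" "k 0 = e (0, Some f0)"
      by (rule split_facts_hom[OF e])
    have "eli_holds (rename (sw f0) ` ?F) 0 p"
      using eli_holds_hom[OF h1[of f0] eli_holds_hom[OF k(3) canonical_holds]] k(4) sw by metis
    thus ?thesis using k by (auto simp: F_def)
  qed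
  ultimately show ?thesis unfolding frontier_def by blast
qed

section \<open>Blocks and distances\<close>

text \<open>
  A query is given by its first block \<open>x\<close> and the list \<open>ps\<close> of the other blocks, each with the least
  distance from the last point of the preceding block to its first point: \<open>0\<close> for \<open>\<le>\<close> and \<open>n\<close> for
  \<open>n\<close> times \<open><\<close>.
\<close>

type_synonym ('u, 'b) later_blocks = "(nat \<times> ('u, 'b) eli list) list"

definition chain :: "(nat \<Rightarrow> ('u, 'b) eli \<Rightarrow> bool) \<Rightarrow> nat \<Rightarrow> ('u, 'b) eli list \<Rightarrow> bool" where
  "chain T t x \<longleftrightarrow> (\<forall>j<length x. T (t + j) (x ! j))"

text \<open>The last point of the chain is \<open>t + length x - 1\<close>, and the next block has
  to start at least \<open>d\<close> later; the inequality says this without subtraction and also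
  makes sense for an empty \<open>x\<close>.\<close>

fun sat :: "(nat \<Rightarrow> ('u, 'b) eli \<Rightarrow> bool) \<Rightarrow> nat \<Rightarrow> ('u, 'b) eli list \<Rightarrow> ('u, 'b) later_blocks \<Rightarrow> bool" where
  "sat T t x [] \<longleftrightarrow> chain T t x"
| "sat T t x ((d, y) # ps) \<longleftrightarrow> chain T t x \<and> (\<exists>t'. t + length x + d \<le> t' + 1 \<and> sat T t' y ps)"

definition truth :: "('u, 'b) temporal_data \<Rightarrow> individual \<Rightarrow> nat \<Rightarrow> ('u, 'b) eli \<Rightarrow> bool" where
  "truth \<D> a t r \<longleftrightarrow> eli_holds (at_time \<D> t) a r"

definition block :: "('u, 'b) eli list \<Rightarrow> ('u, 'b) later_blocks \<Rightarrow> nat \<Rightarrow> ('u, 'b) eli list" where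
  "block x ps v = (x # map snd ps) ! v"

definition gap :: "('u, 'b) later_blocks \<Rightarrow> nat \<Rightarrow> nat" where
  "gap ps v = fst (ps ! v)"

lemma block_0 [simp]: "block x ps 0 = x"
  by (simp add: block_def)

lemma block_Suc [simp]: "block x ((d, y) # ps) (Suc v) = block y ps v"
  by (simp add: block_def)

lemma gap_simps [simp]: "gap ((d, y) # ps) 0 = d" "gap (p # ps) (Suc v) = gap ps v"
  by (simp_all add: gap_def)

lemma sat_iff_starts:
  "sat T t x ps \<longleftrightarrow> (\<exists>s. s 0 = t \<and> (\<forall>v\<le>length ps. chain T (s v) (block x ps v)) \<and>
     (\<forall>v<length ps. s v + length (block x ps v) + gap ps v \<le> s (Suc v) + 1))"
proof (induction ps arbitrary: t x)
  case Nil
  then show ?case by auto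
next
  case (Cons p ps)
  obtain d y where p: "p = (d, y)" by (cases p)
  show ?case
  proof
    assume "sat T t x (p # ps)"
    then obtain t' where t': "chain T t x" "t + length x + d \<le> t' + 1" "sat T t' y ps" by (auto simp: p)
    then obtain s where s: "s 0 = t'" "\<forall>v\<le>length ps. chain T (s v) (block y ps v)"
      "\<forall>v<length ps. s v + length (block y ps v) + gap ps v \<le> s (Suc v) + 1" using Cons.IH by blast
    have "chain T (case_nat t s v) (block x (p # ps) v)" if "v \<le> length (p # ps)" for v
      using that t' s by (cases v) (auto simp: p)
    moreover have "case_nat t s v + length (block x (p # ps) v) + gap (p # ps) v \<le> case_nat t s (Suc v) + 1"
      if "v < length (p # ps)" for v
      using that t' s by (cases v) (auto simp: p)
    ultimately show "\<exists>s. s 0 = t \<and> (\<forall>v\<le>length (p # ps). chain T (s v) (block x (p # ps) v)) \<and>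
     (\<forall>v<length (p # ps). s v + length (block x (p # ps) v) + gap (p # ps) v \<le> s (Suc v) + 1)"
      by (intro exI[of _ "case_nat t s"]) auto
  next
    assume "\<exists>s. s 0 = t \<and> (\<forall>v\<le>length (p # ps). chain T (s v) (block x (p # ps) v)) \<and>
     (\<forall>v<length (p # ps). s v + length (block x (p # ps) v) + gap (p # ps) v \<le> s (Suc v) + 1)"
    then obtain s where s: "s 0 = t" "\<forall>v\<le>length (p # ps). chain T (s v) (block x (p # ps) v)"
     "\<forall>v<length (p # ps). s v + length (block x (p # ps) v) + gap (p # ps) v \<le> s (Suc v) + 1" by blast
    have "sat T (s 1) y ps"
      unfolding Cons.IH
    proof (intro exI[of _ "\<lambda>v. s (Suc v)"] conjI allI impI)
      fix v assume "v \<le> length ps" thus "chain T (s (Suc v)) (block y ps v)"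
        using s(2)[rule_format, of "Suc v"] by (simp add: p)
    next
      fix v assume "v < length ps"
      thus "s (Suc v) + length (block y ps v) + gap ps v \<le> s (Suc (Suc v)) + 1"
        using s(3)[rule_format, of "Suc v"] by (simp add: p)
    qed simp
    thus "sat T t x (p # ps)"
      using s(1) s(2)[rule_format, of 0] s(3)[rule_format, of 0] by (auto simp: p)
  qed
qed

text \<open>The restriction to a single \<open>\<le>\<close> or a sequence of \<open><\<close> needs
  no clause, since a number as distance leaves no other choice.\<close>

definition nf :: "('u, 'b) eli list \<Rightarrow> ('u, 'b) later_blocks \<Rightarrow> bool" where
  "nf x ps \<longleftrightarrow>
     (\<forall>v\<le>length ps. block x ps v \<noteq> []) \<and>
     (\<forall>v\<le>length ps. 0 < v \<longrightarrow> \<not> eli_entails Top (hd (block x ps v))) \<and>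
     (\<forall>v\<le>length ps. 0 < v \<or> 1 < length (block x ps v) \<longrightarrow> \<not> eli_entails Top (last (block x ps v))) \<and>
     (\<forall>v<length ps. gap ps v = 0 \<and> length (block x ps (Suc v)) = 1 \<longrightarrow>
        \<not> eli_entails (last (block x ps v)) (hd (block x ps (Suc v)))) \<and>
     (\<forall>v<length ps. 0 < v \<and> gap ps v = 0 \<and> length (block x ps v) = 1 \<longrightarrow>
        \<not> eli_entails (hd (block x ps (Suc v))) (last (block x ps v)))"

lemma nfD:
  assumes "nf x ps"
  shows "v \<le> length ps \<Longrightarrow> block x ps v \<noteq> []"
    "v \<le> length ps \<Longrightarrow> 0 < v \<Longrightarrow> \<not> eli_entails Top (hd (block x ps v))"
    "v \<le> length ps \<Longrightarrow> 0 < v \<or> 1 < length (block x ps v) \<Longrightarrow> \<not> eli_entails Top (last (block x ps v))"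
    "v < length ps \<Longrightarrow> gap ps v = 0 \<Longrightarrow> length (block x ps (Suc v)) = 1 \<Longrightarrow>
        \<not> eli_entails (last (block x ps v)) (hd (block x ps (Suc v)))"
    "v < length ps \<Longrightarrow> 0 < v \<Longrightarrow> gap ps v = 0 \<Longrightarrow> length (block x ps v) = 1 \<Longrightarrow>
        \<not> eli_entails (hd (block x ps (Suc v))) (last (block x ps v))"
  using assms unfolding nf_def by blast+

section \<open>Words of separated segments\<close>

definition word :: "nat \<Rightarrow> ('u, 'b) data_instance list list \<Rightarrow> ('u, 'b) temporal_data" where
  "word b ss = concat (map (\<lambda>s. s @ replicate b {}) ss)"

definition pos :: "nat \<Rightarrow> 'a list list \<Rightarrow> nat \<Rightarrow> nat" where
  "pos b ss u = (\<Sum>s\<leftarrow>take u ss. length s + b)"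

lemma pos_simps [simp]: "pos b ss 0 = 0" "pos b (s # ss) (Suc u) = length s + b + pos b ss u"
  by (simp_all add: pos_def)

lemma at_time_append: "at_time (xs @ ys) t = (if t < length xs then xs ! t else at_time ys (t - length xs))"
  by (auto simp: at_time_def nth_append)

lemma at_time_Nil: "at_time [] t = {}"
  by (simp add: at_time_def)

lemma at_time_word_Cons:
  "at_time (word b (s # ss)) t = (if t < length s then s ! t
     else if t < length s + b then {} else at_time (word b ss) (t - (length s + b)))"
  by (auto simp: word_def at_time_append simp flip: append_assoc) (auto simp: nth_append)

lemma at_time_word:
  "u < length ss \<Longrightarrow> j < length (ss ! u) \<Longrightarrow> at_time (word b ss) (pos b ss u + j) = ss ! u ! j"
proof (induction ss arbitrary: u)
  case (Cons s ss)
  then show ?case by (cases u) (auto simp: at_time_word_Cons)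
qed simp

lemma at_time_word_nonempty:
  "at_time (word b ss) t \<noteq> {} \<Longrightarrow> \<exists>u j. u < length ss \<and> j < length (ss ! u) \<and> t = pos b ss u + j"
proof (induction ss arbitrary: t)
  case Nil
  then show ?case by (simp add: word_def at_time_Nil)
next
  case (Cons s ss)
  show ?case
  proof (cases "t < length s")
    case True
    then have "0 < length (s # ss) \<and> t < length ((s # ss) ! 0) \<and> t = pos b (s # ss) 0 + t" by simp
    then show ?thesis by blast
  next
    case False
    hence t: "t \<ge> length s + b" "at_time (word b ss) (t - (length s + b)) \<noteq> {}"
      using Cons.prems by (auto simp: at_time_word_Cons split: if_splits)
    then obtain u j where "u < length ss" "j < length (ss ! u)" "t - (length s + b) = pos b ss u + j"
      using Cons.IH by blast
    then show ?thesis using t by (intro exI[of _ "Suc u"] exI[of _ j]) auto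
  qed
qed

lemma pos_less:
  "u < u' \<Longrightarrow> u' < length ss \<Longrightarrow> pos b ss u + length (ss ! u) + b \<le> pos b ss u'"
proof (induction ss arbitrary: u u')
  case (Cons s ss)
  then obtain w where "u' = Suc w" by (cases u') auto
  then show ?case using Cons.prems Cons.IH[of "u - 1" w] by (cases u) auto
qed simp

text \<open>Embeddings into the segments: block \<open>v\<close> goes to segment \<open>\<sigma> v\<close>, at offset \<open>f v\<close>.\<close>

definition seg_emb :: "('u, 'b) data_instance list list \<Rightarrow> ('u, 'b) eli list \<Rightarrow> ('u, 'b) later_blocks \<Rightarrow>
    (nat \<Rightarrow> nat) \<Rightarrow> (nat \<Rightarrow> nat) \<Rightarrow> bool" where
  "seg_emb ss x ps \<sigma> f \<longleftrightarrow> \<sigma> 0 = 0 \<and> f 0 = 0 \<and>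
     (\<forall>v\<le>length ps. \<sigma> v < length ss \<and> f v + length (block x ps v) \<le> length (ss ! \<sigma> v) \<and>
        (\<forall>j<length (block x ps v). eli_holds (ss ! \<sigma> v ! (f v + j)) 0 (block x ps v ! j))) \<and>
     (\<forall>v<length ps. \<sigma> v < \<sigma> (Suc v) \<or>
        \<sigma> v = \<sigma> (Suc v) \<and> f v + length (block x ps v) + gap ps v \<le> f (Suc v) + 1)"

lemma seg_embD:
  assumes "seg_emb ss x ps \<sigma> f"
  shows "\<sigma> 0 = 0" "f 0 = 0"
    "v \<le> length ps \<Longrightarrow> \<sigma> v < length ss"
    "v \<le> length ps \<Longrightarrow> f v + length (block x ps v) \<le> length (ss ! \<sigma> v)"
    "v \<le> length ps \<Longrightarrow> j < length (block x ps v) \<Longrightarrow> eli_holds (ss ! \<sigma> v ! (f v + j)) 0 (block x ps v ! j)"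
    "v < length ps \<Longrightarrow> \<sigma> v < \<sigma> (Suc v) \<or>
        \<sigma> v = \<sigma> (Suc v) \<and> f v + length (block x ps v) + gap ps v \<le> f (Suc v) + 1"
  using assms unfolding seg_emb_def by blast+

lemma seg_emb_mono:
  assumes "seg_emb ss x ps \<sigma> f" "v \<le> w" "w \<le> length ps"
  shows "\<sigma> v \<le> \<sigma> w"
  using assms(2,3)
proof (induction w rule: dec_induct)
  case (step w)
  then show ?case using seg_embD(6)[OF assms(1), of w] by linarith
qed simp

text \<open>Within a segment the offsets give the distances; between two segments lie
  \<open>b\<close> empty letters, as many as any distance demands.\<close>

lemma seg_emb_sat:
  assumes e: "seg_emb ss x ps \<sigma> f" and b: "\<forall>v<length ps. gap ps v \<le> b"
  shows "sat (truth (word b ss) 0) 0 x ps"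
  unfolding sat_iff_starts
proof (intro exI[of _ "\<lambda>v. pos b ss (\<sigma> v) + f v"] conjI allI impI)
  show "pos b ss (\<sigma> 0) + f 0 = 0" using seg_embD(1,2)[OF e] by simp
next
  fix v assume v: "v \<le> length ps"
  show "chain (truth (word b ss) 0) (pos b ss (\<sigma> v) + f v) (block x ps v)"
    using seg_embD(3-5)[OF e v] at_time_word[of "\<sigma> v" ss _ b]
    by (auto simp: chain_def truth_def add.assoc)
next
  fix v assume v: "v < length ps"
  show "pos b ss (\<sigma> v) + f v + length (block x ps v) + gap ps v \<le> pos b ss (\<sigma> (Suc v)) + f (Suc v) + 1"
    using seg_embD(6)[OF e v]
  proof
    assume "\<sigma> v < \<sigma> (Suc v)"
    hence "pos b ss (\<sigma> v) + length (ss ! \<sigma> v) + b \<le> pos b ss (\<sigma> (Suc v))"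
      using v by (intro pos_less seg_embD(3)[OF e]) auto
    moreover have "f v + length (block x ps v) \<le> length (ss ! \<sigma> v)" using v by (intro seg_embD(4)[OF e]) auto
    moreover have "gap ps v \<le> b" using b v by blast
    ultimately show ?thesis by linarith
  qed auto
qed

text \<open>In normal form the first label of a later block and the last label of a block with
  several points are no tautologies, so both ends lie in segments, and a block of length at most
  \<open>b\<close> cannot span the empty letters between two segments. The first block is held by
  time \<open>0\<close> instead.\<close>

lemma sat_seg_emb:
  assumes s: "sat (truth (word b ss) 0) 0 x ps" and nf: "nf x ps"
    and len: "\<forall>v\<le>length ps. length (block x ps v) \<le> b"
    and ss: "ss \<noteq> []" "hd ss \<noteq> []"
  shows "\<exists>\<sigma> f. seg_emb ss x ps \<sigma> f"
proof -
  obtain s where s: "s 0 = 0" "\<And>v. v \<le> length ps \<Longrightarrow> chain (truth (word b ss) 0) (s v) (block x ps v)"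
     "\<And>v. v < length ps \<Longrightarrow> s v + length (block x ps v) + gap ps v \<le> s (Suc v) + 1"
    using s unfolding sat_iff_starts by blast
  have T: "eli_holds (at_time (word b ss) (s v + j)) 0 (block x ps v ! j)"
    if "v \<le> length ps" "j < length (block x ps v)" for v j
    using s(2)[OF that(1)] that(2) by (auto simp: chain_def truth_def)
  have inseg: "\<exists>u k. u < length ss \<and> k < length (ss ! u) \<and> s v + j = pos b ss u + k"
    if "v \<le> length ps" "j < length (block x ps v)" "\<not> eli_entails Top (block x ps v ! j)" for v j
  proof (rule at_time_word_nonempty)
    show "at_time (word b ss) (s v + j) \<noteq> {}"
    proof
      assume "at_time (word b ss) (s v + j) = {}"
      hence "eli_holds {} 0 (block x ps v ! j)" using T[OF that(1,2)] by simp
      thus False using eli_holds_empty that(3) by blast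
    qed
  qed
  have ex: "\<exists>u k. u < length ss \<and> k + length (block x ps v) \<le> length (ss ! u) \<and> s v = pos b ss u + k"
    if v: "v \<le> length ps" for v
  proof -
    let ?n = "length (block x ps v)"
    have ne: "block x ps v \<noteq> []" "0 < ?n" using nfD(1)[OF nf v] by auto
    have "\<exists>u k. u < length ss \<and> k < length (ss ! u) \<and> s v = pos b ss u + k"
    proof (cases "v = 0")
      case True
      thus ?thesis using s(1) ss by (intro exI[of _ 0]) (auto simp: hd_conv_nth)
    next
      case False
      thus ?thesis using inseg[OF v, of 0] nfD(2)[OF nf v] ne by (auto simp: hd_conv_nth)
    qed
    then obtain u k where u: "u < length ss" "k < length (ss ! u)" "s v = pos b ss u + k" by blast
    have "k + ?n \<le> length (ss ! u)"
    proof (cases "?n = 1")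
      case True
      thus ?thesis using u by simp
    next
      case False
      hence "1 < ?n" using ne(2) by linarith
      hence "\<not> eli_entails Top (block x ps v ! (?n - 1))" using nfD(3)[OF nf v] ne by (simp add: last_conv_nth)
      then obtain u' k' where u': "u' < length ss" "k' < length (ss ! u')" "s v + (?n - 1) = pos b ss u' + k'"
        using inseg[OF v, of "?n - 1"] ne by auto
      have nb: "?n \<le> b" using len v by blast
      have "u' = u"
      proof (rule linorder_cases[of u u'])
        assume "u < u'"
        hence "pos b ss u + length (ss ! u) + b \<le> pos b ss u'" using u' by (intro pos_less)
        thus ?thesis using u u' nb ne by linarith
      next
        assume "u' < u"
        hence "pos b ss u' + length (ss ! u') + b \<le> pos b ss u" using u by (intro pos_less)
        thus ?thesis using u u' nb ne by linarith
      qed simp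
      thus ?thesis using u u' ne by (simp)
    qed
    thus ?thesis using u by blast
  qed
  then obtain \<sigma> f where \<sigma>: "\<And>v. v \<le> length ps \<Longrightarrow> \<sigma> v < length ss \<and> f v + length (block x ps v) \<le> length (ss ! \<sigma> v) \<and> s v = pos b ss (\<sigma> v) + f v"
    by metis
  have ne: "0 < length (block x ps v)" if "v \<le> length ps" for v using nfD(1)[OF nf that] by simp
  have 0: "\<sigma> 0 = 0"
  proof (rule ccontr)
    assume "\<sigma> 0 \<noteq> 0"
    hence "pos b ss 0 + length (ss ! 0) + b \<le> pos b ss (\<sigma> 0)" using \<sigma>[of 0] by (intro pos_less) auto
    moreover have "length (ss ! 0) > 0" using ss by (simp add: hd_conv_nth)
    ultimately show False using \<sigma>[of 0] s(1) by simp
  qed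
  have "\<sigma> v < \<sigma> (Suc v) \<or> \<sigma> v = \<sigma> (Suc v) \<and> f v + length (block x ps v) + gap ps v \<le> f (Suc v) + 1"
    if v: "v < length ps" for v
  proof (rule linorder_cases[of "\<sigma> v" "\<sigma> (Suc v)"])
    assume e: "\<sigma> v = \<sigma> (Suc v)"
    thus ?thesis using s(3)[OF v] \<sigma>[of v] \<sigma>[of "Suc v"] v by simp
  next
    assume "\<sigma> (Suc v) < \<sigma> v"
    hence "pos b ss (\<sigma> (Suc v)) + length (ss ! \<sigma> (Suc v)) + b \<le> pos b ss (\<sigma> v)"
      using \<sigma>[of v] v by (intro pos_less) auto
    moreover have "s v = pos b ss (\<sigma> v) + f v" "s (Suc v) = pos b ss (\<sigma> (Suc v)) + f (Suc v)"
      "f (Suc v) + length (block x ps (Suc v)) \<le> length (ss ! \<sigma> (Suc v))"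
      "0 < length (block x ps v)" "0 < length (block x ps (Suc v))"
      using \<sigma>[of v] \<sigma>[of "Suc v"] ne[of v] ne[of "Suc v"] v by auto
    ultimately show ?thesis using s(3)[OF v] by linarith
  qed simp
  moreover have "eli_holds (ss ! \<sigma> v ! (f v + j)) 0 (block x ps v ! j)"
    if "v \<le> length ps" "j < length (block x ps v)" for v j
    using T[OF that] \<sigma>[OF that(1)] that(2) at_time_word[of "\<sigma> v" ss "f v + j" b] by (simp add: add.assoc)
  ultimately have "seg_emb ss x ps \<sigma> f" unfolding seg_emb_def using \<sigma> \<sigma>[of 0] 0 s(1) by auto
  thus ?thesis by blast
qed

section \<open>Rigidity of queries in normal form\<close>

lemma length_1_nth: "length l = Suc 0 \<Longrightarrow> hd l = l ! 0" "length l = Suc 0 \<Longrightarrow> last l = l ! 0"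
  by (cases l; simp)+

lemma length_pos_nth: "0 < length l \<Longrightarrow> hd l = l ! 0" "0 < length l \<Longrightarrow> last l = l ! (length l - 1)"
  by (simp_all add: hd_conv_nth last_conv_nth)

definition segments :: "('u, 'b) eli list \<Rightarrow> ('u, 'b) later_blocks \<Rightarrow> ('u, 'b) data_instance list list" where
  "segments x ps = map (map canonical) (x # map snd ps)"

lemma length_segments [simp]: "length (segments x ps) = Suc (length ps)"
  by (simp add: segments_def)

lemma segments_nth: "i \<le> length ps \<Longrightarrow> segments x ps ! i = map canonical (block x ps i)"
  by (simp add: segments_def block_def nth_map[symmetric] del: nth_map list.map(2))
     (simp add: nth_Cons')

text \<open>Only an upper bound on what the letters make true. This suffices for contradicting the
  normal form, and it also holds for the letters of another query with equivalent labels.\<close>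

definition like :: "('u, 'b) data_instance list \<Rightarrow> ('u, 'b) eli list \<Rightarrow> bool" where
  "like s x \<longleftrightarrow> length s = length x \<and> (\<forall>j<length x. \<forall>r. eli_holds (s ! j) 0 r \<longrightarrow> eli_entails (x ! j) r)"

lemma like_canonical: "like (map canonical x) x"
  by (simp add: like_def eli_entails_iff_canonical)

text \<open>If block \<open>l + 1\<close> joined block \<open>l\<close> in segment \<open>l\<close>,
  which block \<open>l\<close> already fills, only the last letter would be left for it: it would be
  primitive, at distance 0 and entailed by the last label of block \<open>l\<close>, against the
  normal form.\<close>

lemma seg_left:
  assumes nf: "nf y qs" and e: "seg_emb ss y qs \<sigma> f" and i: "i \<le> length qs"
    and like: "\<And>l. l < i \<Longrightarrow> like (ss ! l) (block y qs l)"
  shows "l \<le> i \<Longrightarrow> l \<le> \<sigma> l"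
proof (induction l)
  case (Suc l)
  hence l: "l < length qs" "l \<le> \<sigma> l" "l < i" using i by auto
  show ?case
  proof (rule ccontr)
    assume "\<not> ?thesis"
    hence s: "\<sigma> l = l" "\<sigma> (Suc l) = l" using l seg_embD(6)[OF e l(1)] by auto
    note lk = like[OF l(3)]
    have len: "length (ss ! l) = length (block y qs l)" using lk by (simp add: like_def)
    have ne: "0 < length (block y qs l)" "0 < length (block y qs (Suc l))" using nfD(1)[OF nf] l by auto
    have f: "f (Suc l) + length (block y qs (Suc l)) \<le> length (block y qs l)"
      "f l + length (block y qs l) + gap qs l \<le> f (Suc l) + 1"
      using seg_embD(4)[OF e, of "Suc l"] seg_embD(6)[OF e l(1)] s l len by auto
    hence g: "gap qs l = 0" "length (block y qs (Suc l)) = 1" "f (Suc l) = length (block y qs l) - 1"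
      using ne by linarith+
    have "eli_holds (ss ! l ! f (Suc l)) 0 (hd (block y qs (Suc l)))"
      using seg_embD(5)[OF e, of "Suc l" 0] s l ne by (simp add: hd_conv_nth)
    hence "eli_entails (last (block y qs l)) (hd (block y qs (Suc l)))"
      using lk g ne by (auto simp: like_def last_conv_nth)
    thus False using nfD(4)[OF nf l(1) g(1,2)] by blast
  qed
qed simp

text \<open>Mirror image of \<open>seg_left\<close>, from the last block down: a block sharing the
  segment of its successor would be primitive on the first letter. Segments are shifted by
  \<open>m - 1\<close> because \<open>m\<close> pieces may replace segment \<open>i\<close>;
  \<open>m = 0\<close> covers words with two merged segments.\<close>

lemma seg_right:
  assumes nf: "nf y qs" and e: "seg_emb ss y qs \<sigma> f" and i: "i \<le> length qs"
    and like: "\<And>l. i < l \<Longrightarrow> l \<le> length qs \<Longrightarrow> like (ss ! (l + m - 1)) (block y qs l)"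
    and len: "length ss = length qs + m" and m: "0 < m \<or> 0 < i"
  shows "i \<le> l \<Longrightarrow> l \<le> length qs \<Longrightarrow> \<sigma> l < l + m"
proof (induction "length qs - l" arbitrary: l)
  case 0
  then show ?case using seg_embD(3)[OF e, of l] len by auto
next
  case (Suc k)
  hence l: "l < length qs" "i \<le> l" by auto
  have IH: "\<sigma> (Suc l) < Suc l + m" using Suc.hyps(1)[of "Suc l"] Suc.hyps(2) l by auto
  show ?case
  proof (rule ccontr)
    assume "\<not> ?thesis"
    hence s: "\<sigma> l = l + m" "\<sigma> (Suc l) = l + m" using IH seg_embD(6)[OF e l(1)] by auto
    have l0: "0 < l" using s seg_embD(1)[OF e] m l by (cases "l = 0") auto
    have lk: "like (ss ! (l + m)) (block y qs (Suc l))" using like[of "Suc l"] l by simp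
    have len: "length (ss ! (l + m)) = length (block y qs (Suc l))" using lk by (simp add: like_def)
    have ne: "0 < length (block y qs l)" "0 < length (block y qs (Suc l))" using nfD(1)[OF nf] l by auto
    have f: "f (Suc l) = 0"
      "f l + length (block y qs l) + gap qs l \<le> f (Suc l) + 1"
      using seg_embD(4)[OF e, of "Suc l"] seg_embD(6)[OF e l(1)] s l len by auto
    hence g: "gap qs l = 0" "length (block y qs l) = 1" "f l = 0"
      using ne by linarith+
    have "eli_holds (ss ! (l + m) ! 0) 0 (last (block y qs l))"
      using seg_embD(5)[OF e, of l 0] s l ne g by (simp add: length_1_nth)
    hence "eli_entails (hd (block y qs (Suc l))) (last (block y qs l))"
      using lk g ne by (auto simp: like_def hd_conv_nth)
    thus False using nfD(5)[OF nf l(1) l0 g(1,2)] by blast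
  qed
qed

definition replace :: "nat \<Rightarrow> 'a list \<Rightarrow> 'a list \<Rightarrow> 'a list" where
  "replace i ms ss = take i ss @ ms @ drop (Suc i) ss"

lemma replace_nth:
  assumes "i < length ss"
  shows "l < i \<Longrightarrow> replace i ms ss ! l = ss ! l"
    "l < length ms \<Longrightarrow> replace i ms ss ! (i + l) = ms ! l"
    "i < l \<Longrightarrow> l < length ss \<Longrightarrow> replace i ms ss ! (l + length ms - 1) = ss ! l"
    "length (replace i ms ss) + 1 = length ss + length ms"
  using assms by (auto simp: replace_def nth_append)

text \<open>\<open>seg_left\<close> and \<open>seg_right\<close> bound the segment of block
  \<open>i\<close> from both sides, which leaves only the pieces \<open>ms\<close>.\<close>

lemma replaced_seg_emb:
  assumes nf: "nf x ps" and i: "i \<le> length ps" and ms: "ms \<noteq> []"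
    and e: "seg_emb (replace i ms (segments x ps)) x ps \<sigma> f"
  obtains m where "m < length ms" "\<sigma> i = i + m" "f i + length (block x ps i) \<le> length (ms ! m)"
    "\<And>j. j < length (block x ps i) \<Longrightarrow> eli_holds (ms ! m ! (f i + j)) 0 (block x ps i ! j)"
proof -
  let ?S = "segments x ps"
  have iS: "i < length ?S" using i by simp
  have "i \<le> \<sigma> i"
    by (rule seg_left[OF nf e i]) (use i in \<open>auto simp: replace_nth(1)[OF iS] segments_nth like_canonical\<close>)
  moreover have "\<sigma> i < i + length ms"
    by (rule seg_right[OF nf e i])
       (use i ms replace_nth(4)[OF iS, of ms] in
         \<open>simp_all add: replace_nth(3)[OF iS] segments_nth like_canonical del: One_nat_def\<close>)
  ultimately obtain m where m: "m < length ms" "\<sigma> i = i + m"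
    by (metis add_less_cancel_left le_Suc_ex)
  hence "replace i ms ?S ! \<sigma> i = ms ! m" using replace_nth(2)[OF iS] by simp
  thus ?thesis using that[OF m] seg_embD(4,5)[OF e i] by simp
qed

text \<open>Both blocks \<open>i\<close> and \<open>Suc i\<close> are squeezed into segment
  \<open>i\<close>, whose length leaves room for a distance of at most \<open>d\<close>.\<close>

lemma merged_seg_emb:
  assumes nf: "nf y qs" and e: "seg_emb ss y qs \<sigma> f" and i: "i < length qs"
    and left: "\<And>l. l < i \<Longrightarrow> like (ss ! l) (block y qs l)"
    and right: "\<And>l. Suc i < l \<Longrightarrow> l \<le> length qs \<Longrightarrow> like (ss ! (l - 1)) (block y qs l)"
    and len: "length ss = length qs"
    and leni: "length (ss ! i) + 1 = length (block y qs i) + length (block y qs (Suc i)) + d"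
  shows "gap qs i \<le> d"
proof -
  have l: "i \<le> \<sigma> i" by (rule seg_left[OF nf e _ left]) (use i in auto)
  have "\<sigma> (Suc i) < Suc i + 0"
    by (rule seg_right[OF nf e, of "Suc i" 0]) (use i len right in auto)
  hence s: "\<sigma> i = i" "\<sigma> (Suc i) = i" using l seg_embD(6)[OF e i] by auto
  show ?thesis
    using seg_embD(6)[OF e i] seg_embD(4)[OF e, of "Suc i"] s i leni nfD(1)[OF nf, of i] by auto
qed

text \<open>How an embedding is redirected: the blocks in segment \<open>i\<close> are distributed
  over the pieces by \<open>\<mu>\<close> and \<open>g\<close>, all others keep their segment. For
  \<open>i = 0\<close> the first block has to stay at the very beginning.\<close>

lemma seg_emb_replace:
  assumes e: "seg_emb ss y qs \<sigma> f" and i: "i < length ss"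
    and \<mu>: "\<And>v. v \<le> length qs \<Longrightarrow> \<sigma> v = i \<Longrightarrow> \<mu> v < length ms \<and> g v + length (block y qs v) \<le> length (ms ! \<mu> v) \<and>
      (\<forall>j<length (block y qs v). eli_holds (ms ! \<mu> v ! (g v + j)) 0 (block y qs v ! j))"
    and step: "\<And>v. v < length qs \<Longrightarrow> \<sigma> v = i \<Longrightarrow> \<sigma> (Suc v) = i \<Longrightarrow> \<mu> v < \<mu> (Suc v) \<or>
      \<mu> v = \<mu> (Suc v) \<and> g v + length (block y qs v) + gap qs v \<le> g (Suc v) + 1"
    and start: "i = 0 \<Longrightarrow> \<mu> 0 = 0 \<and> g 0 = 0"
  shows "\<exists>\<sigma> f. seg_emb (replace i ms ss) y qs \<sigma> f"
proof -
  define \<sigma>' where "\<sigma>' v = (if \<sigma> v < i then \<sigma> v else if \<sigma> v = i then i + \<mu> v else \<sigma> v + length ms - 1)" for v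
  define f' where "f' v = (if \<sigma> v = i then g v else f v)" for v
  have "seg_emb (replace i ms ss) y qs \<sigma>' f'"
    unfolding seg_emb_def
  proof (intro conjI allI impI)
    show "\<sigma>' 0 = 0" "f' 0 = 0" using seg_embD(1,2)[OF e] start by (auto simp: \<sigma>'_def f'_def)
  next
    fix v assume v: "v < length qs"
    show "\<sigma>' v < \<sigma>' (Suc v) \<or> \<sigma>' v = \<sigma>' (Suc v) \<and> f' v + length (block y qs v) + gap qs v \<le> f' (Suc v) + 1"
      using seg_embD(6)[OF e v]
    proof
      assume s: "\<sigma> v < \<sigma> (Suc v)"
      have "\<sigma>' v < \<sigma>' (Suc v)" using s \<mu>[of v] v by (auto simp: \<sigma>'_def)
      thus ?thesis ..
    next
      assume "\<sigma> v = \<sigma> (Suc v) \<and> f v + length (block y qs v) + gap qs v \<le> f (Suc v) + 1"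
      hence s: "\<sigma> (Suc v) = \<sigma> v" "f v + length (block y qs v) + gap qs v \<le> f (Suc v) + 1" by auto
      show ?thesis
      proof (cases "\<sigma> v = i")
        case True
        thus ?thesis using step[OF v True] s(1) unfolding \<sigma>'_def f'_def by simp
      next
        case False
        thus ?thesis using s unfolding \<sigma>'_def f'_def by simp
      qed
    qed
  next
    fix v assume v: "v \<le> length qs"
    have nth: "replace i ms ss ! \<sigma>' v = (if \<sigma> v = i then ms ! \<mu> v else ss ! \<sigma> v)"
      using replace_nth[OF i] \<mu>[OF v] seg_embD(3)[OF e v] unfolding \<sigma>'_def by auto
    show "\<sigma>' v < length (replace i ms ss)"
      using seg_embD(3)[OF e v] \<mu>[OF v] replace_nth(4)[OF i, of ms] i unfolding \<sigma>'_def by auto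
    show "f' v + length (block y qs v) \<le> length (replace i ms ss ! \<sigma>' v)"
      unfolding nth using seg_embD(4)[OF e v] \<mu>[OF v] unfolding f'_def by auto
    fix j assume j: "j < length (block y qs v)"
    show "eli_holds (replace i ms ss ! \<sigma>' v ! (f' v + j)) 0 (block y qs v ! j)"
      unfolding nth using seg_embD(5)[OF e v j] \<mu>[OF v] j unfolding f'_def by auto
  qed
  thus ?thesis by blast
qed

section \<open>Queries fitting the examples\<close>

text \<open>\<open>x\<close>, \<open>ps\<close> is the query to be characterised, and \<open>y\<close>, \<open>qs\<close> a query fitting the examples.\<close>

locale fitting =
  fixes x :: "('u, 'b) eli list" and ps and y :: "('u, 'b) eli list" and qs and \<sigma> f
    and F :: "('u, 'b) eli \<Rightarrow> ('u, 'b) data_instance set"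
  assumes nf_ps: "nf x ps" and nf_qs: "nf y qs"
    and emb: "seg_emb (segments x ps) y qs \<sigma> f"
    and F: "\<And>r. frontier r (F r)"
begin

abbreviation "X i \<equiv> block x ps i"
abbreviation "Y v \<equiv> block y qs v"
abbreviation "CX i \<equiv> map canonical (block x ps i)"

definition refuted :: "nat \<Rightarrow> ('u, 'b) data_instance list list \<Rightarrow> bool" where
  "refuted i ms \<longleftrightarrow> \<not> (\<exists>\<sigma> f. seg_emb (replace i ms (segments x ps)) y qs \<sigma> f)"

definition matched :: "nat \<Rightarrow> nat \<Rightarrow> bool" where
  "matched i v \<longleftrightarrow> v \<le> length qs \<and> \<sigma> v = i \<and> f v = 0 \<and> length (Y v) = length (X i) \<and>
     (\<forall>j<length (X i). eli_entails (X i ! j) (Y v ! j) \<and> eli_entails (Y v ! j) (X i ! j))"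

lemma \<sigma>_le: "v \<le> length qs \<Longrightarrow> \<sigma> v \<le> length ps"
  using seg_embD(3)[OF emb, of v] by simp

lemma Y_fits: "v \<le> length qs \<Longrightarrow> f v + length (Y v) \<le> length (X (\<sigma> v))"
  using seg_embD(4)[OF emb, of v] \<sigma>_le[of v] by (simp add: segments_nth)

lemma X_entails_Y: "v \<le> length qs \<Longrightarrow> j < length (Y v) \<Longrightarrow> eli_entails (X (\<sigma> v) ! (f v + j)) (Y v ! j)"
  using seg_embD(5)[OF emb, of v j] \<sigma>_le[of v] Y_fits[of v]
  by (simp add: segments_nth eli_entails_iff_canonical)

lemma Y_ne: "v \<le> length qs \<Longrightarrow> 0 < length (Y v)"
  using nfD(1)[OF nf_qs] by auto

lemma X_ne: "i \<le> length ps \<Longrightarrow> 0 < length (X i)"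
  using nfD(1)[OF nf_ps] by auto

lemma same_seg: "v < length qs \<Longrightarrow> \<sigma> v = \<sigma> (Suc v) \<Longrightarrow> f v + length (Y v) + gap qs v \<le> f (Suc v) + 1"
  using seg_embD(6)[OF emb, of v] by auto

lemma frontierD: "eli_entails r p \<Longrightarrow> \<not> eli_entails p r \<Longrightarrow> \<exists>\<phi>\<in>F r. eli_holds \<phi> 0 p"
  using F[of r] by (auto simp: frontier_def)

text \<open>The matched block fills its segment, so a successor there would be a primitive block at
  distance 0 on the last letter, with a label entailed by the last label of the matched block. This
  contradicts the normal form of \<open>y\<close>, \<open>qs\<close>.\<close>

lemma matched_next:
  assumes m: "matched i v" and v: "v < length qs"
  shows "\<sigma> (Suc v) \<noteq> i"
proof
  assume s: "\<sigma> (Suc v) = i"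
  have m': "\<sigma> v = i" "f v = 0" "length (Y v) = length (X i)" using m by (auto simp: matched_def)
  have ne: "0 < length (Y v)" "0 < length (Y (Suc v))" using Y_ne v by auto
  have g: "gap qs v = 0" "length (Y (Suc v)) = 1" "f (Suc v) = length (X i) - 1"
  proof -
    have "length (X i) + gap qs v \<le> f (Suc v) + 1" using same_seg[OF v] m' s by simp
    moreover have "f (Suc v) + length (Y (Suc v)) \<le> length (X i)" using Y_fits[of "Suc v"] s v by simp
    ultimately show "gap qs v = 0" "length (Y (Suc v)) = 1" "f (Suc v) = length (X i) - 1"
      using ne by linarith+
  qed
  have "eli_entails (X i ! (length (X i) - 1)) (hd (Y (Suc v)))"
    using X_entails_Y[of "Suc v" 0] g s v ne by (simp add: length_1_nth)
  moreover have "eli_entails (last (Y v)) (X i ! (length (X i) - 1))"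
    using m ne by (auto simp: matched_def length_pos_nth(2)[OF ne(1)])
  ultimately show False using nfD(4)[OF nf_qs v g(1,2)] eli_entails_trans by blast
qed

lemma matched_prev:
  assumes m: "matched i (Suc v)" and v: "v < length qs" and i: "0 < i"
  shows "\<sigma> v \<noteq> i"
proof
  assume s: "\<sigma> v = i"
  hence v0: "0 < v" using i seg_embD(1)[OF emb] by (cases v) auto
  have m': "\<sigma> (Suc v) = i" "f (Suc v) = 0" "length (Y (Suc v)) = length (X i)" using m by (auto simp: matched_def)
  have ne: "0 < length (Y v)" "0 < length (Y (Suc v))" using Y_ne v by auto
  have g: "gap qs v = 0" "length (Y v) = 1" "f v = 0"
    using same_seg[OF v] unfolding s m'(1,2) using ne by linarith+
  have "eli_entails (X i ! 0) (last (Y v))"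
    using X_entails_Y[of v 0] g s v ne by (simp add: length_1_nth)
  moreover have "eli_entails (hd (Y (Suc v))) (X i ! 0)"
    using m ne by (auto simp: matched_def length_pos_nth(1)[OF ne(2)])
  ultimately show False using nfD(5)[OF nf_qs v v0 g(1,2)] eli_entails_trans by blast
qed

text \<open>As \<open>\<sigma>\<close> is monotone, any further block in the segment would bring a
  neighbour of the matched block into it.\<close>

lemma matched_unique:
  assumes m: "matched i v" and i: "i = 0 \<longrightarrow> v = 0" and w: "w \<le> length qs" "\<sigma> w = i"
  shows "w = v"
proof (rule linorder_cases[of v w])
  assume "v < w"
  moreover have "\<sigma> v = i" using m by (simp add: matched_def)
  ultimately have "\<sigma> (Suc v) = i"
    using seg_emb_mono[OF emb, of v "Suc v"] seg_emb_mono[OF emb, of "Suc v" w] w by auto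
  thus ?thesis using matched_next[OF m] \<open>v < w\<close> w by auto
next
  assume wv: "w < v"
  then obtain u where u: "v = Suc u" by (cases v) auto
  have v: "\<sigma> v = i" "v \<le> length qs" using m by (auto simp: matched_def)
  hence "\<sigma> u = i"
    using seg_emb_mono[OF emb, of w u] seg_emb_mono[OF emb, of u v] w wv u by auto
  thus ?thesis using matched_prev[of i u] m u wv i v by auto
qed simp

text \<open>In the negative example the first block goes to the weakened copy of the segment and all
  other blocks of the segment to the intact copy behind it; a weaker label of \<open>y\<close> would
  make this an embedding.\<close>

lemma match_first:
  assumes refuted: "\<And>j \<phi>. j < length x \<Longrightarrow> \<phi> \<in> F (x ! j) \<Longrightarrow> refuted 0 [(map canonical x)[j := \<phi>], map canonical x]"
  shows "matched 0 0"
proof -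
  have s0: "\<sigma> 0 = 0" "f 0 = 0" using seg_embD(1,2)[OF emb] by auto
  have S0: "segments x ps ! 0 = map canonical x" by (simp add: segments_nth)
  have key: "j < length y \<and> eli_entails (y ! j) (x ! j)"
    if j: "j < length x" and nt: "\<not> (j < length y \<and> eli_entails (y ! j) (x ! j))" and top: "\<not> eli_entails Top (x ! j)" for j
  proof -
    have "\<exists>\<phi>\<in>F (x ! j). j < length y \<longrightarrow> eli_holds \<phi> 0 (y ! j)"
    proof (cases "j < length y")
      case True
      thus ?thesis using frontierD[of "x ! j" "y ! j"] nt X_entails_Y[of 0 j] s0 by auto
    next
      \<comment> \<open>Without a label at position \<open>j\<close> any frontier instance serves;
        there is one because \<open>Top\<close> is strictly weaker than
        \<open>x ! j\<close>.\<close>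
      case False
      thus ?thesis using frontierD[OF eli_entails_Top top] by auto
    qed
    then obtain \<phi> where \<phi>: "\<phi> \<in> F (x ! j)" "j < length y \<Longrightarrow> eli_holds \<phi> 0 (y ! j)" by blast
    let ?ms = "[(map canonical x)[j := \<phi>], map canonical x]"
    have "\<exists>\<sigma> f. seg_emb (replace 0 ?ms (segments x ps)) y qs \<sigma> f"
    proof (rule seg_emb_replace[OF emb, where \<mu> = "\<lambda>v. if v = 0 then 0 else 1" and g = f])
      fix v assume v: "v \<le> length qs" "\<sigma> v = 0"
      show "(if v = 0 then 0 else 1) < length ?ms \<and>
         f v + length (block y qs v) \<le> length (?ms ! (if v = 0 then 0 else 1)) \<and>
         (\<forall>k<length (Y v). eli_holds (?ms ! (if v = 0 then 0 else 1) ! (f v + k)) 0 (Y v ! k))"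
      proof -
        have "eli_holds ((map canonical x)[j := \<phi>] ! k) 0 (y ! k)" if "v = 0" "k < length y" for k
        proof (cases "k = j")
          case True
          thus ?thesis using \<phi>(2) j that by simp
        next
          case False
          thus ?thesis using seg_embD(5)[OF emb v(1), of k] that S0 s0 by simp
        qed
        moreover have "eli_holds (map canonical x ! (f v + k)) 0 (Y v ! k)" if "k < length (Y v)" for k
          using seg_embD(5)[OF emb v(1) that] v S0 by simp
        ultimately show ?thesis using Y_fits[OF v(1)] v s0 by auto
      qed
    next
      fix v assume "v < length qs" "\<sigma> v = 0" "\<sigma> (Suc v) = 0"
      thus "(if v = 0 then 0 else 1) < (if Suc v = 0 then 0 else 1::nat) \<or> (if v = 0 then 0 else 1) = (if Suc v = 0 then 0 else 1::nat) \<and>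
         f v + length (Y v) + gap qs v \<le> f (Suc v) + 1"
        using same_seg[of v] by auto
    qed (use s0 in auto)
    thus ?thesis using refuted[OF j \<phi>(1)] by (simp add: refuted_def)
  qed
  hence key: "j < length y \<and> eli_entails (y ! j) (x ! j)" if "j < length x" "\<not> eli_entails Top (x ! j)" for j
    using that by blast
  have len: "length y \<le> length x" using Y_fits[of 0] s0 by simp
  \<comment> \<open>Tautological labels yield nothing in \<open>key\<close>, but the last label of a
    chain with several points is none, and this fixes the length.\<close>
  have "length y = length x"
  proof (rule ccontr)
    assume "length y \<noteq> length x"
    hence l: "length y < length x" using len by simp
    moreover have "0 < length y" using Y_ne[of 0] by simp
    ultimately have "1 < length x" by linarith
    hence "\<not> eli_entails Top (last x)" using nfD(3)[OF nf_ps, of 0] by simp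
    hence "\<not> eli_entails Top (x ! (length x - 1))" using length_pos_nth(2)[of x] l by fastforce
    moreover have "length x - 1 < length x" using l by simp
    ultimately have "length x - 1 < length y" using key by blast
    thus False using l by simp
  qed
  moreover have "eli_entails (x ! j) (y ! j) \<and> eli_entails (y ! j) (x ! j)" if j: "j < length x" for j
    using X_entails_Y[of 0 j] key[OF j] s0 j calculation eli_entails_trans[OF eli_entails_Top, of "x ! j" "y ! j"]
    by auto
  ultimately show ?thesis using s0 by (auto simp: matched_def)
qed

text \<open>Without a block of full length, every block in the segment misses its first or its last
  letter and fits into one of the two shortened copies. With a full block \<open>v\<close>, the
  other blocks in the segment are single points on the first or last letter and go to the outer
  pieces, so a weaker label in \<open>v\<close> would let \<open>v\<close> use the weakened
  copy.\<close>

lemma match_long: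
  assumes i: "0 < i" "i \<le> length ps" and long: "1 < length (X i)"
    and split: "refuted i [butlast (CX i), tl (CX i)]"
    and weak: "\<And>j \<phi>. j < length (X i) \<Longrightarrow> \<phi> \<in> F (X i ! j) \<Longrightarrow>
      refuted i [[hd (CX i)], (CX i)[j := \<phi>], [last (CX i)]]"
  shows "\<exists>v. matched i v"
proof -
  let ?n = "length (X i)"
  have Si: "segments x ps ! i = CX i" using i by (simp add: segments_nth)
  have iS: "i < length (segments x ps)" using i by simp
  have fits: "f v + length (Y v) \<le> ?n" if "v \<le> length qs" "\<sigma> v = i" for v
    using Y_fits[OF that(1)] that by simp
  have letter: "eli_holds (CX i ! (f v + k)) 0 (Y v ! k)" if "v \<le> length qs" "\<sigma> v = i" "k < length (Y v)" for v k
    using seg_embD(5)[OF emb that(1,3)] that(2) Si by simp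
  have "\<exists>v\<le>length qs. \<sigma> v = i \<and> length (Y v) = ?n"
  proof (rule ccontr)
    assume no: "\<not> ?thesis"
    \<comment> \<open>A block goes to the copy without the last letter whenever it fits; otherwise
      to the copy without the first letter, where its offset drops by one.\<close>
    define \<mu> where "\<mu> v = (if f v + length (Y v) < ?n then 0 else 1::nat)" for v
    have "\<exists>\<sigma> f. seg_emb (replace i [butlast (CX i), tl (CX i)] (segments x ps)) y qs \<sigma> f"
    proof (rule seg_emb_replace[OF emb iS, where \<mu> = \<mu> and g = "\<lambda>v. f v - \<mu> v"])
      fix v assume v: "v \<le> length qs" "\<sigma> v = i"
      have "\<mu> v = 0 \<and> f v + length (Y v) < ?n \<or> \<mu> v = 1 \<and> f v + length (Y v) = ?n \<and> 0 < f v"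
        using fits[OF v] no v by (auto simp: \<mu>_def)
      thus "\<mu> v < length [butlast (CX i), tl (CX i)] \<and>
        f v - \<mu> v + length (Y v) \<le> length ([butlast (CX i), tl (CX i)] ! \<mu> v) \<and>
        (\<forall>j<length (Y v). eli_holds ([butlast (CX i), tl (CX i)] ! \<mu> v ! (f v - \<mu> v + j)) 0 (Y v ! j))"
        using letter[OF v] by (auto simp: nth_butlast nth_tl)
    next
      fix v assume v: "v < length qs" "\<sigma> v = i" "\<sigma> (Suc v) = i"
      have "f v + length (Y v) + gap qs v \<le> f (Suc v) + 1" using same_seg[of v] v by simp
      moreover have "0 < length (Y (Suc v))" "0 < length (Y v)" using Y_ne v by auto
      moreover have "f (Suc v) + length (Y (Suc v)) \<le> ?n" using fits[of "Suc v"] v by simp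
      moreover have "0 < f v" if "\<mu> v = 1"
      proof -
        have "f v + length (Y v) = ?n" using that fits[of v] v by (auto simp: \<mu>_def split: if_splits)
        moreover have "length (Y v) \<noteq> ?n" using no v by auto
        ultimately show ?thesis by simp
      qed
      moreover have "0 < f (Suc v)" if "\<mu> (Suc v) = 1"
      proof -
        have "f (Suc v) + length (Y (Suc v)) = ?n" using that fits[of "Suc v"] v by (auto simp: \<mu>_def split: if_splits)
        moreover have "length (Y (Suc v)) \<noteq> ?n" using no v by auto
        ultimately show ?thesis by simp
      qed
      moreover have "\<mu> v = 0 \<or> \<mu> v = 1" "\<mu> (Suc v) = 0 \<or> \<mu> (Suc v) = 1" by (auto simp: \<mu>_def)
      moreover have "\<mu> (Suc v) = 1" if "\<mu> v = 1"
      proof -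
        have "\<not> f v + length (Y v) < ?n" using that by (auto simp: \<mu>_def)
        hence "\<not> f (Suc v) + length (Y (Suc v)) < ?n" using calculation(1-4) by linarith
        thus ?thesis by (simp add: \<mu>_def)
      qed
      ultimately show "\<mu> v < \<mu> (Suc v) \<or>
          \<mu> v = \<mu> (Suc v) \<and> f v - \<mu> v + length (Y v) + gap qs v \<le> f (Suc v) - \<mu> (Suc v) + 1"
        by auto
    qed (use i in auto)
    thus False using split by (simp add: refuted_def)
  qed
  then obtain v where v: "v \<le> length qs" "\<sigma> v = i" "length (Y v) = ?n" by blast
  have fv: "f v = 0" using fits[OF v(1,2)] v(3) by simp
  have "eli_entails (Y v ! j) (X i ! j)" if j: "j < ?n" for j
  proof (rule ccontr)
    assume n: "\<not> ?thesis"
    have "eli_entails (X i ! j) (Y v ! j)" using X_entails_Y[OF v(1), of j] v fv j by simp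
    then obtain \<phi> where \<phi>: "\<phi> \<in> F (X i ! j)" "eli_holds \<phi> 0 (Y v ! j)" using frontierD n by blast
    let ?ms = "[[hd (CX i)], (CX i)[j := \<phi>], [last (CX i)]]"
    define \<mu> where "\<mu> w = (if w < v then 0 else if w = v then 1 else 2::nat)" for w
    have before: "length (Y w) = 1 \<and> f w = 0" if "w < v" "\<sigma> w = i" for w
    proof -
      have "\<sigma> (Suc w) = i"
        using seg_emb_mono[OF emb, of w "Suc w"] seg_emb_mono[OF emb, of "Suc w" v] that v by auto
      moreover have "f u = 0" if "Suc w \<le> u" "u \<le> v" for u
        using that(2,1)
      proof (induction u rule: inc_induct)
        case (step u)
        have "\<sigma> u = i" "\<sigma> (Suc u) = i"
          using seg_emb_mono[OF emb, of w u] seg_emb_mono[OF emb, of u v] seg_emb_mono[OF emb, of w "Suc u"] 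
            seg_emb_mono[OF emb, of "Suc u" v] step.prems step.hyps v \<open>\<sigma> w = i\<close> by auto
        hence "f u + length (Y u) + gap qs u \<le> 0 + 1" "0 < length (Y u)"
          using same_seg[of u] Y_ne[of u] step v by auto
        thus ?case by linarith
      qed (use fv in simp)
      ultimately have "f w + length (Y w) + gap qs w \<le> 0 + 1" "0 < length (Y w)"
        using same_seg[of w] Y_ne[of w] that v by auto
      thus ?thesis by linarith
    qed
    have after: "length (Y w) = 1 \<and> f w = ?n - 1" if "v < w" "\<sigma> w = i" "w \<le> length qs" for w
      using that
    proof (induction w rule: less_induct)
      case (less w)
      then obtain u where u: "w = Suc u" by (cases w) auto
      have "\<sigma> u = i" using seg_emb_mono[OF emb, of v u] seg_emb_mono[OF emb, of u w] less.prems v u by auto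
      hence s: "f u + length (Y u) + gap qs u \<le> f w + 1" using same_seg[of u] less.prems u by auto
      have "f u + length (Y u) = ?n"
        using less.IH[of u] less.prems u \<open>\<sigma> u = i\<close> v fv long by (cases "u = v") auto
      moreover have "0 < length (Y w)" "f w + length (Y w) \<le> ?n" using fits[of w] less.prems Y_ne[of w] by auto
      ultimately have "length (Y w) = 1" "f w = ?n - 1" using s by linarith+
      thus ?case by simp
    qed
    have "\<exists>\<sigma> f. seg_emb (replace i ?ms (segments x ps)) y qs \<sigma> f"
    proof (rule seg_emb_replace[OF emb iS, where \<mu> = \<mu> and g = "\<lambda>_. 0"])
      fix w assume w: "w \<le> length qs" "\<sigma> w = i"
      consider "w < v" | "w = v" | "v < w" by linarith
      thus "\<mu> w < length ?ms \<and> 0 + length (Y w) \<le> length (?ms ! \<mu> w) \<and>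
        (\<forall>j<length (Y w). eli_holds (?ms ! \<mu> w ! (0 + j)) 0 (Y w ! j))"
      proof cases
        case 1
        thus ?thesis using before[OF 1 w(2)] letter[OF w, of 0] long length_pos_nth(1)[of "CX i"] by (auto simp: \<mu>_def simp del: length_greater_0_conv)
      next
        case 2
        have "eli_holds ((CX i)[j := \<phi>] ! k) 0 (Y v ! k)" if "k < length (Y v)" for k
        proof (cases "k = j")
          case True
          thus ?thesis using \<phi>(2) j by simp
        next
          case False
          thus ?thesis using letter[OF v(1,2) that] fv by simp
        qed
        thus ?thesis using 2 v(3) by (auto simp: \<mu>_def)
      next
        case 3
        thus ?thesis using after[OF 3 w(2,1)] letter[OF w, of 0] long length_pos_nth(2)[of "CX i"] by (auto simp: \<mu>_def numeral_2_eq_2 simp del: length_greater_0_conv)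
      qed
    next
      fix w assume w: "w < length qs" "\<sigma> w = i" "\<sigma> (Suc w) = i"
      have s: "f w + length (Y w) + gap qs w \<le> f (Suc w) + 1" using same_seg[of w] w by simp
      consider "Suc w < v" | "Suc w = v" | "w = v" | "v < w" by linarith
      thus "\<mu> w < \<mu> (Suc w) \<or> \<mu> w = \<mu> (Suc w) \<and> 0 + length (Y w) + gap qs w \<le> 0 + 1"
      proof cases
        case 1
        thus ?thesis using before[of w] before[of "Suc w"] w s by (auto simp: \<mu>_def)
      next
        case 4
        thus ?thesis using after[of w] after[of "Suc w"] w s by (auto simp: \<mu>_def)
      qed (auto simp: \<mu>_def)
    qed (use i in auto)
    thus False using weak[OF j \<phi>(1)] by (simp add: refuted_def)
  qed
  hence "matched i v" using v fv X_entails_Y[OF v(1)] by (auto simp: matched_def)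
  thus ?thesis by blast
qed

end

text \<open>Weak monotonicity is enough: consecutive blocks in a one-letter segment are at distance
  0, so they may share a letter among the pieces too.\<close>

definition covers :: "('u, 'b) data_instance list \<Rightarrow> ('u, 'b) eli \<Rightarrow> nat \<Rightarrow> bool" where
  "covers \<psi> r n \<longleftrightarrow> (\<forall>p. (\<forall>u<n. eli_entails r (p u) \<and> \<not> eli_entails (p u) r) \<longrightarrow>
     (\<exists>\<mu>. mono \<mu> \<and> (\<forall>u<n. \<mu> u < length \<psi> \<and> eli_holds (\<psi> ! \<mu> u) 0 (p u))))"

context fitting
begin

text \<open>Blocks in a one-letter segment are single points with labels entailed by
  \<open>hd (X i)\<close>. Were all of them strictly weaker, they could be placed along
  \<open>\<psi>\<close>.\<close>

lemma match_primitive: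
  assumes i: "0 < i" "i \<le> length ps" and prim: "length (X i) = 1"
    and c: "\<And>n. n \<le> length qs \<Longrightarrow> covers \<psi> (hd (X i)) n"
    and r: "refuted i (map (\<lambda>\<phi>. [\<phi>]) \<psi>)"
  shows "\<exists>v. matched i v"
proof -
  let ?r = "hd (X i)"
  have X0: "X i ! 0 = ?r" using prim by (cases "X i") auto
  have iS: "i < length (segments x ps)" using i by simp
  have Y1: "length (Y v) = 1 \<and> f v = 0 \<and> eli_entails ?r (Y v ! 0)" if "v \<le> length qs" "\<sigma> v = i" for v
  proof -
    have "f v + length (Y v) \<le> 1" using Y_fits[OF that(1)] that prim by simp
    hence "length (Y v) = 1" "f v = 0" using Y_ne[OF that(1)] by linarith+
    thus ?thesis using X_entails_Y[OF that(1), of 0] that X0 by simp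
  qed
  have "\<exists>v\<le>length qs. \<sigma> v = i \<and> eli_entails (Y v ! 0) ?r"
  proof (rule ccontr)
    assume no: "\<not> ?thesis"
    define V where "V = {v. v \<le> length qs \<and> \<sigma> v = i}"
    have finV: "finite V" by (auto simp: V_def)
    have V0: "0 \<notin> V" using seg_embD(1)[OF emb] i by (auto simp: V_def)
    define a where "a = (if V = {} then 0 else Min V)"
    have a: "a \<le> v" if "v \<in> V" for v using that finV by (auto simp: a_def)
    have aV: "a \<in> V" if "V \<noteq> {}" using that finV Min_in[OF finV] by (auto simp: a_def)
    have conv: "v \<in> V" if "a \<le> v" "v \<le> w" "w \<in> V" for v w
    proof -
      have "a \<in> V" using aV \<open>w \<in> V\<close> by blast
      hence \<sigma>: "\<sigma> a = i" "\<sigma> w = i" "w \<le> length qs" using \<open>w \<in> V\<close> unfolding V_def by blast+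
      have "\<sigma> a \<le> \<sigma> v" using that \<sigma> by (intro seg_emb_mono[OF emb]) auto
      moreover have "\<sigma> v \<le> \<sigma> w" using that \<sigma> by (intro seg_emb_mono[OF emb]) auto
      ultimately show ?thesis using that(2) \<sigma> unfolding V_def by simp
    qed
    define n where "n = card V"
    have Vn: "v \<in> V \<longleftrightarrow> V \<noteq> {} \<and> a \<le> v \<and> v < a + n" for v
    proof (cases "V = {}")
      case False
      have "V = {a..Max V}"
      proof (intro equalityI subsetI)
        fix w assume "w \<in> V"
        thus "w \<in> {a..Max V}" using a Max_ge[OF finV] by simp
      next
        fix w assume "w \<in> {a..Max V}"
        thus "w \<in> V" using conv[of w "Max V"] Max_in[OF finV False] by simp
      qed
      moreover define M where "M = Max V"
      ultimately have VM: "V = {a..M}" by (simp only: M_def)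
      have "n = Suc M - a" unfolding n_def VM by simp
      thus ?thesis using False unfolding VM by auto
    qed (simp add: n_def)
    \<comment> \<open>The first block lies in segment \<open>0\<close>, so at most
      \<open>length qs\<close> of the \<open>length qs + 1\<close> blocks have to be
      covered.\<close>
    have "V \<subseteq> {1..length qs}" using V0 by (auto simp: V_def Suc_le_eq intro: gr0I)
    hence "n \<le> length qs" unfolding n_def using card_mono[of "{1..length qs}" V] by simp
    note cov = c[OF this]
    have "eli_entails ?r (Y (a + u) ! 0) \<and> \<not> eli_entails (Y (a + u) ! 0) ?r" if "u < n" for u
    proof -
      have "a + u \<in> V" using Vn[of "a + u"] that n_def by auto
      thus ?thesis using Y1[of "a + u"] no by (auto simp: V_def)
    qed
    then obtain \<mu> where \<mu>: "mono \<mu>" "\<And>u. u < n \<Longrightarrow> \<mu> u < length \<psi> \<and> eli_holds (\<psi> ! \<mu> u) 0 (Y (a + u) ! 0)"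
      using cov[unfolded covers_def, rule_format, of "\<lambda>u. Y (a + u) ! 0"] by blast
    have "\<exists>\<sigma> f. seg_emb (replace i (map (\<lambda>\<phi>. [\<phi>]) \<psi>) (segments x ps)) y qs \<sigma> f"
    proof (rule seg_emb_replace[OF emb iS, where \<mu> = "\<lambda>v. \<mu> (v - a)" and g = "\<lambda>_. 0"])
      fix v assume v: "v \<le> length qs" "\<sigma> v = i"
      hence "v \<in> V" by (simp add: V_def)
      hence "v - a < n" "a + (v - a) = v" using Vn[of v] by auto
      thus "\<mu> (v - a) < length (map (\<lambda>\<phi>. [\<phi>]) \<psi>) \<and>
         0 + length (Y v) \<le> length (map (\<lambda>\<phi>. [\<phi>]) \<psi> ! \<mu> (v - a)) \<and>
         (\<forall>j<length (Y v). eli_holds (map (\<lambda>\<phi>. [\<phi>]) \<psi> ! \<mu> (v - a) ! (0 + j)) 0 (Y v ! j))"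
        using \<mu>(2)[of "v - a"] Y1[OF v] by auto
    next
      fix v assume v: "v < length qs" "\<sigma> v = i" "\<sigma> (Suc v) = i"
      have "\<mu> (v - a) \<le> \<mu> (Suc v - a)" using \<mu>(1) by (simp add: mono_def)
      thus "\<mu> (v - a) < \<mu> (Suc v - a) \<or> \<mu> (v - a) = \<mu> (Suc v - a) \<and> 0 + length (Y v) + gap qs v \<le> 0 + 1"
        using same_seg[of v] v Y1[of v] Y1[of "Suc v"] by auto
    qed (use i in auto)
    thus False using r by (simp add: refuted_def)
  qed
  then obtain v where v: "v \<le> length qs" "\<sigma> v = i" "eli_entails (Y v ! 0) ?r" by blast
  hence "matched i v" using Y1[OF v(1,2)] prim X0 by (auto simp: matched_def)
  thus ?thesis by blast
qed

text \<open>A matched segment holds no second block, so \<open>\<sigma>\<close> is strictly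
  increasing, and it reaches every segment; such a map is the identity.\<close>

lemma all_matched:
  assumes "matched 0 0" and m: "\<And>i. 0 < i \<Longrightarrow> i \<le> length ps \<Longrightarrow> \<exists>v. matched i v"
  shows "length qs = length ps \<and> (\<forall>v\<le>length ps. matched v v)"
proof -
  have m': "\<exists>v. matched i v \<and> (i = 0 \<longrightarrow> v = 0)" if "i \<le> length ps" for i
    using assms(1) m[of i] that by (cases "i = 0") auto
  have inj: "v = w" if "v \<le> length qs" "w \<le> length qs" "\<sigma> v = \<sigma> w" for v w
    using m'[OF \<sigma>_le[OF that(1)]] matched_unique that by metis
  have sm: "\<sigma> v < \<sigma> w" if "v < w" "w \<le> length qs" for v w
    using seg_emb_mono[OF emb, of v w] inj[of v w] that by (metis less_imp_le_nat le_neq_implies_less order.trans nat_neq_iff)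
  have surj: "\<exists>v\<le>length qs. \<sigma> v = i" if "i \<le> length ps" for i
    using m'[OF that] by (auto simp: matched_def)
  have id: "\<sigma> v = v" if "v \<le> length qs" for v
    using that
  proof (induction v rule: less_induct)
    case (less v)
    have ge: "v \<le> \<sigma> v"
    proof (cases v)
      case (Suc u)
      thus ?thesis using less.IH[of u] less.prems sm[of u v] by auto
    qed simp
    obtain w where w: "w \<le> length qs" "\<sigma> w = v" using surj[of v] \<sigma>_le[OF less.prems] ge by auto
    show ?case
      using w less.IH[of w] sm[of v w] ge by (cases w v rule: linorder_cases) auto
  qed
  have "length qs = length ps"
    using id[of "length qs"] \<sigma>_le[of "length qs"] surj[of "length ps"] id by force
  moreover have "matched v v" if v: "v \<le> length ps" for v
  proof -
    obtain w where "matched v w" using m'[OF v] by blast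
    moreover from this have "w = v" using id[of w] by (auto simp: matched_def)
    ultimately show ?thesis by simp
  qed
  ultimately show ?thesis by blast
qed

end

section \<open>Joining blocks\<close>

text \<open>The shortest chain with \<open>z\<close> at distance \<open>d\<close> behind
  \<open>x\<close>; for \<open>d = 0\<close> they overlap in one point, whose labels are
  conjoined.\<close>

definition join :: "nat \<Rightarrow> ('u, 'b) eli list \<Rightarrow> ('u, 'b) eli list \<Rightarrow> ('u, 'b) eli list" where
  "join d x z = (if d = 0 then butlast x @ And (last x) (hd z) # tl z else x @ replicate (d - 1) Top @ z)"

lemma length_join: "x \<noteq> [] \<Longrightarrow> z \<noteq> [] \<Longrightarrow> length (join d x z) + 1 = length x + length z + d"
  by (cases x; cases z) (auto simp: join_def)

lemma join_left: "x \<noteq> [] \<Longrightarrow> j < length x \<Longrightarrow> eli_entails (join d x z ! j) (x ! j)"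
  by (cases "j = length x - 1")
     (auto simp: join_def nth_append nth_butlast last_conv_nth And_eli_entails eli_entails_refl)

lemma join_right:
  assumes "x \<noteq> []" "j < length z"
  shows "eli_entails (join d x z ! (length x + d - 1 + j)) (z ! j)"
proof (cases "d = 0")
  case True
  then show ?thesis using assms
    by (cases z; cases j) (auto simp: join_def nth_append And_eli_entails eli_entails_refl)
next
  case False
  then obtain e where "d = Suc e" by (cases d) auto
  then show ?thesis using assms by (auto simp: join_def nth_append eli_entails_refl)
qed

fun flatten :: "('u, 'b) eli list \<Rightarrow> ('u, 'b) later_blocks \<Rightarrow> ('u, 'b) eli list" where
  "flatten x [] = x"
| "flatten x ((d, y) # ps) = join d x (flatten y ps)"

definition labels :: "('u, 'b) eli list \<Rightarrow> ('u, 'b) later_blocks \<Rightarrow> ('u, 'b) eli set" where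
  "labels x ps = set x \<union> (\<Union>p\<in>set ps. set (snd p))"

lemma labels_simps [simp]: "labels x [] = set x" "labels x ((d, y) # ps) = set x \<union> labels y ps"
  by (auto simp: labels_def)

lemma labels_block: "r \<in> labels x ps \<longleftrightarrow> (\<exists>v\<le>length ps. \<exists>j<length (block x ps v). r = block x ps v ! j)"
proof (induction ps arbitrary: x)
  case Nil
  then show ?case by (auto simp: in_set_conv_nth)
next
  case (Cons p ps)
  obtain d y where p: "p = (d, y)" by (cases p)
  have "(\<exists>v\<le>length (p # ps). \<exists>j<length (block x (p # ps) v). r = block x (p # ps) v ! j) \<longleftrightarrow>
    (\<exists>j<length x. r = x ! j) \<or> (\<exists>v\<le>length ps. \<exists>j<length (block y ps v). r = block y ps v ! j)" (is "?L \<longleftrightarrow> ?R")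
  proof
    assume ?L
    then obtain v j where v: "v \<le> length (p # ps)" "j < length (block x (p # ps) v)" "r = block x (p # ps) v ! j" by blast
    thus ?R by (cases v) (auto simp: p)
  next
    assume ?R
    thus ?L
    proof
      assume "\<exists>j<length x. r = x ! j"
      thus ?L by (intro exI[of _ 0]) auto
    next
      assume "\<exists>v\<le>length ps. \<exists>j<length (block y ps v). r = block y ps v ! j"
      then obtain v where "v \<le> length ps" "\<exists>j<length (block y ps v). r = block y ps v ! j" by blast
      thus ?L by (intro exI[of _ "Suc v"]) (auto simp: p)
    qed
  qed
  then show ?case using Cons.IH[of y] by (auto simp: p in_set_conv_nth)
qed

lemma sat_mono:
  assumes "sat T t x ps" "\<And>t r. r \<in> labels x ps \<Longrightarrow> T t r \<Longrightarrow> T' t r"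
  shows "sat T' t x ps"
  using assms
proof (induction ps arbitrary: t x)
  case Nil
  then show ?case by (auto simp: chain_def)
next
  case (Cons p ps)
  obtain d y where p: "p = (d, y)" by (cases p)
  obtain t' where t': "chain T t x" "t + length x + d \<le> t' + 1" "sat T t' y ps" using Cons.prems by (auto simp: p)
  have "sat T' t' y ps" using t'(3) Cons.prems(2) by (intro Cons.IH) (auto simp: p)
  moreover have "chain T' t x" using t'(1) Cons.prems(2) by (auto simp: chain_def p)
  ultimately show ?case using t' by (auto simp: p)
qed

lemma flatten_ne: "x \<noteq> [] \<Longrightarrow> (\<forall>p\<in>set ps. snd p \<noteq> []) \<Longrightarrow> flatten x ps \<noteq> []"
proof (induction ps arbitrary: x)
  case (Cons p ps)
  thus ?case by (cases p) (auto simp: join_def)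
qed simp

lemma flatten_sat:
  assumes "chain T t (flatten x ps)" "x \<noteq> []" "\<forall>p\<in>set ps. snd p \<noteq> []"
    and T: "\<And>t r s. T t r \<Longrightarrow> eli_entails r s \<Longrightarrow> T t s"
  shows "sat T t x ps"
  using assms(1-3)
proof (induction ps arbitrary: t x)
  case (Cons p ps)
  obtain d y where p: "p = (d, y)" by (cases p)
  let ?z = "flatten y ps"
  have ne: "x \<noteq> []" "?z \<noteq> []" using Cons.prems flatten_ne by (auto simp: p)
  have ch: "T (t + j) (join d x ?z ! j)" if "j < length (join d x ?z)" for j
    using Cons.prems that by (auto simp: p chain_def)
  have lenx: "0 < length x" "0 < length ?z" using ne by auto
  note lj = length_join[OF ne, of d]
  have "chain T t x"
    unfolding chain_def
  proof (intro allI impI)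
    fix j assume j: "j < length x"
    hence "j < length (join d x ?z)" using lj lenx by linarith
    thus "T (t + j) (x ! j)" using T[OF ch join_left[OF ne(1) j]] by blast
  qed
  moreover have "chain T (t + (length x + d - 1)) ?z"
    unfolding chain_def
  proof (intro allI impI)
    fix j assume j: "j < length ?z"
    hence "length x + d - 1 + j < length (join d x ?z)" using lj lenx by linarith
    thus "T (t + (length x + d - 1) + j) (?z ! j)" using T[OF ch join_right[OF ne(1) j]] by (simp add: add.assoc)
  qed
  hence "sat T (t + (length x + d - 1)) y ps" using Cons by (auto simp: p)
  moreover have "t + length x + d \<le> t + (length x + d - 1) + 1" using lenx by linarith
  ultimately show ?case unfolding p sat.simps by blast
qed simp

text \<open>The distance is a parameter because both the exact distance (positive examples) and one
  less (negative examples) are used.\<close>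

definition merged :: "('u, 'b) eli list \<Rightarrow> ('u, 'b) later_blocks \<Rightarrow> nat \<Rightarrow> nat \<Rightarrow> ('u, 'b) data_instance list list" where
  "merged x ps i d = take i (segments x ps) @ [map canonical (join d (block x ps i) (block x ps (Suc i)))] @
     drop (Suc (Suc i)) (segments x ps)"

lemma merged_nth:
  assumes i: "i < length ps"
  shows "l < i \<Longrightarrow> merged x ps i d ! l = map canonical (block x ps l)"
    "merged x ps i d ! i = map canonical (join d (block x ps i) (block x ps (Suc i)))"
    "Suc i < l \<Longrightarrow> l \<le> length ps \<Longrightarrow> merged x ps i d ! (l - 1) = map canonical (block x ps l)"
    "length (merged x ps i d) = length ps"
proof -
  show "l < i \<Longrightarrow> merged x ps i d ! l = map canonical (block x ps l)"
    using i by (simp add: merged_def nth_append segments_nth)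
  show "merged x ps i d ! i = map canonical (join d (block x ps i) (block x ps (Suc i)))"
    using i by (simp add: merged_def nth_append)
  show "merged x ps i d ! (l - 1) = map canonical (block x ps l)" if l: "Suc i < l" "l \<le> length ps"
  proof -
    have *: "min (Suc (length ps)) i = i" using i by simp
    have "\<not> l - 1 < i" "l - 1 - i = Suc (l - Suc (Suc i))" "Suc (Suc i) + (l - Suc (Suc i)) = l" using l by auto
    thus ?thesis using l i by (simp add: merged_def nth_append segments_nth * del: add_Suc)
  qed
  show "length (merged x ps i d) = length ps" using i by (simp add: merged_def)
qed

lemma self_emb: 
  assumes "length qs = length ps"
    and "\<And>v. v \<le> length ps \<Longrightarrow> length (block y qs v) = length (block x ps v)"
    and "\<And>v j. v \<le> length ps \<Longrightarrow> j < length (block x ps v) \<Longrightarrow> eli_entails (block x ps v ! j) (block y qs v ! j)"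
  shows "seg_emb (segments x ps) y qs (\<lambda>v. v) (\<lambda>_. 0)"
  using assms by (auto simp: seg_emb_def segments_nth eli_entails_iff_canonical)

lemma merged_emb:
  assumes len: "length qs = length ps"
    and lens: "\<And>v. v \<le> length ps \<Longrightarrow> length (block y qs v) = length (block x ps v)"
    and ent: "\<And>v j. v \<le> length ps \<Longrightarrow> j < length (block x ps v) \<Longrightarrow> eli_entails (block x ps v ! j) (block y qs v ! j)"
    and ne: "\<And>v. v \<le> length ps \<Longrightarrow> block x ps v \<noteq> []"
    and i: "i < length ps" and d: "gap qs i \<le> d"
  shows "seg_emb (merged x ps i d) y qs (\<lambda>v. if v \<le> i then v else v - 1)
    (\<lambda>v. if v = Suc i then length (block x ps i) + d - 1 else 0)"
    (is "seg_emb ?M y qs ?\<sigma> ?f")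
proof -
  let ?J = "join d (block x ps i) (block x ps (Suc i))"
  note M = merged_nth[OF i]
  have n: "block x ps i \<noteq> []" "block x ps (Suc i) \<noteq> []" using ne i by auto
  note lj = length_join[OF n, of d]
  have pos: "0 < length (block x ps i)" "0 < length (block x ps (Suc i))" using n by auto
  have "?\<sigma> v < length ?M \<and> ?f v + length (block y qs v) \<le> length (?M ! ?\<sigma> v) \<and>
     (\<forall>j<length (block y qs v). eli_holds (?M ! ?\<sigma> v ! (?f v + j)) 0 (block y qs v ! j))" if v: "v \<le> length qs" for v
  proof -
    have v': "v \<le> length ps" using v len by simp
    note lv = lens[OF v']
    consider "v < i" | "v = i" | "v = Suc i" | "Suc i < v" by linarith
    thus ?thesis
    proof cases
      case 1
      thus ?thesis using M(1)[of v] M(4) ent[OF v'] lv i by (auto simp: eli_entails_iff_canonical)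
    next
      case 2
      have l: "length (block x ps i) \<le> length ?J" using lj pos by linarith
      have "eli_entails (?J ! j) (block y qs i ! j)" if "j < length (block x ps i)" for j
        using eli_entails_trans[OF join_left[OF n(1) that] ent[of i j]] that v' 2 by simp
      thus ?thesis using 2 M(2) M(4) i l lv by (simp add: eli_entails_iff_canonical)
    next
      case 3
      have l: "length (block x ps i) + d - 1 + length (block x ps (Suc i)) = length ?J"
        using lj pos by linarith
      have "eli_entails (?J ! (length (block x ps i) + d - 1 + j)) (block y qs (Suc i) ! j)"
        if "j < length (block x ps (Suc i))" for j
        using eli_entails_trans[OF join_right[OF n(1) that] ent[of "Suc i" j]] that v' 3 by simp
      moreover have "length (block x ps i) + d - 1 + j < length ?J"
        if "j < length (block x ps (Suc i))" for j using that l by linarith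
      ultimately show ?thesis using 3 M(2) M(4) i l lv by (auto simp: eli_entails_iff_canonical)
    next
      case 4
      thus ?thesis using M(3)[of v] M(4) ent[OF v'] lv i v' by (auto simp: eli_entails_iff_canonical)
    qed
  qed
  moreover have "?\<sigma> v < ?\<sigma> (Suc v) \<or> ?\<sigma> v = ?\<sigma> (Suc v) \<and> ?f v + length (block y qs v) + gap qs v \<le> ?f (Suc v) + 1"
    if v: "v < length qs" for v
    using lens[of v] i d pos by (cases "v = i") auto
  ultimately show ?thesis unfolding seg_emb_def by auto
qed

section \<open>Sizes\<close>

text \<open>Distances count in unary, since a distance \<open>d\<close> takes \<open>d\<close>
  strict diamonds; so \<open>query_size\<close> can bound this size.\<close>

fun total_size :: "('u, 'b) eli list \<Rightarrow> ('u, 'b) later_blocks \<Rightarrow> nat" where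
  "total_size x [] = (\<Sum>r\<leftarrow>x. eli_size r)"
| "total_size x ((d, y) # ps) = (\<Sum>r\<leftarrow>x. eli_size r) + d + total_size y ps"

lemma eli_size_pos: "1 \<le> eli_size r"
  by (induction r) auto

lemma length_le_size: "length x \<le> (\<Sum>r\<leftarrow>x. eli_size r)"
proof (induction x)
  case (Cons r x)
  then show ?case using eli_size_pos[of r] by simp
qed simp

lemma block_size: "v \<le> length ps \<Longrightarrow> (\<Sum>r\<leftarrow>block x ps v. eli_size r) \<le> total_size x ps"
proof (induction ps arbitrary: x v)
  case (Cons p ps)
  obtain d y where p: "p = (d, y)" by (cases p)
  show ?case using Cons.prems Cons.IH[of "v - 1" y] by (cases v) (auto simp: p)
qed simp

lemma block_length: "v \<le> length ps \<Longrightarrow> length (block x ps v) \<le> total_size x ps"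
  using block_size length_le_size le_trans by blast

lemma label_size: "r \<in> labels x ps \<Longrightarrow> eli_size r \<le> total_size x ps"
proof -
  assume "r \<in> labels x ps"
  then obtain v where "v \<le> length ps" "r \<in> set (block x ps v)" unfolding labels_block by auto
  moreover from this have "eli_size r \<le> (\<Sum>r\<leftarrow>block x ps v. eli_size r)" by (simp add: member_le_sum_list)
  ultimately show ?thesis using block_size le_trans by blast
qed

lemma gap_size: "v < length ps \<Longrightarrow> gap ps v \<le> total_size x ps"
proof (induction ps arbitrary: x v)
  case (Cons p ps)
  obtain d y where p: "p = (d, y)" by (cases p)
  show ?case using Cons.prems Cons.IH[of "v - 1" y] by (cases v) (auto simp: p)
qed simp

lemma length_size: "x \<noteq> [] \<Longrightarrow> (\<forall>p\<in>set ps. snd p \<noteq> []) \<Longrightarrow> length ps < total_size x ps"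
proof (induction ps arbitrary: x)
  case Nil
  then show ?case using length_le_size[of x] by (cases x) auto
next
  case (Cons p ps)
  then show ?case using length_le_size[of x] by (cases p; cases x) fastforce+
qed

lemma flatten_length:
  "x \<noteq> [] \<Longrightarrow> (\<forall>p\<in>set ps. snd p \<noteq> []) \<Longrightarrow> length (flatten x ps) \<le> total_size x ps"
proof (induction ps arbitrary: x)
  case (Cons p ps)
  obtain d y where p: "p = (d, y)" by (cases p)
  have "length (flatten y ps) \<le> total_size y ps" using Cons by (auto simp: p)
  moreover have "flatten y ps \<noteq> []" using Cons.prems flatten_ne by (auto simp: p)
  ultimately show ?case using length_join[of x "flatten y ps" d] Cons.prems length_le_size[of x] by (simp add: p)
qed (simp add: length_le_size)

definition letters_size :: "('u, 'b) data_instance list \<Rightarrow> nat" where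
  "letters_size s = (\<Sum>I\<leftarrow>s. card I)"

lemma letters_size_simps [simp]: "letters_size [] = 0" "letters_size (I # s) = card I + letters_size s"
  "letters_size (s @ s') = letters_size s + letters_size s'"
  by (simp_all add: letters_size_def)

lemma letters_size_canonical: "letters_size (map canonical x) \<le> (\<Sum>r\<leftarrow>x. eli_size r)"
proof (induction x)
  case (Cons r x)
  then show ?case using card_canonical[of r] by simp
qed simp

lemma letters_size_update: "letters_size (s[j := I]) \<le> letters_size s + card I"
proof (induction s arbitrary: j)
  case (Cons J s)
  show ?case using Cons[of "j - 1"] by (cases j) auto
qed simp

definition segs_size :: "('u, 'b) data_instance list list \<Rightarrow> nat" where
  "segs_size ss = (\<Sum>s\<leftarrow>ss. letters_size s)"

lemma segs_size_simps [simp]: "segs_size [] = 0" "segs_size (s # ss) = letters_size s + segs_size ss"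
  "segs_size (ss @ ss') = segs_size ss + segs_size ss'"
  by (simp_all add: segs_size_def)

lemma segs_size_drop: "segs_size (drop i ss) \<le> segs_size ss"
  by (metis append_take_drop_id segs_size_simps(3) le_add2)

lemma segs_size_take_drop: "i \<le> j \<Longrightarrow> segs_size (take i ss) + segs_size (drop j ss) \<le> segs_size ss"
proof -
  assume ij: "i \<le> j"
  have "segs_size ss = segs_size (take i ss) + segs_size (drop i ss)"
    by (metis append_take_drop_id segs_size_simps(3))
  moreover have "drop j ss = drop (j - i) (drop i ss)" using ij by simp
  ultimately show ?thesis using segs_size_drop[of "j - i" "drop i ss"] by simp
qed

lemma segs_size_segments: "segs_size (segments x ps) \<le> total_size x ps"
proof (induction ps arbitrary: x)
  case Nil
  then show ?case using letters_size_canonical by (simp add: segments_def)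
next
  case (Cons p ps)
  obtain d y where p: "p = (d, y)" by (cases p)
  show ?case using Cons[of y] letters_size_canonical[of x] by (simp add: segments_def p)
qed

lemma segs_size_replace: "segs_size (replace i ms ss) \<le> segs_size ss + segs_size ms"
  using segs_size_take_drop[of i "Suc i" ss] by (simp add: replace_def)

lemma data_size_word: "data_size (word b ss) = segs_size ss"
proof (induction ss)
  case (Cons s ss)
  have "(\<Sum>I\<leftarrow>replicate b {}. card I) = 0" by (induction b) auto
  then show ?case using Cons by (simp add: word_def data_size_def letters_size_def)
qed (simp add: word_def data_size_def)

lemma join_size: "z \<noteq> [] \<Longrightarrow> x \<noteq> [] \<Longrightarrow>
  (\<Sum>r\<leftarrow>join d x z. eli_size r) \<le> (\<Sum>r\<leftarrow>x. eli_size r) + (\<Sum>r\<leftarrow>z. eli_size r) + d + 1"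
proof -
  assume ne: "z \<noteq> []" "x \<noteq> []"
  obtain z0 z' where z: "z = z0 # z'" using ne by (cases z) auto
  obtain x' x0 where x: "x = x' @ [x0]" using ne by (cases x rule: rev_cases) auto
  show ?thesis by (cases d) (simp_all add: join_def x z sum_list_replicate)
qed

lemma flatten_size: "x \<noteq> [] \<Longrightarrow> (\<forall>p\<in>set ps. snd p \<noteq> []) \<Longrightarrow>
  (\<Sum>r\<leftarrow>flatten x ps. eli_size r) \<le> total_size x ps + length ps"
proof (induction ps arbitrary: x)
  case (Cons p ps)
  obtain d y where p: "p = (d, y)" by (cases p)
  have "flatten y ps \<noteq> []" using Cons.prems flatten_ne by (auto simp: p)
  thus ?case using Cons.IH[of y] Cons.prems join_size[of "flatten y ps" x d] by (simp add: p)
qed simp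

section \<open>The example set\<close>

definition fits_query :: "('u, 'b) eli list \<Rightarrow> ('u, 'b) later_blocks \<Rightarrow> ('u, 'b) examples \<Rightarrow> bool" where
  "fits_query x ps E \<longleftrightarrow> (\<forall>(\<D>, a)\<in>fst E. sat (truth \<D> a) 0 x ps) \<and> (\<forall>(\<D>, a)\<in>snd E. \<not> sat (truth \<D> a) 0 x ps)"

definition same_truth :: "('u, 'b) eli list \<Rightarrow> ('u, 'b) later_blocks \<Rightarrow>
    ('u, 'b) eli list \<Rightarrow> ('u, 'b) later_blocks \<Rightarrow> bool" where
  "same_truth x ps y qs \<longleftrightarrow> (\<forall>\<D> a t. sat (truth \<D> a) t x ps \<longleftrightarrow> sat (truth \<D> a) t y qs)"

lemma fresh_letter: "Z \<notin> set1_eli r \<Longrightarrow> eli_holds {Unary Z c} a r \<Longrightarrow> eli_holds {} a r"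
proof (induction r arbitrary: a)
  case (Exists S r)
  then show ?case by (cases S) (auto simp: eli_holds_Exists)
qed auto

lemma truth_entails: "truth \<D> a t r \<Longrightarrow> eli_entails r s \<Longrightarrow> truth \<D> a t s"
  by (auto simp: truth_def dest: eli_entailsD)

lemma truth_append_letter:
  "truth \<D> a t r \<Longrightarrow> truth (\<D> @ [I]) a t r"
  using eli_holds_mono[of "{}" _ a r] by (auto simp: truth_def at_time_def nth_append)

lemma truth_append_fresh:
  "Z \<notin> set1_eli r \<Longrightarrow> truth (\<D> @ [{Unary Z c}]) a t r \<Longrightarrow> truth \<D> a t r"
  using fresh_letter[of Z r c a] by (auto simp: truth_def at_time_def nth_append split: if_splits)

lemma truth_list: "t < length x \<Longrightarrow> truth (map canonical x) 0 t r \<longleftrightarrow> eli_entails (x ! t) r"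
  by (simp add: truth_def at_time_def eli_entails_iff_canonical)

lemma is_temporal_data_word:
  assumes "ss \<noteq> []" "hd ss \<noteq> []" "\<And>s I. s \<in> set ss \<Longrightarrow> I \<in> set s \<Longrightarrow> finite I"
  shows "is_temporal_data (word b ss)"
  using assms by (cases ss) (auto simp: is_temporal_data_def word_def)

lemma sat_gives_ind:
  assumes s: "sat (truth \<D> a) t x ps" and r: "r \<in> labels x ps" "\<not> eli_entails Top r"
  shows "a \<in> temporal_inds \<D>"
proof -
  obtain s where s: "\<And>v. v \<le> length ps \<Longrightarrow> chain (truth \<D> a) (s v) (block x ps v)"
    using s unfolding sat_iff_starts by blast
  obtain v j where v: "v \<le> length ps" "j < length (block x ps v)" "r = block x ps v ! j"
    using r(1) unfolding labels_block by blast
  have h: "eli_holds (at_time \<D> (s v + j)) a r" using s[OF v(1)] v by (auto simp: chain_def truth_def)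
  hence "a \<in> inds (at_time \<D> (s v + j))" using eli_holds_isolated r(2) by blast
  thus ?thesis by (auto simp: temporal_inds_def at_time_def split: if_splits)
qed

lemma nf_ne:
  assumes "nf x ps"
  shows "x \<noteq> []" "\<forall>p\<in>set ps. snd p \<noteq> []"
proof -
  show "x \<noteq> []" using nfD(1)[OF assms, of 0] by simp
  show "\<forall>p\<in>set ps. snd p \<noteq> []"
  proof
    fix p assume "p \<in> set ps"
    then obtain v where "v < length ps" "p = ps ! v" by (auto simp: in_set_conv_nth)
    thus "snd p \<noteq> []" using nfD(1)[OF assms, of "Suc v"] by (simp add: block_def)
  qed
qed

text \<open>On the joined blocks, the last point of a query in normal form bounds its lengths and distances.\<close>

lemma sat_list_bounds:
  assumes nf: "nf y qs" and s: "sat (truth (map canonical z) 0) 0 y qs" and z: "z \<noteq> []"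
  shows "v \<le> length qs \<Longrightarrow> length (block y qs v) \<le> length z"
    "v < length qs \<Longrightarrow> gap qs v \<le> length z"
    "\<forall>v<length qs. 1 \<le> gap qs v \<Longrightarrow> length qs < length z"
proof -
  let ?n = "length qs"
  obtain s where s: "s 0 = 0" "\<And>v. v \<le> ?n \<Longrightarrow> chain (truth (map canonical z) 0) (s v) (block y qs v)"
     "\<And>v. v < ?n \<Longrightarrow> s v + length (block y qs v) + gap qs v \<le> s (Suc v) + 1"
    using s unfolding sat_iff_starts by blast
  have ne: "1 \<le> length (block y qs v)" if "v \<le> ?n" for v using nfD(1)[OF nf that] by (simp add: Suc_le_eq)
  \<comment> \<open>The query ends inside \<open>z\<close> because its last label is no tautology,
    unless it consists of a single point at time 0.\<close>
  have fin: "s ?n + length (block y qs ?n) \<le> length z"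
  proof (cases "0 < ?n \<or> 1 < length (block y qs ?n)")
    case True
    let ?l = "length (block y qs ?n) - 1"
    have "\<not> eli_entails Top (block y qs ?n ! ?l)"
      using nfD(3)[OF nf le_refl True] length_pos_nth(2)[of "block y qs ?n"] ne[of ?n] by fastforce
    moreover have "truth (map canonical z) 0 (s ?n + ?l) (block y qs ?n ! ?l)"
    proof -
      have "?l < length (block y qs ?n)" using ne[of ?n] by linarith
      thus ?thesis using s(2)[OF le_refl] unfolding chain_def by blast
    qed
    ultimately have "s ?n + ?l < length z"
      using eli_holds_empty by (auto simp: truth_def at_time_def split: if_splits)
    thus ?thesis using ne[of ?n] by linarith
  next
    case False
    hence "?n = 0" "length (block y qs ?n) = 1" using ne[of ?n] by linarith+
    thus ?thesis using s(1) z by (simp add: Suc_le_eq)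
  qed
  have bound: "s v + length (block y qs v) \<le> length z" if "v \<le> ?n" for v
    using that
  proof (induction v rule: inc_induct)
    case (step v)
    thus ?case using s(3)[of v] ne[of "Suc v"] by linarith
  qed (rule fin)
  show "v \<le> ?n \<Longrightarrow> length (block y qs v) \<le> length z" using bound[of v] by linarith
  show "gap qs v \<le> length z" if v: "v < ?n" 
    using s(3)[OF v] bound[of "Suc v"] v ne[of v] ne[of "Suc v"] by linarith
  show "?n < length z" if g: "\<forall>v<?n. 1 \<le> gap qs v"
  proof -
    \<comment> \<open>Strict distances make the start times strictly increasing, which bounds the
      number of blocks.\<close>
    have "v \<le> s v" if "v \<le> ?n" for v
      using that
    proof (induction v)
      case (Suc v)
      thus ?case using s(3)[of v] ne[of v] g[rule_format, of v] by linarith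
    qed simp
    from this[of ?n] show ?thesis using fin ne[of ?n] by linarith
  qed
qed

text \<open>\<open>\<psi> i\<close> lists the frontier instances put in place of a primitive block
  \<open>i\<close>, and \<open>K\<close> bounds their number. \<open>nontrivial\<close> guarantees
  that the positive examples mention the individual \<open>0\<close>.\<close>

locale examples =
  fixes x :: "('u, 'b) eli list" and ps and F :: "('u, 'b) eli \<Rightarrow> ('u, 'b) data_instance set"
    and \<psi> :: "nat \<Rightarrow> ('u, 'b) data_instance list" and K :: nat and Z :: 'u
  assumes nf_ps: "nf x ps" and F: "\<And>r. frontier r (F r)"
    and nontrivial: "\<exists>r\<in>labels x ps. \<not> eli_entails Top r"
    and Z: "\<And>r. r \<in> labels x ps \<Longrightarrow> Z \<notin> set1_eli r"
    and \<psi>: "\<And>i. 0 < i \<Longrightarrow> i \<le> length ps \<Longrightarrow> length (block x ps i) = 1 \<Longrightarrow>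
       set (\<psi> i) \<subseteq> F (hd (block x ps i)) \<and> \<psi> i \<noteq> [] \<and> length (\<psi> i) \<le> K"
begin

abbreviation "N \<equiv> total_size x ps"
abbreviation "X i \<equiv> block x ps i"
abbreviation "CX i \<equiv> map canonical (block x ps i)"
abbreviation "S \<equiv> segments x ps"

text \<open>Some pieces only catch further blocks of a fitting query: the intact copy behind the
  first segment and the end letters around a weakened long segment. The two shortened copies refute
  queries without a block of full length.\<close>

definition replacements :: "nat \<Rightarrow> ('u, 'b) data_instance list list set" where
  "replacements i =
    (if i = 0 then \<Union>j<length x. (\<lambda>\<phi>. [(map canonical x)[j := \<phi>], map canonical x]) ` F (x ! j)
     else if length (X i) = 1 then {map (\<lambda>\<phi>. [\<phi>]) (\<psi> i)}
     else insert [butlast (CX i), tl (CX i)]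
       (\<Union>j<length (X i). (\<lambda>\<phi>. [[hd (CX i)], (CX i)[j := \<phi>], [last (CX i)]]) ` F (X i ! j)))"

definition positives :: "('u, 'b) temporal_data set" where
  "positives = {word N S, map canonical (flatten x ps)} \<union> (\<lambda>i. word N (merged x ps i (gap ps i))) ` {..<length ps}"

definition negative_segments :: "('u, 'b) data_instance list list set" where
  "negative_segments = (\<Union>i\<le>length ps. (\<lambda>ms. replace i ms S) ` replacements i) \<union>
     (\<lambda>i. merged x ps i (gap ps i - 1)) ` {i. i < length ps \<and> 0 < gap ps i}"

text \<open>The letter with the fresh symbol \<open>Z\<close> makes \<open>0\<close> occur in every
  negative example. It does not affect the query to be characterised; for a fitting query
  monotonicity suffices, since truth only has to be carried over to the longer word.\<close>

definition E :: "('u, 'b) examples" where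
  "E = ((\<lambda>\<D>. (\<D>, 0)) ` positives, (\<lambda>ss. (word N ss @ [{Unary Z 0}], 0)) ` negative_segments)"

lemma Fin: "finite (F r)" and F_card: "card (F r) \<le> eli_size r"
  and F_finite: "\<phi> \<in> F r \<Longrightarrow> finite \<phi>" and F_not: "\<phi> \<in> F r \<Longrightarrow> \<not> eli_holds \<phi> 0 r"
  and F_size: "\<phi> \<in> F r \<Longrightarrow> card \<phi> \<le> eli_size r * (eli_size r + 1)\<^sup>2"
  using F[of r] by (auto simp: frontier_def)

lemma X_ne: "i \<le> length ps \<Longrightarrow> X i \<noteq> []"
  using nfD(1)[OF nf_ps] .

lemma x_ne: "x \<noteq> []" using X_ne[of 0] by simp

lemma X_label: "i \<le> length ps \<Longrightarrow> j < length (X i) \<Longrightarrow> X i ! j \<in> labels x ps"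
  unfolding labels_block by blast

lemma hd_label: "i \<le> length ps \<Longrightarrow> hd (X i) \<in> labels x ps"
  using X_label[of i 0] X_ne[of i] by (simp add: hd_conv_nth)

lemma replacements_ne: "i \<le> length ps \<Longrightarrow> ms \<in> replacements i \<Longrightarrow> ms \<noteq> []"
  using \<psi>[of i] by (auto simp: replacements_def split: if_splits)

lemma hd_replace: "i \<le> length ps \<Longrightarrow> ms \<in> replacements i \<Longrightarrow> replace i ms S \<noteq> [] \<and> hd (replace i ms S) \<noteq> []"
  using x_ne by (cases "i = 0") (auto simp: replacements_def replace_def segments_def hd_append split: if_splits)

lemma hd_merged: "i < length ps \<Longrightarrow> merged x ps i d \<noteq> [] \<and> hd (merged x ps i d) \<noteq> []"
  using x_ne X_ne[of 1] by (cases "i = 0") (auto simp: merged_def segments_def join_def hd_append)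

lemma hd_negative: "ss \<in> negative_segments \<Longrightarrow> ss \<noteq> [] \<and> hd ss \<noteq> []"
  using hd_replace hd_merged by (auto simp: negative_segments_def)

text \<open>By rigidity block \<open>i\<close> would lie in one of the pieces, but each is too short
  for it or carries a frontier instance falsifying one of its labels. For \<open>i = 0\<close> the
  intact copy is excluded because the first block stays at the beginning.\<close>

lemma replacement_false:
  assumes i: "i \<le> length ps" and ms: "ms \<in> replacements i"
  shows "\<not> seg_emb (replace i ms S) x ps \<sigma> f"
proof
  assume e: "seg_emb (replace i ms S) x ps \<sigma> f"
  obtain m where m: "m < length ms" "\<sigma> i = i + m" "f i + length (X i) \<le> length (ms ! m)"
    "\<And>j. j < length (X i) \<Longrightarrow> eli_holds (ms ! m ! (f i + j)) 0 (X i ! j)"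
    using replaced_seg_emb[OF nf_ps i replacements_ne[OF i ms] e] by blast
  have pos: "0 < length (X i)" using X_ne[OF i] by simp
  show False
  proof (cases "i = 0")
    case True
    obtain j \<phi> where j: "j < length x" "\<phi> \<in> F (x ! j)" "ms = [(map canonical x)[j := \<phi>], map canonical x]"
      using ms True by (auto simp: replacements_def)
    have "m = 0" "f 0 = 0" using m(2) seg_embD(1,2)[OF e] True by auto
    hence "eli_holds \<phi> 0 (x ! j)" using m(4)[of j] j True by simp
    thus False using F_not j by blast
  next
    case False
    show False
    proof (cases "length (X i) = 1")
      case True
      hence ms': "ms = map (\<lambda>\<phi>. [\<phi>]) (\<psi> i)" using ms False by (simp add: replacements_def)
      have "f i = 0" using m(3) ms' m(1) True by simp
      hence "eli_holds (\<psi> i ! m) 0 (hd (X i))" using m(4)[of 0] ms' m(1) True by (simp add: length_1_nth)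
      moreover have "\<psi> i ! m \<in> F (hd (X i))" using \<psi>[of i] False i True ms' m(1) by auto
      ultimately show False using F_not by blast
    next
      case n1: False
      then consider "ms = [butlast (CX i), tl (CX i)]" |
         j \<phi> where "j < length (X i)" "\<phi> \<in> F (X i ! j)" "ms = [[hd (CX i)], (CX i)[j := \<phi>], [last (CX i)]]"
        using ms False by (auto simp: replacements_def)
      thus False
      proof cases
        case 1
        hence "length (ms ! m) = length (X i) - 1" using m(1) by (auto simp: less_Suc_eq)
        thus False using m(3) pos by linarith
      next
        case 2
        have "m = 1"
        proof (rule ccontr)
          assume "m \<noteq> 1"
          hence "length (ms ! m) = 1" using m(1) 2(3) by (auto simp: less_Suc_eq numeral_3_eq_3)
          thus False using m(3) pos n1 by linarith
        qed
        moreover from this have "f i = 0" using m(3) 2 by simp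
        ultimately have "eli_holds \<phi> 0 (X i ! j)" using m(4)[of j] 2 by simp
        thus False using F_not 2 by blast
      qed
    qed
  qed
qed

lemma negative_false:
  assumes ss: "ss \<in> negative_segments"
  shows "\<not> sat (truth (word N ss @ [{Unary Z 0}]) 0) 0 x ps"
proof
  assume "sat (truth (word N ss @ [{Unary Z 0}]) 0) 0 x ps"
  hence "sat (truth (word N ss) 0) 0 x ps"
    by (rule sat_mono) (rule truth_append_fresh[OF Z])
  then obtain \<sigma> f where e: "seg_emb ss x ps \<sigma> f"
    using sat_seg_emb[OF _ nf_ps] hd_negative[OF ss] block_length by blast
  from ss consider i ms where "i \<le> length ps" "ms \<in> replacements i" "ss = replace i ms S"
    | i where "i < length ps" "0 < gap ps i" "ss = merged x ps i (gap ps i - 1)"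
    by (auto simp: negative_segments_def)
  thus False
  proof cases
    case 1
    thus False using replacement_false e by blast
  next
    case (2 i)
    note M = merged_nth[OF 2(1)]
    have ne: "X i \<noteq> []" "X (Suc i) \<noteq> []" using X_ne 2(1) by auto
    have "gap ps i \<le> gap ps i - 1"
      by (rule merged_seg_emb[OF nf_ps e 2(1)])
         (use M length_join[OF ne] in \<open>auto simp: 2(3) like_canonical\<close>)
    thus False using 2(2) by linarith
  qed
qed

lemma positive_true: "\<D> \<in> positives \<Longrightarrow> sat (truth \<D> 0) 0 x ps"
proof -
  assume "\<D> \<in> positives"
  then consider "\<D> = word N S" | "\<D> = map canonical (flatten x ps)"
    | i where "i < length ps" "\<D> = word N (merged x ps i (gap ps i))"
    by (auto simp: positives_def)
  thus ?thesis
  proof cases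
    case 1
    show ?thesis unfolding 1
      by (rule seg_emb_sat[OF self_emb]) (auto simp: eli_entails_refl gap_size)
  next
    case 2
    show ?thesis unfolding 2
    proof (rule flatten_sat)
      show "chain (truth (map canonical (flatten x ps)) 0) 0 (flatten x ps)"
        by (simp add: chain_def truth_list eli_entails_refl)
    qed (use nf_ne[OF nf_ps] truth_entails in blast)+
  next
    case (3 i)
    show ?thesis unfolding 3(2)
      by (rule seg_emb_sat[OF merged_emb]) (use 3(1) X_ne in \<open>auto simp: eli_entails_refl gap_size\<close>)
  qed
qed

lemma fits_E: "fits_query x ps E"
  using positive_true negative_false by (auto simp: fits_query_def E_def)

section \<open>The examples form an example set\<close>

lemma segments_finite: "s \<in> set S \<Longrightarrow> I \<in> set s \<Longrightarrow> finite I"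
  by (auto simp: segments_def finite_canonical)

lemma replacement_finite:
  assumes "ms \<in> replacements i" "i \<le> length ps" "s \<in> set ms" "I \<in> set s"
  shows "finite I"
proof (cases "i = 0")
  case True
  thus ?thesis using assms F_finite set_update_subset_insert[of "map canonical x"]
    by (fastforce simp: replacements_def finite_canonical)
next
  case False
  have CX: "finite I" if "I \<in> set (CX i)" for I using that finite_canonical by auto
  show ?thesis
  proof (cases "length (X i) = 1")
    case True
    thus ?thesis using assms False F_finite \<psi>[of i] by (fastforce simp: replacements_def)
  next
    case n1: False
    then consider "ms = [butlast (CX i), tl (CX i)]" |
         j \<phi> where "j < length (X i)" "\<phi> \<in> F (X i ! j)" "ms = [[hd (CX i)], (CX i)[j := \<phi>], [last (CX i)]]"
      using assms(1) False by (auto simp: replacements_def)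
    thus ?thesis
    proof cases
      case 1
      hence "I \<in> set (butlast (CX i)) \<or> I \<in> set (tl (CX i))" using assms(3,4) by auto
      hence "I \<in> set (CX i)" by (metis in_set_butlastD list.sel(2) list.set_sel(2))
      thus ?thesis by (rule CX)
    next
      case 2
      have "CX i \<noteq> []" using X_ne assms by simp
      hence "hd (CX i) \<in> set (CX i)" "last (CX i) \<in> set (CX i)" by (rule hd_in_set, rule last_in_set)
      moreover have "I = hd (CX i) \<or> I \<in> set ((CX i)[j := \<phi>]) \<or> I = last (CX i)" using assms(3,4) unfolding 2(3) by auto
      ultimately have "I \<in> set (CX i) \<or> I = \<phi>"
        using set_update_subset_insert[of "CX i" j \<phi>] by blast
      thus ?thesis using CX F_finite 2 by blast
    qed
  qed
qed

lemma merged_finite: "s \<in> set (merged x ps i d) \<Longrightarrow> I \<in> set s \<Longrightarrow> finite I"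
  using segments_finite set_take_subset[of i S] set_drop_subset[of "Suc (Suc i)" S]
  by (fastforce simp: merged_def finite_canonical)

lemma negative_finite: "ss \<in> negative_segments \<Longrightarrow> s \<in> set ss \<Longrightarrow> I \<in> set s \<Longrightarrow> finite I"
proof -
  assume ss: "ss \<in> negative_segments" "s \<in> set ss" "I \<in> set s"
  from ss consider i ms where "i \<le> length ps" "ms \<in> replacements i" "ss = replace i ms S"
    | i where "i < length ps" "0 < gap ps i" "ss = merged x ps i (gap ps i - 1)"
    by (auto simp: negative_segments_def)
  thus ?thesis
  proof cases
    case (1 i ms)
    have "s \<in> set ms \<or> s \<in> set S"
      using ss(2) 1 set_take_subset[of i S] set_drop_subset[of "Suc i" S] by (auto simp: replace_def)
    thus ?thesis using replacement_finite 1 ss segments_finite by blast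
  next
    case 2
    thus ?thesis using merged_finite ss by blast
  qed
qed

lemma finite_replacements: "finite (replacements i)"
  using Fin by (auto simp: replacements_def)

lemma finite_negative_segments: "finite negative_segments"
  using finite_replacements by (auto simp: negative_segments_def)

lemma finite_positives: "finite positives"
  by (auto simp: positives_def)

lemma is_example_set_E: "is_example_set E"
proof -
  have "is_temporal_data \<D> \<and> 0 \<in> temporal_inds \<D>" if \<D>: "\<D> \<in> positives" for \<D>
  proof
    show "0 \<in> temporal_inds \<D>" using positive_true[OF \<D>] nontrivial sat_gives_ind by blast
    have "S \<noteq> []" "hd S \<noteq> []" using x_ne by (auto simp: segments_def)
    hence "is_temporal_data (word N S)" using segments_finite by (intro is_temporal_data_word) auto
    moreover have "is_temporal_data (word N (merged x ps i d))" if "i < length ps" for i d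
      using hd_merged[OF that] merged_finite by (intro is_temporal_data_word) auto
    moreover have "is_temporal_data (map canonical (flatten x ps))"
      using flatten_ne nf_ne[OF nf_ps] by (auto simp: is_temporal_data_def finite_canonical)
    ultimately show "is_temporal_data \<D>" using \<D> by (auto simp: positives_def)
  qed
  moreover have "is_temporal_data (word N ss @ [{Unary Z 0}]) \<and> 0 \<in> temporal_inds (word N ss @ [{Unary Z 0}])"
    if ss: "ss \<in> negative_segments" for ss
  proof
    have "is_temporal_data (word N ss)"
      using hd_negative[OF ss] negative_finite[OF ss] by (intro is_temporal_data_word) auto
    thus "is_temporal_data (word N ss @ [{Unary Z 0}])" by (auto simp: is_temporal_data_def)
  qed (simp add: temporal_inds_def inds_def)
  ultimately show ?thesis
    using finite_positives finite_negative_segments by (auto simp: is_example_set_def E_def)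
qed

text \<open>The embedding into the word of separated blocks matches the blocks one to one with
  equivalent labels; the merged words then fix the distances.\<close>

lemma unique:
  assumes nf_qs: "nf y qs" and fit: "fits_query y qs E"
    and cov: "\<And>i n. 0 < i \<Longrightarrow> i \<le> length ps \<Longrightarrow> length (X i) = 1 \<Longrightarrow> n \<le> length qs \<Longrightarrow> covers (\<psi> i) (hd (X i)) n"
  shows "same_truth x ps y qs"
proof -
  have pos: "sat (truth \<D> 0) 0 y qs" if "\<D> \<in> positives" for \<D>
    using fit that by (auto simp: fits_query_def E_def)
  have fne: "flatten x ps \<noteq> []" using flatten_ne nf_ne[OF nf_ps] by blast
  have fl: "length (flatten x ps) \<le> N" using flatten_length nf_ne[OF nf_ps] by blast
  \<comment> \<open>\<open>N\<close> depends on \<open>x\<close>, \<open>ps\<close> only; this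
    example shows that it is large enough for \<open>y\<close>, \<open>qs\<close> as well.\<close>
  have fsat: "sat (truth (map canonical (flatten x ps)) 0) 0 y qs" by (rule pos) (simp add: positives_def)
  have lenY: "length (block y qs v) \<le> N" if "v \<le> length qs" for v
    using sat_list_bounds(1)[OF nf_qs fsat fne that] fl by linarith
  have gapY: "gap qs v \<le> N" if "v < length qs" for v
    using sat_list_bounds(2)[OF nf_qs fsat fne that] fl by linarith
  have emb: "\<exists>\<sigma> f. seg_emb ss y qs \<sigma> f" if "word N ss \<in> positives" "ss \<noteq> []" "hd ss \<noteq> []" for ss
    using sat_seg_emb[OF pos[OF that(1)] nf_qs _ that(2,3)] lenY by blast
  have neg: "\<not> seg_emb ss y qs \<sigma> f" if "ss \<in> negative_segments" for ss \<sigma> f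
  proof
    assume "seg_emb ss y qs \<sigma> f"
    hence "sat (truth (word N ss) 0) 0 y qs" using seg_emb_sat gapY by blast
    hence "sat (truth (word N ss @ [{Unary Z 0}]) 0) 0 y qs"
      by (rule sat_mono) (rule truth_append_letter)
    thus False using fit that by (auto simp: fits_query_def E_def)
  qed
  have "S \<noteq> []" "hd S \<noteq> []" using x_ne by (auto simp: segments_def)
  then obtain \<sigma> f where e: "seg_emb S y qs \<sigma> f" using emb[of S] by (auto simp: positives_def)
  interpret fit: fitting x ps y qs \<sigma> f F
    using nf_ps nf_qs e F by unfold_locales
  have ref: "fit.refuted i ms" if "i \<le> length ps" "ms \<in> replacements i" for i ms
    using neg that unfolding fit.refuted_def negative_segments_def by blast
  have m0: "fit.matched 0 0"
    by (rule fit.match_first) (rule ref, auto simp: replacements_def)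
  have "\<exists>v. fit.matched i v" if i: "0 < i" "i \<le> length ps" for i
  proof (cases "length (X i) = 1")
    case True
    show ?thesis
      by (rule fit.match_primitive[OF i True cov[OF i True]], assumption, rule ref[OF i(2)])
         (use i True in \<open>simp add: replacements_def\<close>)
  next
    case False
    hence l: "1 < length (X i)" using X_ne[OF i(2)] by (cases "X i") auto
    show ?thesis
      by (rule fit.match_long[OF i l]; rule ref[OF i(2)]) (use i l in \<open>auto simp: replacements_def\<close>)
  qed
  from fit.all_matched[OF m0 this] have len: "length qs = length ps" and m: "\<And>v. v \<le> length ps \<Longrightarrow> fit.matched v v"
    by auto
  have lens: "length (block y qs v) = length (X v)" if "v \<le> length ps" for v
    using m[OF that] by (simp add: fit.matched_def)
  have ent: "eli_entails (X v ! j) (block y qs v ! j)" "eli_entails (block y qs v ! j) (X v ! j)"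
    if "v \<le> length ps" "j < length (X v)" for v j
    using m[OF that(1)] that(2) by (auto simp: fit.matched_def)
  have lk: "like (CX v) (block y qs v)" if "v \<le> length ps" for v
    using ent(2)[OF that] lens[OF that]
    by (auto simp: like_def eli_entails_iff_canonical[symmetric] intro: eli_entails_trans)
  \<comment> \<open>The positive example with blocks \<open>i\<close> and \<open>Suc i\<close> at
    their least distance bounds the gap from above, the negative one with the blocks one step closer
    from below.\<close>
  have gaps: "gap qs i = gap ps i" if i: "i < length ps" for i
  proof (rule antisym)
    have ne: "X i \<noteq> []" "X (Suc i) \<noteq> []" using X_ne i by auto
    obtain \<tau> g where g: "seg_emb (merged x ps i (gap ps i)) y qs \<tau> g"
      using emb[of "merged x ps i (gap ps i)"] hd_merged[OF i] i by (auto simp: positives_def)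
    show "gap qs i \<le> gap ps i"
      by (rule merged_seg_emb[OF nf_qs g])
         (use merged_nth[OF i] len i lk lens length_join[OF ne] in auto)
    show "gap ps i \<le> gap qs i"
    proof (rule ccontr)
      assume "\<not> ?thesis"
      hence "gap qs i \<le> gap ps i - 1" "0 < gap ps i" by auto
      hence "seg_emb (merged x ps i (gap ps i - 1)) y qs (\<lambda>v. if v \<le> i then v else v - 1)
         (\<lambda>v. if v = Suc i then length (block x ps i) + (gap ps i - 1) - 1 else 0)"
        using lens ent(1) X_ne i len by (intro merged_emb) auto
      moreover have "merged x ps i (gap ps i - 1) \<in> negative_segments"
        using i \<open>0 < gap ps i\<close> by (auto simp: negative_segments_def)
      ultimately show False using neg by blast
    qed
  qed
  have ch: "chain (truth \<D> a) t (X v) \<longleftrightarrow> chain (truth \<D> a) t (block y qs v)" if "v \<le> length ps" for \<D> a t v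
    using ent[OF that] lens[OF that] truth_entails by (fastforce simp: chain_def)
  show ?thesis
    unfolding same_truth_def sat_iff_starts using len lens gaps ch by simp
qed

lemma short:
  assumes nf_qs: "nf y qs" and fit: "fits_query y qs E" and g: "\<forall>v<length qs. 1 \<le> gap qs v"
  shows "length qs \<le> N"
proof -
  have fne: "flatten x ps \<noteq> []" using flatten_ne nf_ne[OF nf_ps] by blast
  have fl: "length (flatten x ps) \<le> N" using flatten_length nf_ne[OF nf_ps] by blast
  have fsat: "sat (truth (map canonical (flatten x ps)) 0) 0 y qs" 
    using fit by (auto simp: positives_def fits_query_def E_def)
  show ?thesis using sat_list_bounds(3)[OF nf_qs fsat fne g] fl by linarith
qed

section \<open>Polynomial bounds on the examples\<close>

definition C :: nat where "C = N * (N + 1)\<^sup>2"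

lemma C: "\<phi> \<in> F r \<Longrightarrow> r \<in> labels x ps \<Longrightarrow> card \<phi> \<le> C"
proof -
  assume "\<phi> \<in> F r" "r \<in> labels x ps"
  hence "card \<phi> \<le> eli_size r * (eli_size r + 1)\<^sup>2" "eli_size r \<le> N" using F_size label_size by auto
  moreover from this have "eli_size r * (eli_size r + 1)\<^sup>2 \<le> C" 
    unfolding C_def by (intro mult_le_mono power_mono) auto
  ultimately show ?thesis by linarith
qed

lemma CX_size: "i \<le> length ps \<Longrightarrow> letters_size (CX i) \<le> N"
  using letters_size_canonical[of "X i"] block_size[of i ps x] by linarith

lemma replacement_size:
  assumes i: "i \<le> length ps" and ms: "ms \<in> replacements i"
  shows "segs_size ms \<le> 3 * N + (K + 1) * C"
proof (cases "i = 0")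
  case True
  obtain j \<phi> where j: "j < length x" "\<phi> \<in> F (x ! j)" "ms = [(map canonical x)[j := \<phi>], map canonical x]"
    using ms True by (auto simp: replacements_def)
  have "card \<phi> \<le> C" using C[OF j(2)] X_label[of 0 j] j by simp
  thus ?thesis using letters_size_update[of "map canonical x" j \<phi>] CX_size[of 0] j(3) by simp
next
  case False
  show ?thesis
  proof (cases "length (X i) = 1")
    case True
    have "segs_size (map (\<lambda>\<phi>. [\<phi>]) \<chi>) \<le> length \<chi> * C" if "set \<chi> \<subseteq> F (hd (X i))" for \<chi>
      using that C hd_label[OF i] by (induction \<chi>) (auto simp: add_mono)
    from this[of "\<psi> i"] have "segs_size ms \<le> length (\<psi> i) * C" "length (\<psi> i) \<le> K"
      using ms False True \<psi>[of i] i by (auto simp: replacements_def)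
    moreover from this have "length (\<psi> i) * C \<le> (K + 1) * C" by (intro mult_le_mono1) simp
    ultimately show ?thesis by linarith
  next
    case n1: False
    have ne: "CX i \<noteq> []" using X_ne i by simp
    have b: "letters_size (butlast (CX i)) + card (last (CX i)) = letters_size (CX i)"
      using append_butlast_last_id[OF ne] by (metis letters_size_simps add.right_neutral)
    have t: "card (hd (CX i)) + letters_size (tl (CX i)) = letters_size (CX i)"
      using list.collapse[OF ne] by (metis letters_size_simps(2))
    from n1 consider "ms = [butlast (CX i), tl (CX i)]" |
         j \<phi> where "j < length (X i)" "\<phi> \<in> F (X i ! j)" "ms = [[hd (CX i)], (CX i)[j := \<phi>], [last (CX i)]]"
      using ms False by (auto simp: replacements_def)
    thus ?thesis
    proof cases
      case 1
      have "segs_size ms = letters_size (butlast (CX i)) + letters_size (tl (CX i))" using 1 by simp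
      thus ?thesis using b t CX_size[OF i] by linarith
    next
      case 2
      have "segs_size ms = card (hd (CX i)) + (letters_size ((CX i)[j := \<phi>]) + card (last (CX i)))" using 2 by simp
      moreover have "card \<phi> \<le> C" using C[OF 2(2)] X_label[OF i 2(1)] by simp
      moreover have "(K + 1) * C = K * C + C" by simp
      ultimately show ?thesis using letters_size_update[of "CX i" j \<phi>] b t CX_size[OF i] by linarith
    qed
  qed
qed

text \<open>Room for every example: a word with a replacement takes at most
  \<open>N + 3 * N + (K + 1) * C\<close>, a merged word \<open>4 * N + 1\<close>, and the fresh
  letter one more.\<close>

definition B :: nat where "B = 5 * N + (K + 1) * C + 2"

lemma merged_size:
  assumes i: "i < length ps" and d: "d \<le> N"
  shows "segs_size (merged x ps i d) \<le> 4 * N + 1"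
proof -
  have "segs_size (take i S) + segs_size (drop (Suc (Suc i)) S) \<le> N"
    using segs_size_take_drop[of i "Suc (Suc i)" S] segs_size_segments[of x ps] by simp
  moreover have "letters_size (map canonical (join d (X i) (X (Suc i)))) \<le> N + N + N + 1"
    using letters_size_canonical[of "join d (X i) (X (Suc i))"] join_size[OF X_ne[of "Suc i"] X_ne[of i], of d]
      block_size[of i ps x] block_size[of "Suc i" ps x] i d by simp
  ultimately show ?thesis by (simp add: merged_def)
qed

lemma positive_size: "\<D> \<in> positives \<Longrightarrow> data_size \<D> \<le> B"
proof -
  assume \<D>: "\<D> \<in> positives"
  have "data_size (map canonical (flatten x ps)) = letters_size (map canonical (flatten x ps))"
    by (simp add: data_size_def letters_size_def)
  also have "\<dots> \<le> N + length ps"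
    using letters_size_canonical[of "flatten x ps"] flatten_size[of x ps] nf_ne[OF nf_ps] by fastforce
  also have "\<dots> \<le> 2 * N" using length_size[of x ps] nf_ne[OF nf_ps] by fastforce
  finally have "data_size (map canonical (flatten x ps)) \<le> B" by (simp add: B_def)
  moreover have "data_size (word N S) \<le> B"
    using segs_size_segments[of x ps] by (simp add: data_size_word B_def)
  moreover have "data_size (word N (merged x ps i (gap ps i))) \<le> B" if "i < length ps" for i
    using merged_size[OF that gap_size[OF that]] by (simp add: data_size_word B_def)
  ultimately show ?thesis using \<D> by (auto simp: positives_def)
qed

lemma negative_size: "ss \<in> negative_segments \<Longrightarrow> data_size (word N ss @ [{Unary Z 0}]) \<le> B"
proof -
  assume ss: "ss \<in> negative_segments"
  have "data_size (word N ss @ [{Unary Z 0}]) = segs_size ss + 1"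
    by (simp add: data_size_word[of N ss, symmetric]) (simp add: data_size_def)
  moreover have "segs_size ss \<le> 4 * N + (K + 1) * C + 1"
  proof -
    from ss consider i ms where "i \<le> length ps" "ms \<in> replacements i" "ss = replace i ms S"
      | i where "i < length ps" "0 < gap ps i" "ss = merged x ps i (gap ps i - 1)"
      by (auto simp: negative_segments_def)
    thus ?thesis
    proof cases
      case (1 i ms)
      show ?thesis unfolding 1(3)
        using segs_size_replace[of i ms S] segs_size_segments[of x ps] replacement_size[OF 1(1,2)] by linarith
    next
      case (2 i)
      have "gap ps i - 1 \<le> N" using gap_size[OF 2(1), of x] by linarith
      thus ?thesis using merged_size[OF 2(1)] 2(3) by fastforce
    qed
  qed
  ultimately show ?thesis by (simp add: B_def)
qed

lemma blocks_le: "Suc (length ps) \<le> N"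
  using length_size[of x ps] nf_ne[OF nf_ps] by (simp add: Suc_le_eq)

lemma card_positives: "card positives \<le> N + 2"
proof -
  have "card positives \<le> card {word N S, map canonical (flatten x ps)} +
      card ((\<lambda>i. word N (merged x ps i (gap ps i))) ` {..<length ps})"
    unfolding positives_def by (rule card_Un_le)
  also have "\<dots> \<le> 2 + length ps"
    by (intro add_mono) (auto simp: card_insert_if intro: order.trans[OF card_image_le])
  finally show ?thesis using blocks_le by linarith
qed

lemma card_replacements: "i \<le> length ps \<Longrightarrow> card (replacements i) \<le> N * N + 1"
proof -
  assume i: "i \<le> length ps"
  have U: "card (\<Union>j<length (X i). h j ` F (X i ! j)) \<le> N * N" for h :: "nat \<Rightarrow> _ \<Rightarrow> ('u, 'b) data_instance list list"
  proof -
    have "card (\<Union>j<length (X i). h j ` F (X i ! j)) \<le> (\<Sum>j<length (X i). card (h j ` F (X i ! j)))"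
      by (rule card_UN_le) simp
    also have "\<dots> \<le> (\<Sum>j<length (X i). N)"
    proof (rule sum_mono)
      fix j assume "j \<in> {..<length (X i)}"
      thus "card (h j ` F (X i ! j)) \<le> N"
        using card_image_le[OF Fin, of "h j" "X i ! j"] F_card[of "X i ! j"] label_size[OF X_label[OF i, of j]] by auto
    qed
    also have "\<dots> \<le> N * N" using block_length[OF i, of x] by simp
    finally show ?thesis .
  qed
  show ?thesis
  proof (cases "i = 0")
    case True
    thus ?thesis using U[of "\<lambda>j \<phi>. [(map canonical x)[j := \<phi>], map canonical x]"] by (simp add: replacements_def)
  next
    case False
    thus ?thesis
      using U[of "\<lambda>j \<phi>. [[hd (CX i)], (CX i)[j := \<phi>], [last (CX i)]]"] Fin
      by (auto simp: replacements_def card_insert_if)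
  qed
qed

lemma card_negative_segments: "card negative_segments \<le> N * (N * N + 1) + N"
proof -
  have "card (\<Union>i\<le>length ps. (\<lambda>ms. replace i ms S) ` replacements i)
    \<le> (\<Sum>i\<le>length ps. card ((\<lambda>ms. replace i ms S) ` replacements i))"
    by (rule card_UN_le) simp
  also have "\<dots> \<le> (\<Sum>i\<le>length ps. N * N + 1)"
  proof (rule sum_mono)
    fix i assume "i \<in> {..length ps}"
    thus "card ((\<lambda>ms. replace i ms S) ` replacements i) \<le> N * N + 1"
      using card_image_le[OF finite_replacements, of "\<lambda>ms. replace i ms S" i] card_replacements[of i] by auto
  qed
  also have "\<dots> = Suc (length ps) * (N * N + 1)" by simp
  also have "\<dots> \<le> N * (N * N + 1)" using blocks_le by (intro mult_le_mono1)
  finally have "card (\<Union>i\<le>length ps. (\<lambda>ms. replace i ms S) ` replacements i) \<le> N * (N * N + 1)" .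
  moreover have "card ((\<lambda>i. merged x ps i (gap ps i - 1)) ` {i. i < length ps \<and> 0 < gap ps i}) \<le> N"
  proof -
    have "card ((\<lambda>i. merged x ps i (gap ps i - 1)) ` {i. i < length ps \<and> 0 < gap ps i})
        \<le> card {i. i < length ps \<and> 0 < gap ps i}"
      by (rule card_image_le) simp
    also have "\<dots> \<le> card {..<length ps}" by (rule card_mono) auto
    finally show ?thesis using blocks_le by simp
  qed
  ultimately show ?thesis
    unfolding negative_segments_def using card_Un_le by (meson add_mono le_trans)
qed

lemma examples_size_E: "examples_size E \<le> (N + 2 + (N * (N * N + 1) + N)) * B"
proof -
  have "(\<Sum>(\<D>, a)\<in>fst E. data_size \<D>) \<le> card (fst E) * B"
    using positive_size by (intro order.trans[OF sum_bounded_above[of _ _ B]]) (auto simp: E_def)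
  also have "\<dots> \<le> (N + 2) * B"
    using card_image_le[OF finite_positives, of "\<lambda>\<D>. (\<D>, 0::nat)"] card_positives
    by (intro mult_le_mono1) (simp add: E_def)
  finally have p: "(\<Sum>(\<D>, a)\<in>fst E. data_size \<D>) \<le> (N + 2) * B" .
  have "(\<Sum>(\<D>, a)\<in>snd E. data_size \<D>) \<le> card (snd E) * B"
    using negative_size by (intro order.trans[OF sum_bounded_above[of _ _ B]]) (auto simp: E_def)
  also have "\<dots> \<le> (N * (N * N + 1) + N) * B"
    using card_image_le[OF finite_negative_segments, of "\<lambda>ss. (word N ss @ [{Unary Z 0}], 0::nat)"]
      card_negative_segments by (intro mult_le_mono1) (simp add: E_def)
  finally have n: "(\<Sum>(\<D>, a)\<in>snd E. data_size \<D>) \<le> (N * (N * N + 1) + N) * B" .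
  show ?thesis
    unfolding examples_size_def by (subst add_mult_distrib) (rule add_mono[OF p n])
qed

end

section \<open>Existence of normal forms\<close>

definition wf_blocks :: "('u, 'b) eli list \<Rightarrow> ('u, 'b) later_blocks \<Rightarrow> bool" where
  "wf_blocks x ps \<longleftrightarrow> x \<noteq> [] \<and> (\<forall>p\<in>set ps. snd p \<noteq> [])"

definition num_points :: "('u, 'b) eli list \<Rightarrow> ('u, 'b) later_blocks \<Rightarrow> nat" where
  "num_points x ps = length x + (\<Sum>p\<leftarrow>ps. length (snd p))"

text \<open>The decrease of \<open>num_points\<close> makes normalisation terminate. Preserving
  strict distances matters for queries without reflexive diamond, whose number of blocks is bounded
  through it.\<close>

definition improves :: "('u, 'b) eli list \<Rightarrow> ('u, 'b) later_blocks \<Rightarrow>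
    ('u, 'b) eli list \<Rightarrow> ('u, 'b) later_blocks \<Rightarrow> bool" where
  "improves x ps y qs \<longleftrightarrow> wf_blocks y qs \<and> same_truth x ps y qs \<and> total_size y qs \<le> total_size x ps \<and>
     num_points y qs < num_points x ps \<and> ((\<forall>p\<in>set ps. 1 \<le> fst p) \<longrightarrow> (\<forall>p\<in>set qs. 1 \<le> fst p))"

lemma truth_tautology: "eli_entails Top r \<Longrightarrow> truth \<D> a t r"
  by (rule truth_entails[of _ _ _ Top]) (auto simp: truth_def)

lemma sat_Cons: "sat T t (r # x) ps \<longleftrightarrow> T t r \<and> sat T (Suc t) x ps"
proof -
  have "chain T t (r # x) \<longleftrightarrow> T t r \<and> chain T (Suc t) x"
    by (auto simp: chain_def less_Suc_eq_0_disj)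
  thus ?thesis by (cases ps) auto
qed

lemma chain_singleton: "chain T t [r] \<longleftrightarrow> T t r"
  by (simp add: chain_def)

lemma chain_append: "chain T t (x @ y) \<longleftrightarrow> chain T t x \<and> chain T (t + length x) y"
proof
  assume h: "chain T t (x @ y)"
  have "T (t + length x + j) (y ! j)" if "j < length y" for j
    using h[unfolded chain_def, rule_format, of "length x + j"] that by (simp add: add.assoc)
  moreover have "T (t + j) (x ! j)" if "j < length x" for j
    using h[unfolded chain_def, rule_format, of j] that by (simp add: nth_append)
  ultimately show "chain T t x \<and> chain T (t + length x) y" by (simp add: chain_def)
next
  assume h: "chain T t x \<and> chain T (t + length x) y"
  show "chain T t (x @ y)"
    unfolding chain_def
  proof (intro allI impI)
    fix j assume "j < length (x @ y)"
    thus "T (t + j) ((x @ y) ! j)"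
      using h[unfolded chain_def] by (cases "j < length x") (auto simp: nth_append dest: spec[of _ "j - length x"])
  qed
qed

lemma improves_context:
  assumes "improves y qs y' qs'" "wf_blocks x ((d, y) # qs)"
  shows "improves x ((d, y) # qs) x ((d, y') # qs')"
  using assms by (auto simp: improves_def wf_blocks_def same_truth_def num_points_def)

lemma improve_context:
  assumes "\<exists>y' qs'. improves y qs y' qs'" "wf_blocks x ((d, y) # qs)"
  shows "\<exists>x' ps'. improves x ((d, y) # qs) x' ps'"
  using improves_context assms by blast

lemma wf_blocks_Cons: "wf_blocks x ((d, y) # qs) \<longleftrightarrow> x \<noteq> [] \<and> wf_blocks y qs"
  by (auto simp: wf_blocks_def)

lemma total_size_Cons: "total_size (r # x) ps = eli_size r + total_size x ps"
  by (cases ps) auto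

text \<open>A tautological first point of a later block only takes up time: it is absorbed into the
  distance before it or, if it is the whole block, the two adjacent distances are added; at the end
  of the query it is dropped.\<close>

lemma improve_hd:
  "wf_blocks x ps \<Longrightarrow> v < length ps \<Longrightarrow> eli_entails Top (hd (block x ps (Suc v))) \<Longrightarrow> \<exists>x' ps'. improves x ps x' ps'"
proof (induction ps arbitrary: x v)
  case (Cons p qs)
  obtain d y where p: "p = (d, y)" by (cases p)
  have wf: "x \<noteq> []" "wf_blocks y qs" using Cons.prems(1) by (auto simp: p wf_blocks_Cons)
  show ?case
  proof (cases v)
    case (Suc w)
    thus ?thesis using improve_context[OF Cons.IH[OF wf(2), of w]] Cons.prems by (simp add: p)
  next
    case 0
    hence top: "eli_entails Top (hd y)" using Cons.prems by (simp add: p)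
    obtain r y' where y: "y = r # y'" using wf by (cases y) (auto simp: wf_blocks_def)
    have r: "truth \<D> a t r" for \<D> :: "('a, 'b) temporal_data" and a t
      using top truth_tautology y by fastforce
    have lx: "1 \<le> length x" using wf by (simp add: Suc_le_eq)
    show ?thesis
    proof (cases "y' = []")
      case True
      show ?thesis
      proof (cases qs)
        case Nil
        have "sat (truth \<D> a) t x [(d, [r])] \<longleftrightarrow> sat (truth \<D> a) t x []" for \<D> a t
          using r by (auto simp: chain_def intro!: exI[of _ "t + length x + d"])
        hence "improves x (p # qs) x []"
          using wf Nil True by (auto simp: improves_def p y wf_blocks_def same_truth_def num_points_def)
        thus ?thesis by blast
      next
        case (Cons p2 ws)
        obtain d2 z where p2: "p2 = (d2, z)" by (cases p2)
        have "sat (truth \<D> a) t x ((d, [r]) # (d2, z) # ws) \<longleftrightarrow> sat (truth \<D> a) t x ((d + d2, z) # ws)"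
          (is "?l \<longleftrightarrow> ?r") for \<D> a t
        proof
          assume ?l
          then obtain t1 t2 where t: "chain (truth \<D> a) t x" "t + length x + d \<le> t1 + 1" "t1 + 1 + d2 \<le> t2 + 1"
            "sat (truth \<D> a) t2 z ws" by auto
          thus ?r by (auto intro!: exI[of _ t2])
        next
          assume ?r
          then obtain t2 where t: "chain (truth \<D> a) t x" "t + length x + (d + d2) \<le> t2 + 1"
            "sat (truth \<D> a) t2 z ws" by auto
          \<comment> \<open>The trivial point is put back exactly \<open>d2\<close> before the next
            block.\<close>
          hence "t + length x + d \<le> (t2 - d2) + 1" "(t2 - d2) + 1 + d2 \<le> t2 + 1" using lx by linarith+
          moreover have "chain (truth \<D> a) (t2 - d2) [r]" using r by (simp add: chain_singleton)
          ultimately show ?l using t unfolding sat.simps by fastforce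
        qed
        hence "improves x (p # qs) x ((d + d2, z) # ws)"
          using wf Cons True by (auto simp: improves_def p p2 y wf_blocks_def same_truth_def num_points_def)
        thus ?thesis by blast
      qed
    next
      case False
      have "sat (truth \<D> a) t x ((d, r # y') # qs) \<longleftrightarrow> sat (truth \<D> a) t x ((d + 1, y') # qs)"
        (is "?l \<longleftrightarrow> ?r") for \<D> a t
      proof
        assume ?l
        then obtain t1 where "chain (truth \<D> a) t x" "t + length x + d \<le> t1 + 1" "sat (truth \<D> a) (Suc t1) y' qs"
          by (auto simp: sat_Cons)
        thus ?r by (auto intro!: exI[of _ "Suc t1"])
      next
        assume ?r
        then obtain t1 where t: "chain (truth \<D> a) t x" "t + length x + (d + 1) \<le> t1 + 1" "sat (truth \<D> a) t1 y' qs"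
          by auto
        then obtain t2 where "t1 = Suc t2" using lx by (cases t1) auto
        thus ?l using t r by (auto simp: sat_Cons intro!: exI[of _ t2])
      qed
      hence "improves x (p # qs) x ((d + 1, y') # qs)"
        using wf False eli_size_pos[of r]
        by (auto simp: improves_def p y wf_blocks_def same_truth_def num_points_def total_size_Cons)
      thus ?thesis by blast
    qed
  qed
qed simp

text \<open>A tautological last point turns into one more step of the following distance, or is
  dropped at the end of the query.\<close>

lemma improve_last:
  "wf_blocks x ps \<Longrightarrow> v \<le> length ps \<Longrightarrow> 1 < length (block x ps v) \<Longrightarrow> eli_entails Top (last (block x ps v)) \<Longrightarrow>
   \<exists>x' ps'. improves x ps x' ps'"
proof (induction v arbitrary: x ps)
  case 0
  obtain x' r where x: "x = x' @ [r]" using 0 by (cases x rule: rev_cases) (auto simp: wf_blocks_def)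
  have x': "x' \<noteq> []" using 0(3) x by auto
  have r: "truth \<D> a t r" for \<D> :: "('a, 'b) temporal_data" and a t
    using 0(4) truth_tautology x by fastforce
  show ?case
  proof (cases ps)
    case Nil
    have "improves x ps x' []"
      using r x' by (auto simp: improves_def Nil x wf_blocks_def same_truth_def num_points_def chain_append chain_singleton)
    thus ?thesis by blast
  next
    case (Cons p ws)
    obtain d z where p: "p = (d, z)" by (cases p)
    have "improves x ps x' ((d + 1, z) # ws)"
      using r x' 0(1) eli_size_pos[of r]
      by (auto simp: improves_def Cons p x wf_blocks_def same_truth_def num_points_def chain_append chain_singleton)
    thus ?thesis by blast
  qed
next
  case (Suc v)
  then obtain d y qs where ps: "ps = (d, y) # qs" by (cases ps) auto
  show ?case using improve_context[OF Suc.IH[of y qs]] Suc.prems by (simp add: ps wf_blocks_Cons)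
qed

text \<open>The primitive block can be put on the last point of its predecessor, where its label
  holds anyway, so it is deleted.\<close>

lemma improve_next:
  "wf_blocks x ps \<Longrightarrow> v < length ps \<Longrightarrow> gap ps v = 0 \<Longrightarrow> length (block x ps (Suc v)) = 1 \<Longrightarrow>
   eli_entails (last (block x ps v)) (hd (block x ps (Suc v))) \<Longrightarrow> \<exists>x' ps'. improves x ps x' ps'"
proof (induction v arbitrary: x ps)
  case 0
  obtain d y qs where ps: "ps = (d, y) # qs" using 0 by (cases ps) auto
  hence d: "d = 0" using 0 by simp
  obtain r where y: "y = [r]" using 0(4) by (auto simp: ps length_Suc_conv)
  have ne: "x \<noteq> []" using 0 by (simp add: wf_blocks_def)
  have lx: "1 \<le> length x" using ne by (simp add: Suc_le_eq)
  have r: "truth \<D> a (t + length x - 1) r" if "chain (truth \<D> a) t x" for \<D> :: "('a, 'b) temporal_data" and a t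
  proof -
    have "length x - 1 < length x" using lx by linarith
    hence "truth \<D> a (t + (length x - 1)) (last x)" using that unfolding chain_def last_conv_nth[OF ne] by blast
    moreover have "t + (length x - 1) = t + length x - 1" using lx by simp
    ultimately show ?thesis using 0(5) truth_entails by (simp add: ps y) 
  qed
  have "sat (truth \<D> a) t x ps \<longleftrightarrow> sat (truth \<D> a) t x qs" for \<D> a t
  proof (cases qs)
    case Nil
    thus ?thesis using r[of \<D> a t] lx by (auto simp: ps d y chain_def intro!: exI[of _ "t + length x - 1"])
  next
    case (Cons p ws)
    obtain d2 z where p: "p = (d2, z)" by (cases p)
    show ?thesis
    proof
      assume "sat (truth \<D> a) t x ps"
      then obtain t1 t2 where t: "chain (truth \<D> a) t x" "t + length x \<le> t1 + 1" "t1 + 1 + d2 \<le> t2 + 1"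
            "sat (truth \<D> a) t2 z ws" by (auto simp: ps d y Cons p)
      hence "t + length x + d2 \<le> t2 + 1" by linarith
      thus "sat (truth \<D> a) t x qs" unfolding Cons p sat.simps using t by blast
    next
      assume "sat (truth \<D> a) t x qs"
      then obtain t2 where t: "chain (truth \<D> a) t x" "t + length x + d2 \<le> t2 + 1"
            "sat (truth \<D> a) t2 z ws" by (auto simp: Cons p)
      have "t + length x + 0 \<le> (t + length x - 1) + 1" "(t + length x - 1) + length [r] + d2 \<le> t2 + 1"
        using t(2) lx by auto
      moreover have "chain (truth \<D> a) (t + length x - 1) [r]" using r[OF t(1)] by (simp add: chain_def)
      ultimately show "sat (truth \<D> a) t x ps" unfolding ps d y Cons p sat.simps using t by blast
    qed
  qed
  moreover have "total_size x qs \<le> total_size x ps" by (cases qs) (auto simp: ps y)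
  ultimately have "improves x ps x qs" using 0(1) by (auto simp: improves_def ps y wf_blocks_def same_truth_def num_points_def)
  thus ?case by blast
next
  case (Suc v)
  then obtain d y qs where ps: "ps = (d, y) # qs" by (cases ps) auto
  show ?case using improve_context[OF Suc.IH[of y qs]] Suc.prems by (simp add: ps wf_blocks_Cons)
qed

text \<open>Dually, the primitive block can be put on the first point of its successor.\<close>

lemma improve_prev:
  "wf_blocks x ps \<Longrightarrow> Suc v < length ps \<Longrightarrow> gap ps (Suc v) = 0 \<Longrightarrow> length (block x ps (Suc v)) = 1 \<Longrightarrow>
   eli_entails (hd (block x ps (Suc (Suc v)))) (last (block x ps (Suc v))) \<Longrightarrow> \<exists>x' ps'. improves x ps x' ps'"
proof (induction v arbitrary: x ps)
  case 0
  obtain d y d2 z ws where ps: "ps = (d, y) # (d2, z) # ws"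
    using 0(2) by (cases ps; cases "tl ps") auto
  hence d: "d2 = 0" using 0 by simp
  obtain r where y: "y = [r]" using 0(4) by (auto simp: ps length_Suc_conv)
  have ne: "z \<noteq> []" using 0 by (simp add: ps wf_blocks_def)
  have r: "truth \<D> a t r" if "sat (truth \<D> a) t z ws" for \<D> :: "('a, 'b) temporal_data" and a t
  proof -
    obtain z0 z' where z: "z = z0 # z'" using ne by (cases z) auto
    hence "truth \<D> a t z0" using that by (simp add: sat_Cons)
    thus ?thesis using 0(5) truth_entails by (simp add: ps y z)
  qed
  have "sat (truth \<D> a) t x ps \<longleftrightarrow> sat (truth \<D> a) t x ((d, z) # ws)" for \<D> a t
  proof
    assume "sat (truth \<D> a) t x ps"
    then obtain t1 t2 where t: "chain (truth \<D> a) t x" "t + length x + d \<le> t1 + 1" "t1 + 1 \<le> t2 + 1"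
            "sat (truth \<D> a) t2 z ws" by (auto simp: ps d y)
    hence "t + length x + d \<le> t2 + 1" by linarith
    thus "sat (truth \<D> a) t x ((d, z) # ws)" using t unfolding sat.simps by blast
  next
    assume "sat (truth \<D> a) t x ((d, z) # ws)"
    then obtain t2 where t: "chain (truth \<D> a) t x" "t + length x + d \<le> t2 + 1" "sat (truth \<D> a) t2 z ws"
      by auto
    thus "sat (truth \<D> a) t x ps" using r[OF t(3)] by (auto simp: ps d y chain_def intro!: exI[of _ t2])
  qed
  hence "improves x ps x ((d, z) # ws)"
    using 0(1) by (auto simp: improves_def ps y wf_blocks_def same_truth_def num_points_def)
  thus ?case by blast
next
  case (Suc v)
  then obtain d y qs where ps: "ps = (d, y) # qs" by (cases ps) auto
  show ?case using improve_context[OF Suc.IH[of y qs]] Suc.prems by (simp add: ps wf_blocks_Cons)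
qed

lemma not_nf_improves:
  assumes wf: "wf_blocks x ps" and n: "\<not> nf x ps"
  shows "\<exists>x' ps'. improves x ps x' ps'"
proof -
  have ne: "block x ps v \<noteq> []" if "v \<le> length ps" for v
    using wf that by (cases v) (auto simp: wf_blocks_def block_def)
  from n ne consider 
      (h) v where "v \<le> length ps" "0 < v" "eli_entails Top (hd (block x ps v))"
    | (l) v where "v \<le> length ps" "0 < v \<or> 1 < length (block x ps v)" "eli_entails Top (last (block x ps v))"
    | (n) v where "v < length ps" "gap ps v = 0" "length (block x ps (Suc v)) = 1"
        "eli_entails (last (block x ps v)) (hd (block x ps (Suc v)))"
    | (p) v where "v < length ps" "0 < v" "gap ps v = 0" "length (block x ps v) = 1"
        "eli_entails (hd (block x ps (Suc v))) (last (block x ps v))"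
    unfolding nf_def by blast
  thus ?thesis
  proof cases
    case (h v)
    thus ?thesis using improve_hd[OF wf, of "v - 1"] by simp
  next
    case (l v)
    show ?thesis
    proof (cases "1 < length (block x ps v)")
      case True
      thus ?thesis using improve_last[OF wf l(1)] l by blast
    next
      case False
      hence "length (block x ps v) = Suc 0" using ne[OF l(1)] by (cases "block x ps v") auto
      hence "hd (block x ps v) = last (block x ps v)" by (simp add: length_1_nth)
      thus ?thesis using improve_hd[OF wf, of "v - 1"] l False by simp
    qed
  next
    case (n v)
    thus ?thesis using improve_next[OF wf] by blast
  next
    case (p v)
    thus ?thesis using improve_prev[OF wf, of "v - 1"] by simp
  qed
qed

lemma nf_exists:
  assumes "wf_blocks x ps"
  shows "\<exists>y qs. nf y qs \<and> same_truth x ps y qs \<and> total_size y qs \<le> total_size x ps \<and>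
    ((\<forall>p\<in>set ps. 1 \<le> fst p) \<longrightarrow> (\<forall>p\<in>set qs. 1 \<le> fst p))"
  using assms
proof (induction "num_points x ps" arbitrary: x ps rule: less_induct)
  case less
  show ?case
  proof (cases "nf x ps")
    case True
    thus ?thesis by (intro exI[of _ x] exI[of _ ps]) (auto simp: same_truth_def)
  next
    case False
    then obtain x' ps' where i: "improves x ps x' ps'" using not_nf_improves less.prems by blast
    then obtain y qs where y: "nf y qs" "same_truth x' ps' y qs" "total_size y qs \<le> total_size x' ps'"
      "(\<forall>p\<in>set ps'. 1 \<le> fst p) \<longrightarrow> (\<forall>p\<in>set qs. 1 \<le> fst p)"
      using less.hyps[of x' ps'] by (auto simp: improves_def)
    have "same_truth x ps y qs" "total_size y qs \<le> total_size x ps" "(\<forall>p\<in>set ps. 1 \<le> fst p) \<longrightarrow> (\<forall>p\<in>set qs. 1 \<le> fst p)"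
      using i y(2-4) by (auto simp: improves_def same_truth_def)
    thus ?thesis using y(1) by blast
  qed
qed

section \<open>Path queries as sequences of blocks\<close>

fun first_block :: "('u, 'b) eli \<Rightarrow> (temporal_op \<times> ('u, 'b) eli) list \<Rightarrow> ('u, 'b) eli list" where
  "first_block r ((Next, s) # ops) = r # first_block s ops"
| "first_block r ops = [r]"

text \<open>Intermediate \<open>Top\<close> points between diamonds become primitive blocks here;
  normalisation turns them into distances.\<close>

fun other_blocks :: "(temporal_op \<times> ('u, 'b) eli) list \<Rightarrow> ('u, 'b) later_blocks" where
  "other_blocks [] = []"
| "other_blocks ((Next, s) # ops) = other_blocks ops"
| "other_blocks ((Dia, s) # ops) = (1, first_block s ops) # other_blocks ops"
| "other_blocks ((DiaR, s) # ops) = (0, first_block s ops) # other_blocks ops"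

lemma path_holds_blocks:
  "path_holds \<D> a t r ops \<longleftrightarrow> sat (truth \<D> a) t (first_block r ops) (other_blocks ops)"
proof (induction ops arbitrary: t r)
  case Nil
  then show ?case by (simp add: chain_def truth_def)
next
  case (Cons p ops)
  obtain opr s where p: "p = (opr, s)" by (cases p)
  show ?case
    by (cases opr) (auto simp: p Cons sat_Cons chain_singleton Suc_le_eq less_Suc_eq_le simp flip: truth_def)
qed

lemma wf_first_block: "first_block r ops \<noteq> []"
  by (cases "(r, ops)" rule: first_block.cases) auto

lemma wf_blocks_path: "wf_blocks (first_block r ops) (other_blocks ops)"
  by (induction ops rule: other_blocks.induct) (auto simp: wf_blocks_def wf_first_block)

lemma total_size_path: "total_size (first_block r ops) (other_blocks ops) \<le> query_size (r, ops)"
proof (induction ops arbitrary: r)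
  case Nil
  then show ?case by (simp add: query_size_def)
next
  case (Cons p ops)
  obtain opr s where p: "p = (opr, s)" by (cases p)
  show ?case using Cons[of s] by (cases opr) (auto simp: p total_size_Cons query_size_def)
qed

lemma gaps_path: "DiaR \<notin> fst ` set ops \<Longrightarrow> \<forall>p\<in>set (other_blocks ops). 1 \<le> fst p"
  by (induction ops rule: other_blocks.induct) auto

definition represents :: "('u, 'b) eli list \<Rightarrow> ('u, 'b) later_blocks \<Rightarrow> ('u, 'b) path_query \<Rightarrow> bool" where
  "represents x ps q \<longleftrightarrow> (\<forall>\<D> a t. is_temporal_data \<D> \<longrightarrow> (holds \<D> a t q \<longleftrightarrow> sat (truth \<D> a) t x ps))"

lemma represented_nf:
  obtains x ps where "nf x ps" "represents x ps q" "total_size x ps \<le> query_size q"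
    "DiaR \<notin> fst ` set (snd q) \<Longrightarrow> \<forall>v<length ps. 1 \<le> gap ps v"
proof -
  obtain r ops where q: "q = (r, ops)" by (cases q)
  obtain y qs where y: "nf y qs" "same_truth (first_block r ops) (other_blocks ops) y qs"
    "total_size y qs \<le> total_size (first_block r ops) (other_blocks ops)"
    "(\<forall>p\<in>set (other_blocks ops). 1 \<le> fst p) \<longrightarrow> (\<forall>p\<in>set qs. 1 \<le> fst p)"
    using nf_exists[OF wf_blocks_path] by blast
  have "represents y qs q"
    using y(2) by (simp add: represents_def same_truth_def holds_def q path_holds_blocks)
  moreover have "total_size y qs \<le> query_size q" using y(3) total_size_path[of r ops] q by simp
  moreover have "DiaR \<notin> fst ` set (snd q) \<Longrightarrow> \<forall>v<length qs. 1 \<le> gap qs v"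
    using gaps_path[of ops] y(4) q by (auto simp: gap_def)
  ultimately show ?thesis using that y(1) by blast
qed

lemma equivalent_represents:
  "represents x ps q \<Longrightarrow> equivalent q q' \<longleftrightarrow> represents x ps q'"
  by (auto simp: represents_def equivalent_def entails_def)

text \<open>A distance \<open>d\<close> is written without \<open>Dia\<close>, as \<open>d\<close>
  steps \<open>Next\<close> through \<open>Top\<close> followed by one \<open>DiaR\<close>.\<close>

lemma distance_query:
  "\<exists>ops'. fst ` set ops' \<subseteq> {Next, DiaR} \<union> fst ` set ops \<and>
     (\<forall>\<D> a t. path_holds \<D> a t r ops' \<longleftrightarrow> truth \<D> a t r \<and> (\<exists>t'\<ge>t + d. path_holds \<D> a t' s ops))"
proof (induction d arbitrary: r)
  case 0
  show ?case by (intro exI[of _ "(DiaR, s) # ops"]) (auto simp: truth_def)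
next
  case (Suc d)
  obtain ops' where "fst ` set ops' \<subseteq> {Next, DiaR} \<union> fst ` set ops"
     "\<And>\<D> a t. path_holds \<D> a t Top ops' \<longleftrightarrow> truth \<D> a t Top \<and> (\<exists>t'\<ge>t + d. path_holds \<D> a t' s ops)"
    using Suc[of Top] by blast
  thus ?case by (intro exI[of _ "(Next, Top) # ops'"]) (auto simp: truth_def)
qed

lemma represents_exists:
  "wf_blocks x ps \<Longrightarrow> \<exists>q\<in>path_queries {Next, DiaR}. represents x ps q"
proof -
  assume wf: "wf_blocks x ps"
  have "\<exists>r ops. fst ` set ops \<subseteq> {Next, DiaR} \<and>
    (\<forall>\<D> a t. path_holds \<D> a t r ops \<longleftrightarrow> sat (truth \<D> a) t x ps)"
    using wf
  proof (induction ps arbitrary: x)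
    case Nil
    thus ?case
    proof (induction x)
      case (Cons r x)
      show ?case
      proof (cases "x = []")
        case True
        thus ?thesis by (intro exI[of _ r] exI[of _ "[]"]) (auto simp: chain_def truth_def)
      next
        case False
        then obtain s ops where "fst ` set ops \<subseteq> {Next, DiaR}"
          "\<forall>\<D> a t. path_holds \<D> a t s ops \<longleftrightarrow> sat (truth \<D> a) t x []" using Cons by (auto simp: wf_blocks_def)
        thus ?thesis by (intro exI[of _ r] exI[of _ "(Next, s) # ops"]) (auto simp: sat_Cons simp del: sat.simps simp flip: truth_def)
      qed
    qed (simp add: wf_blocks_def)
  next
    case (Cons p ps)
    obtain d y where p: "p = (d, y)" by (cases p)
    obtain s ops where s: "fst ` set ops \<subseteq> {Next, DiaR}"
      "\<And>\<D> a t. path_holds \<D> a t s ops \<longleftrightarrow> sat (truth \<D> a) t y ps"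
      using Cons.IH[of y] Cons.prems by (auto simp: p wf_blocks_Cons)
    have "x \<noteq> []" using Cons.prems by (simp add: wf_blocks_def)
    thus ?case
    proof (induction x)
      case (Cons r x)
      show ?case
      proof (cases "x = []")
        case True
        obtain ops' where o: "fst ` set ops' \<subseteq> {Next, DiaR} \<union> fst ` set ops"
          "\<And>\<D> a t. path_holds \<D> a t r ops' \<longleftrightarrow> truth \<D> a t r \<and> (\<exists>t'\<ge>t + d. path_holds \<D> a t' s ops)"
          using distance_query[of ops r d s] by blast
        show ?thesis
        proof (intro exI[of _ r] exI[of _ ops'] conjI allI)
          show "fst ` set ops' \<subseteq> {Next, DiaR}" using o(1) s(1) by blast
        qed (use o(2) s(2) True in \<open>simp add: p chain_singleton\<close>)
      next
        case False
        then obtain s ops where "fst ` set ops \<subseteq> {Next, DiaR}"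
          "\<forall>\<D> a t. path_holds \<D> a t s ops \<longleftrightarrow> sat (truth \<D> a) t x (p # ps)" using Cons by auto
        thus ?thesis by (intro exI[of _ r] exI[of _ "(Next, s) # ops"]) (auto simp: sat_Cons simp del: sat.simps simp flip: truth_def)
      qed
    qed simp
  qed
  then obtain r ops where "fst ` set ops \<subseteq> {Next, DiaR}"
    "\<forall>\<D> a t. path_holds \<D> a t r ops \<longleftrightarrow> sat (truth \<D> a) t x ps" by blast
  thus ?thesis
    by (intro bexI[of _ "(r, ops)"]) (auto simp: represents_def holds_def path_queries_def)
qed

section \<open>Safe queries\<close>

definition lone :: "('u, 'b) eli list \<Rightarrow> ('u, 'b) later_blocks \<Rightarrow> nat \<Rightarrow> bool" where
  "lone x ps i \<longleftrightarrow> 0 < i \<and> i \<le> length ps \<and> length (block x ps i) = 1 \<and>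
     (\<exists>p1 p2. eli_equivalent (hd (block x ps i)) (And p1 p2) \<and>
        \<not> eli_entails p1 (hd (block x ps i)) \<and> \<not> eli_entails p2 (hd (block x ps i)))"

definition distance :: "temporal_op list \<Rightarrow> nat" where
  "distance R = (if R = [DiaR] then 0 else length R)"

text \<open>This is \<open>path_holds\<close> without the label of the current point, which belongs
  to the preceding block when \<open>attach\<close> is evaluated.\<close>

fun reaches_path :: "('u, 'b) temporal_data \<Rightarrow> individual \<Rightarrow> nat \<Rightarrow> (temporal_op \<times> ('u, 'b) eli) list \<Rightarrow> bool" where
  "reaches_path \<D> a t [] \<longleftrightarrow> True"
| "reaches_path \<D> a t ((opr, s) # ops) \<longleftrightarrow> (\<exists>m. op_reaches opr t m \<and> path_holds \<D> a m s ops)"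

lemma path_holds_reaches: "path_holds \<D> a t r ops \<longleftrightarrow> truth \<D> a t r \<and> reaches_path \<D> a t ops"
  by (cases "(\<D>, a, t, ops)" rule: reaches_path.cases) (auto simp: truth_def)

lemma path_holds_chain:
  "path_holds \<D> a t r (map (Pair Next) x @ ops) \<longleftrightarrow> chain (truth \<D> a) t (r # x) \<and> reaches_path \<D> a (t + length x) ops"
proof (induction x arbitrary: t r)
  case Nil
  then show ?case by (simp add: path_holds_reaches chain_def)
next
  case (Cons s x)
  have "chain (truth \<D> a) t (r # s # x) \<longleftrightarrow> truth \<D> a t r \<and> chain (truth \<D> a) (Suc t) (s # x)"
    using sat_Cons[of "truth \<D> a" t r "s # x" "[]"] by simp
  then show ?case using Cons[of "Suc t" s] by (simp flip: truth_def)
qed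

lemma reaches_path_Dia:
  "reaches_path \<D> a t (zip (replicate (Suc n) Dia) (replicate n Top @ [s]) @ ops) \<longleftrightarrow>
    (\<exists>m\<ge>t + Suc n. path_holds \<D> a m s ops)"
proof (induction n arbitrary: t)
  case 0
  then show ?case by (simp add: Suc_le_eq)
next
  case (Suc n)
  have "reaches_path \<D> a t (zip (replicate (Suc (Suc n)) Dia) (replicate (Suc n) Top @ [s]) @ ops) \<longleftrightarrow>
      (\<exists>m>t. reaches_path \<D> a m (zip (replicate (Suc n) Dia) (replicate n Top @ [s]) @ ops))"
    using path_holds_reaches[of \<D> a _ Top] by (simp add: truth_def)
  also have "\<dots> \<longleftrightarrow> (\<exists>m>t. \<exists>m'\<ge>m + Suc n. path_holds \<D> a m' s ops)"
    using Suc by blast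
  also have "\<dots> \<longleftrightarrow> (\<exists>m'\<ge>t + Suc (Suc n). path_holds \<D> a m' s ops)"
  proof
    assume "\<exists>m>t. \<exists>m'\<ge>m + Suc n. path_holds \<D> a m' s ops"
    then obtain m m' where m: "t < m" "m + Suc n \<le> m'" "path_holds \<D> a m' s ops" by blast
    hence "t + Suc (Suc n) \<le> m'" by linarith
    thus "\<exists>m'\<ge>t + Suc (Suc n). path_holds \<D> a m' s ops" using m(3) by blast
  next
    assume "\<exists>m'\<ge>t + Suc (Suc n). path_holds \<D> a m' s ops"
    then obtain m' where "Suc t + Suc n \<le> m'" "path_holds \<D> a m' s ops" by auto
    thus "\<exists>m>t. \<exists>m'\<ge>m + Suc n. path_holds \<D> a m' s ops" by (intro exI[of _ "Suc t"]) auto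
  qed
  finally show ?case .
qed

lemma reaches_path_attach:
  assumes R: "R = [DiaR] \<or> set R = {Dia}" and b: "b \<noteq> []"
  shows "reaches_path \<D> a t (attach R b @ ops) \<longleftrightarrow>
    (\<exists>m\<ge>t + distance R. path_holds \<D> a m (hd b) (map (Pair Next) (tl b) @ ops))"
  using R
proof
  assume "R = [DiaR]"
  thus ?thesis by (simp add: attach_def distance_def)
next
  assume R: "set R = {Dia}"
  then obtain n where n: "length R = Suc n" by (cases R) auto
  have "R = replicate (Suc n) Dia" using R n by (metis replicate_length_same singletonD)
  thus ?thesis
    using reaches_path_Dia[of \<D> a t n "hd b" "map (Pair Next) (tl b) @ ops"]
    by (simp add: attach_def distance_def)
qed

lemma path_holds_division:
  assumes "length Rs = length bs" "b \<noteq> []" "\<forall>b\<in>set bs. b \<noteq> []" "\<forall>R\<in>set Rs. R = [DiaR] \<or> set R = {Dia}"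
  shows "path_holds \<D> a t (hd b) (map (Pair Next) (tl b) @ concat (map2 attach Rs bs)) \<longleftrightarrow>
    sat (truth \<D> a) t b (zip (map distance Rs) bs)"
  using assms
proof (induction Rs bs arbitrary: b t rule: list_induct2)
  case Nil
  then show ?case using path_holds_chain[of \<D> a t "hd b" "tl b" "[]"] by simp
next
  case (Cons R Rs c bs)
  have R: "R = [DiaR] \<or> set R = {Dia}" and c: "c \<noteq> []" using Cons.prems by auto
  have IH: "path_holds \<D> a m (hd c) (map (Pair Next) (tl c) @ concat (map2 attach Rs bs)) \<longleftrightarrow>
    sat (truth \<D> a) m c (zip (map distance Rs) bs)" for m
    using Cons by auto
  obtain b0 b' where b: "b = b0 # b'" using Cons.prems by (cases b) auto
  have "t + length b' + distance R \<le> m \<longleftrightarrow> t + length b + distance R \<le> m + 1" for m by (simp add: b)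
  thus ?case
    using path_holds_chain[of \<D> a t "hd b" "tl b"]
    by (simp add: b reaches_path_attach[OF R c] IH)
qed

lemma normal_division_iff:
  assumes d: "length bs = length Rs + 1" "\<forall>b\<in>set bs. b \<noteq> []" and R: "\<forall>R\<in>set Rs. R = [DiaR] \<or> set R = {Dia}"
  shows "normal_division bs Rs \<longleftrightarrow> nf (hd bs) (zip (map distance Rs) (tl bs))"
    and "lone_conjunct bs i \<longleftrightarrow> lone (hd bs) (zip (map distance Rs) (tl bs)) i"
proof -
  let ?x = "hd bs" and ?ps = "zip (map distance Rs) (tl bs)"
  have lp: "length ?ps = length Rs" using d by simp
  have bl: "block ?x ?ps v = bs ! v" for v
  proof -
    have "?x # map snd ?ps = bs" using d by (cases bs) auto
    thus ?thesis by (simp add: block_def)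
  qed
  have gp: "gap ?ps v = 0 \<longleftrightarrow> Rs ! v = [DiaR]" if "v < length Rs" for v
  proof -
    have "Rs ! v = [DiaR] \<or> set (Rs ! v) = {Dia}" using R nth_mem[OF that] by blast
    thus ?thesis using that d by (auto simp: gap_def distance_def)
  qed
  have le: "v \<le> length Rs \<longleftrightarrow> v < length bs" for v using d by auto
  have ne: "\<forall>v<length bs. bs ! v \<noteq> []" using d by auto
  show "normal_division bs Rs \<longleftrightarrow> nf ?x ?ps"
    unfolding normal_division_def nf_def lp bl le eli_equivalent_Top primitive_block_def
    using R ne gp by auto
  show "lone_conjunct bs i \<longleftrightarrow> lone ?x ?ps i"
    unfolding lone_conjunct_def lone_def lp bl le primitive_block_def by blast
qed

text \<open>For the converse, distances are spelled out as a single \<open>DiaR\<close> or as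
  repeated \<open>Dia\<close>; the latter is possible because the witness in \<open>safe\<close> may
  use all three operators.\<close>

lemma safe_iff: "safe q \<longleftrightarrow> (\<exists>x ps. nf x ps \<and> represents x ps q \<and> \<not> (\<exists>i. lone x ps i))"
proof
  assume "safe q"
  then obtain q' bs Rs where s: "equivalent q q'" "divides_into q' bs Rs" "normal_division bs Rs" "\<not> (\<exists>i. lone_conjunct bs i)"
    unfolding safe_def by blast
  let ?ps = "zip (map distance Rs) (tl bs)"
  have R: "\<forall>R\<in>set Rs. R = [DiaR] \<or> set R = {Dia}" using s(3) unfolding normal_division_def by blast
  have d: "length bs = length Rs + 1" "\<forall>b\<in>set bs. b \<noteq> []"
    "q' = (hd (hd bs), map (Pair Next) (tl (hd bs)) @ concat (map2 attach Rs (tl bs)))"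
    using s(2) unfolding divides_into_def by blast+
  have h: "hd bs \<noteq> []" "\<forall>b\<in>set (tl bs). b \<noteq> []" using d(1,2) by (cases bs; auto)+
  have "represents (hd bs) ?ps q'"
    using path_holds_division[OF _ h R] d(1) by (simp add: represents_def holds_def d(3))
  hence "represents (hd bs) ?ps q" using s(1) by (auto simp: represents_def equivalent_def entails_def)
  thus "\<exists>x ps. nf x ps \<and> represents x ps q \<and> \<not> (\<exists>i. lone x ps i)"
    using s(3,4) unfolding normal_division_iff[OF d(1,2) R] by blast
next
  assume "\<exists>x ps. nf x ps \<and> represents x ps q \<and> \<not> (\<exists>i. lone x ps i)"
  then obtain x ps where s: "nf x ps" "represents x ps q" "\<not> (\<exists>i. lone x ps i)" by blast
  define Rs where "Rs = map (\<lambda>p. if fst p = 0 then [DiaR] else replicate (fst p) Dia) ps"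
  define bs where "bs = x # map snd ps"
  define q' where "q' = (hd (hd bs), map (Pair Next) (tl (hd bs)) @ concat (map2 attach Rs (tl bs)))"
  have R: "\<forall>R\<in>set Rs. R = [DiaR] \<or> set R = {Dia}" by (auto simp: Rs_def)
  have d: "length bs = length Rs + 1" "\<forall>b\<in>set bs. b \<noteq> []"
    using nf_ne[OF s(1)] by (auto simp: Rs_def bs_def)
  have "replicate n Dia \<noteq> [DiaR]" for n by (cases n) auto
  hence "map distance Rs = map fst ps" by (auto simp: Rs_def distance_def)
  hence ps: "zip (map distance Rs) (tl bs) = ps" by (simp add: bs_def zip_map_fst_snd)
  have x: "hd bs = x" by (simp add: bs_def)
  have div: "divides_into q' bs Rs" using d by (auto simp: divides_into_def q'_def Rs_def)
  have h: "hd bs \<noteq> []" "\<forall>b\<in>set (tl bs). b \<noteq> []" using d(1,2) by (cases bs; auto)+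
  have "represents x ps q'"
    using path_holds_division[OF _ h R] d(1) by (simp add: represents_def holds_def q'_def ps x)
  hence "equivalent q q'" using equivalent_represents s(2) by blast
  thus "safe q"
    using div s(1,3) normal_division_iff[OF d R] unfolding safe_def ps x by blast
qed

section \<open>Lone conjuncts prevent characterisability\<close>

fun alternate :: "('u, 'b) eli \<Rightarrow> ('u, 'b) eli \<Rightarrow> nat \<Rightarrow> ('u, 'b) later_blocks \<Rightarrow> ('u, 'b) later_blocks" where
  "alternate p1 p2 0 vs = vs"
| "alternate p1 p2 (Suc n) vs = (0, [p2]) # (0, [p1]) # alternate p1 p2 n vs"

text \<open>With an empty first block, \<open>sat\<close> describes the rest of a query behind a
  point, which is easier to satisfy from an earlier point.\<close>

lemma sat_Nil_antimono: "sat T s [] vs \<Longrightarrow> t \<le> s \<Longrightarrow> sat T t [] vs"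
proof (cases vs)
  case (Cons p ws)
  assume s: "sat T s [] vs" "t \<le> s"
  obtain d z where p: "p = (d, z)" by (cases p)
  obtain t' where t': "s + d \<le> t' + 1" "sat T t' z ws" using s by (auto simp: Cons p)
  hence "t + d \<le> t' + 1" using s(2) by linarith
  thus ?thesis using t' by (auto simp: Cons p chain_def)
qed (simp add: chain_def)

text \<open>All points of the chain are put on \<open>t\<close>.\<close>

lemma sat_alternate:
  assumes "sat (truth \<D> a) t [r] vs" "eli_entails r p1" "eli_entails r p2"
  shows "sat (truth \<D> a) t [p1] (alternate p1 p2 n vs)"
proof (induction n)
  case 0
  then show ?case using assms truth_entails by (auto simp: sat_Cons)
next
  case (Suc n)
  have "truth \<D> a t p1" "truth \<D> a t p2" using assms truth_entails by (auto simp: sat_Cons)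
  then show ?case using Suc by (auto simp: chain_singleton intro!: exI[of _ t])
qed

lemma alternate_sat:
  "sat T t [p1] (alternate p1 p2 n vs) \<Longrightarrow> sat T t [p1] vs"
proof (induction n arbitrary: t)
  case (Suc n)
  then obtain t1 t2 where t: "T t p1" "t \<le> t1" "t1 \<le> t2" "sat T t2 [p1] (alternate p1 p2 n vs)"
    by (auto simp: chain_singleton)
  have "sat T (Suc t2) [] vs" using Suc.IH[OF t(4)] by (simp add: sat_Cons)
  hence "sat T (Suc t) [] vs" by (rule sat_Nil_antimono) (use t in simp)
  then show ?case using t(1) by (simp add: sat_Cons)
qed simp

text \<open>
  On data of length at most \<open>n + t\<close> two neighbouring points of the alternating chain coincide,
  which makes both conjuncts true at the same time.
\<close>

lemma alternate_collapses:
  assumes eq: "eli_equivalent r (And p1 p2)" and top: "\<not> eli_entails Top p1"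
  shows "sat (truth \<D> a) t [p1] (alternate p1 p2 n vs) \<Longrightarrow> length \<D> \<le> n + t \<Longrightarrow>
    \<exists>t'\<ge>t. sat (truth \<D> a) t' [r] vs"
proof (induction n arbitrary: t)
  case 0
  \<comment> \<open>Now \<open>t\<close> lies beyond the data, where \<open>p1\<close>, being no
    tautology, cannot hold.\<close>
  hence "eli_holds {} a p1" by (simp add: sat_Cons truth_def at_time_def)
  thus ?case using top eli_holds_empty by blast
next
  case (Suc n)
  then obtain t1 t2 where t: "truth \<D> a t p1" "t \<le> t1" "truth \<D> a t1 p2" "t1 \<le> t2"
    "sat (truth \<D> a) t2 [p1] (alternate p1 p2 n vs)"
    by (auto simp: chain_singleton)
  show ?case
  \<comment> \<open>If the next point of \<open>p1\<close> has not moved, the point of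
    \<open>p2\<close> in between has not either and \<open>r\<close> holds at \<open>t\<close>.
    Otherwise time has advanced, which makes up for the lost round in \<open>n + t\<close>.\<close>
  proof (cases "t2 = t")
    case True
    hence "truth \<D> a t (And p1 p2)" using t by (simp add: truth_def)
    hence "truth \<D> a t r" using eq truth_entails by (auto simp: equivalent_def)
    moreover have "sat (truth \<D> a) (Suc t) [] vs" using alternate_sat[OF t(5)] True by (simp add: sat_Cons)
    ultimately show ?thesis by (auto simp: sat_Cons)
  next
    case False
    hence "length \<D> \<le> n + t2" using Suc.prems t by linarith
    then obtain t' where "t' \<ge> t2" "sat (truth \<D> a) t' [r] vs" using Suc.IH[OF t(5)] by blast
    moreover from this have "t' \<ge> t" using t by linarith
    ultimately show ?thesis by blast
  qed
qed

lemma sat_context: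
  assumes "\<And>t. sat T t y qs \<Longrightarrow> \<exists>t'\<ge>t. sat T t' y' qs'"
  shows "sat T t x (us @ (d, y) # qs) \<Longrightarrow> sat T t x (us @ (d, y') # qs')"
proof (induction us arbitrary: t x)
  case Nil
  then obtain t1 where t1: "chain T t x" "t + length x + d \<le> t1 + 1" "sat T t1 y qs" by auto
  then obtain t' where "t' \<ge> t1" "sat T t' y' qs'" using assms by blast
  moreover from this have "t + length x + d \<le> t' + 1" using t1 by linarith
  ultimately show ?case using t1(1) unfolding append.simps sat.simps by blast
next
  case (Cons p us)
  then show ?case by (cases p) auto
qed

lemma alternate_labels: "v \<in> snd ` set (alternate p1 p2 n vs) \<Longrightarrow> v = [p1] \<or> v = [p2] \<or> v \<in> snd ` set vs"
  by (induction n) auto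

text \<open>The query \<open>q'\<close> has a chain longer than all data of \<open>E\<close> in
  place of the lone conjunct, so it fits \<open>E\<close>. It is true in the word of its own
  separated blocks, whereas \<open>q\<close> is false there by rigidity: block \<open>i\<close>
  would lie on a letter of \<open>p1\<close> or \<open>p2\<close>, and neither entails it.\<close>

lemma lone_not_characterisable:
  assumes nf: "nf x ps" and lone: "lone x ps i" and rep: "represents x ps q"
    and E: "uniquely_characterises E q (path_queries {Next, DiaR})"
  shows False
proof -
  let ?r = "hd (block x ps i)"
  obtain p1 p2 where p: "eli_equivalent ?r (And p1 p2)" "\<not> eli_entails p1 ?r" "\<not> eli_entails p2 ?r"
    and i: "0 < i" "i \<le> length ps" "length (block x ps i) = 1" using lone unfolding lone_def by blast
  have rp: "eli_entails ?r p1" "eli_entails ?r p2" and pr: "eli_entails (And p1 p2) ?r"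
    using p(1) by (auto simp: equivalent_def eli_entails_And)
  \<comment> \<open>If \<open>p1\<close> were a tautology, \<open>p2\<close> alone would entail the
    label.\<close>
  have top: "\<not> eli_entails Top p1"
  proof
    assume "eli_entails Top p1"
    hence "eli_entails p2 (And p1 p2)"
      using eli_entails_trans[OF eli_entails_Top] by (auto simp: eli_entails_And eli_entails_refl)
    thus False using pr p(3) eli_entails_trans by blast
  qed
  define us vs d where "us = take (i - 1) ps" and "vs = drop i ps" and "d = fst (ps ! (i - 1))"
  have "snd (ps ! (i - 1)) = block x ps i" using i by (simp add: block_def)
  moreover have "block x ps i = [?r]" using i(3) by (cases "block x ps i") auto
  ultimately have psi: "ps ! (i - 1) = (d, [?r])" by (metis d_def prod.collapse)
  have ps: "ps = us @ (d, [?r]) # vs"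
    using id_take_nth_drop[of "i - 1" ps] i unfolding psi us_def vs_def by simp
  have li: "i = Suc (length us)" using i by (simp add: us_def)
  have finE: "finite (fst E \<union> snd E)" "\<And>\<D> a. (\<D>, a) \<in> fst E \<union> snd E \<Longrightarrow> is_temporal_data \<D>"
    using E by (auto simp: uniquely_characterises_def is_example_set_def)
  define n where "n = (\<Sum>(\<D>, a)\<in>fst E \<union> snd E. length \<D>)"
  have n: "length \<D> \<le> n" if "(\<D>, a) \<in> fst E \<union> snd E" for \<D> a
    unfolding n_def using member_le_sum[OF that, of "\<lambda>(\<D>, a). length \<D>"] finE(1) by auto
  define ps' where "ps' = us @ (d, [p1]) # alternate p1 p2 n vs"
  have wf': "wf_blocks x ps'"
  proof -
    have uv: "snd p \<noteq> []" if "p \<in> set us \<or> p \<in> set vs" for p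
      using that nf_ne(2)[OF nf] set_take_subset[of "i - 1" ps] set_drop_subset[of i ps]
      unfolding us_def vs_def by blast
    have "snd p \<noteq> []" if p: "p \<in> set (alternate p1 p2 n vs)" for p
      using alternate_labels[OF imageI[OF p]] uv by (metis imageE list.distinct(1))
    thus ?thesis using nf_ne(1)[OF nf] uv unfolding wf_blocks_def ps'_def by auto
  qed
  then obtain q' where q': "q' \<in> path_queries {Next, DiaR}" "represents x ps' q'"
    using represents_exists by blast
  have forward: "sat (truth \<D> a) t x ps \<Longrightarrow> sat (truth \<D> a) t x ps'" for \<D> a t
    unfolding ps'_def by (subst (asm) ps, erule sat_context[rotated]) (use sat_alternate rp in blast)
  have backward: "sat (truth \<D> a) t x ps' \<Longrightarrow> sat (truth \<D> a) t x ps" if "length \<D> \<le> n" for \<D> a t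
    unfolding ps'_def
    by (subst ps, erule sat_context[rotated]) (use alternate_collapses[OF p(1) top] that trans_le_add1 in blast)
  have "fits q' E"
  proof -
    have h: "holds \<D> a 0 q' \<longleftrightarrow> holds \<D> a 0 q" if "(\<D>, a) \<in> fst E \<union> snd E" for \<D> a
      using forward[of \<D> a 0] backward[OF n[OF that], of a 0] rep q'(2) finE(2)[OF that]
      by (auto simp: represents_def)
    have "fits q E" using E by (simp add: uniquely_characterises_def)
    thus ?thesis using h unfolding fits_def by fastforce
  qed
  hence "equivalent q q'" using E q'(1) by (simp add: uniquely_characterises_def)
  hence rep': "represents x ps q'" using equivalent_represents rep by blast
  \<comment> \<open>Large enough for the distances of \<open>ps'\<close>, when \<open>q'\<close> is
    placed, and for the blocks of \<open>x\<close>, \<open>ps\<close>, when an embedding is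
    extracted.\<close>
  define b where "b = total_size x ps + total_size x ps'"
  let ?ss = "segments x ps'"
  define ms where "ms = [canonical p1] # map (map canonical) (map snd (alternate p1 p2 n []))"
  have alt: "alternate p1 p2 n vs = alternate p1 p2 n [] @ vs" by (induction n) auto
  have ss: "?ss = replace i ms (segments x ps)"
    unfolding replace_def segments_def by (subst (1 2) ps) (simp add: ps'_def li ms_def alt)
  have "sat (truth (word b ?ss) 0) 0 x ps'"
    by (rule seg_emb_sat[OF self_emb]) (auto simp: eli_entails_refl b_def intro: trans_le_add2 gap_size)
  moreover have "is_temporal_data (word b ?ss)"
    using nf_ne[OF nf] by (intro is_temporal_data_word) (auto simp: segments_def finite_canonical)
  ultimately have "sat (truth (word b ?ss) 0) 0 x ps"
    using rep' q'(2) by (simp add: represents_def)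
  moreover have "\<forall>v\<le>length ps. length (block x ps v) \<le> b"
    unfolding b_def using block_length trans_le_add1 by blast
  ultimately obtain \<sigma> f where e: "seg_emb ?ss x ps \<sigma> f"
    using sat_seg_emb[OF _ nf, of b ?ss] nf_ne[OF nf] by (auto simp: segments_def)
  have "ms \<noteq> []" by (simp add: ms_def)
  then obtain m where m: "m < length ms" "f i + length (block x ps i) \<le> length (ms ! m)"
    "\<And>j. j < length (block x ps i) \<Longrightarrow> eli_holds (ms ! m ! (f i + j)) 0 (block x ps i ! j)"
    using replaced_seg_emb[OF nf i(2) _ e[unfolded ss]] by blast
  have "ms ! m = [canonical p1] \<or> ms ! m = [canonical p2]"
    using nth_mem[OF m(1)] alternate_labels[of _ p1 p2 n "[]"] by (fastforce simp: ms_def)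
  thus False
  proof
    assume c: "ms ! m = [canonical p1]"
    hence "eli_holds (canonical p1) 0 ?r" using m(2) m(3)[of 0] i(3) by (simp add: length_1_nth)
    thus False using p(2) eli_entails_iff_canonical by blast
  next
    assume c: "ms ! m = [canonical p2]"
    hence "eli_holds (canonical p2) 0 ?r" using m(2) m(3)[of 0] i(3) by (simp add: length_1_nth)
    thus False using p(3) eli_entails_iff_canonical by blast
  qed
qed

section \<open>Characterising example sets\<close>

text \<open>If every frontier instance missed some strictly weaker query, the conjunction of these
  finitely many queries would still be strictly weaker, as \<open>r\<close> is no conjunction of two
  weaker ones; but then some instance satisfies it.\<close>

lemma covers_prime:
  assumes F: "frontier r F" and top: "\<not> eli_entails Top r"
    and prime: "\<not> (\<exists>p1 p2. eli_equivalent r (And p1 p2) \<and> \<not> eli_entails p1 r \<and> \<not> eli_entails p2 r)"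
  shows "\<exists>\<phi>\<in>F. \<forall>n. covers [\<phi>] r n"
proof -
  have "\<exists>\<phi>\<in>F. \<forall>p. eli_entails r p \<longrightarrow> \<not> eli_entails p r \<longrightarrow> eli_holds \<phi> 0 p"
  proof (rule ccontr)
    assume "\<not> ?thesis"
    then obtain p where p: "\<And>\<phi>. \<phi> \<in> F \<Longrightarrow> eli_entails r (p \<phi>) \<and> \<not> eli_entails (p \<phi>) r \<and> \<not> eli_holds \<phi> 0 (p \<phi>)"
      by metis
    have conj: "\<exists>P. eli_entails r P \<and> \<not> eli_entails P r \<and> (\<forall>\<phi>\<in>G. eli_entails P (p \<phi>))"
      if "finite G" "G \<subseteq> F" for G
      using that
    proof (induction G rule: finite_induct)
      case empty
      thus ?case using top by (intro exI[of _ Top]) (auto simp: eli_entails_Top)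
    next
      case (insert \<phi> G)
      then obtain P where P: "eli_entails r P" "\<not> eli_entails P r" "\<forall>\<phi>\<in>G. eli_entails P (p \<phi>)" by auto
      have \<phi>: "eli_entails r (p \<phi>)" "\<not> eli_entails (p \<phi>) r" using p insert.prems by auto
      have "\<not> eli_entails (And (p \<phi>) P) r"
      proof
        assume "eli_entails (And (p \<phi>) P) r"
        hence "eli_equivalent r (And (p \<phi>) P)" using P \<phi> by (auto simp: equivalent_def eli_entails_And)
        thus False using prime P(2) \<phi>(2) by blast
      qed
      thus ?case
        using P \<phi> And_eli_entails eli_entails_trans
        by (intro exI[of _ "And (p \<phi>) P"]) (auto simp: eli_entails_And, blast)
    qed
    obtain P where P: "eli_entails r P" "\<not> eli_entails P r" "\<forall>\<phi>\<in>F. eli_entails P (p \<phi>)"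
      using conj[OF _ subset_refl] F by (auto simp: frontier_def)
    then obtain \<phi> where "\<phi> \<in> F" "eli_holds \<phi> 0 P" using F by (auto simp: frontier_def)
    thus False using P(3) p eli_entailsD by blast
  qed
  then obtain \<phi> where \<phi>: "\<phi> \<in> F" "\<And>p. eli_entails r p \<Longrightarrow> \<not> eli_entails p r \<Longrightarrow> eli_holds \<phi> 0 p" by blast
  have "covers [\<phi>] r n" for n
    unfolding covers_def using \<phi>(2) by (intro allI impI exI[of _ "\<lambda>_. 0"]) (auto simp: mono_def)
  thus ?thesis using \<phi>(1) by blast
qed

lemma nth_concat_replicate:
  "u < M \<Longrightarrow> k < length fs \<Longrightarrow> concat (replicate M fs) ! (u * length fs + k) = fs ! k"
proof (induction M arbitrary: u)
  case (Suc M)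
  then show ?case by (cases u) (auto simp: nth_append add.assoc)
qed simp

text \<open>The \<open>u\<close>-th query uses the \<open>u\<close>-th repetition of the frontier,
  whichever instance it needs there.\<close>

lemma covers_repeated:
  assumes F: "frontier r F" and fs: "set fs = F" and n: "n \<le> M"
  shows "covers (concat (replicate M fs)) r n"
  unfolding covers_def
proof (intro allI impI)
  fix p assume p: "\<forall>u<n. eli_entails r (p u) \<and> \<not> eli_entails (p u) r"
  have "\<exists>k<length fs. eli_holds (fs ! k) 0 (p u)" if "u < n" for u
    using F p that fs unfolding frontier_def by (metis in_set_conv_nth)
  then obtain k where k: "\<And>u. u < n \<Longrightarrow> k u < length fs \<and> eli_holds (fs ! k u) 0 (p u)" by metis
  define \<mu> where "\<mu> u = u * length fs + (if u < n then k u else 0)" for u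
  have "mono \<mu>"
  proof (rule mono_iff_le_Suc[THEN iffD2], rule allI)
    fix u
    have "\<mu> u \<le> u * length fs + length fs" using k[of u] by (auto simp: \<mu>_def)
    also have "\<dots> \<le> \<mu> (Suc u)" by (simp add: \<mu>_def)
    finally show "\<mu> u \<le> \<mu> (Suc u)" .
  qed
  moreover have "\<mu> u < length (concat (replicate M fs)) \<and> eli_holds (concat (replicate M fs) ! \<mu> u) 0 (p u)"
    if u: "u < n" for u
  proof
    have "\<mu> u < u * length fs + length fs" using k[OF u] u by (simp add: \<mu>_def)
    also have "\<dots> = Suc u * length fs" by simp
    also have "\<dots> \<le> M * length fs" using u n by (intro mult_le_mono1) simp
    also have "\<dots> = length (concat (replicate M fs))"
      by (simp add: length_concat sum_list_replicate)
    finally show "\<mu> u < length (concat (replicate M fs))" .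
    show "eli_holds (concat (replicate M fs) ! \<mu> u) 0 (p u)"
      using k[OF u] u n by (simp add: \<mu>_def nth_concat_replicate)
  qed
  ultimately show "\<exists>\<mu>. mono \<mu> \<and> (\<forall>u<n. \<mu> u < length (concat (replicate M fs)) \<and>
      eli_holds (concat (replicate M fs) ! \<mu> u) 0 (p u))" by blast
qed

text \<open>The bound of \<open>examples_size_E\<close> with \<open>L\<close> for \<open>N\<close>
  and with \<open>K = L * L\<close>, for \<open>L\<close> repetitions of at most \<open>L\<close>
  frontier instances.\<close>

definition size_bound :: "nat \<Rightarrow> nat" where
  "size_bound L = (L + 2 + (L * (L * L + 1) + L)) * (5 * L + (L * L + 1) * (L * (L + 1)\<^sup>2) + 2)"

definition bound_poly :: "nat poly" where
  "bound_poly = ([:0, 1:] + [:2:] + ([:0, 1:] * ([:0, 1:] * [:0, 1:] + [:1:]) + [:0, 1:])) *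
     ([:5:] * [:0, 1:] + ([:0, 1:] * [:0, 1:] + [:1:]) * ([:0, 1:] * ([:0, 1:] + [:1:])\<^sup>2) + [:2:])"

lemma poly_bound_poly: "poly bound_poly L = size_bound L"
proof -
  have "poly [:0, 1:] L = L" "\<And>c. poly [:c:] L = c" by simp_all
  thus ?thesis by (simp only: bound_poly_def size_bound_def poly_add poly_mult poly_power)
qed

lemma sat_tautologies:
  "(\<And>r. r \<in> labels x ps \<Longrightarrow> eli_entails Top r) \<Longrightarrow> sat (truth \<D> a) t x ps"
proof (induction ps arbitrary: x t)
  case Nil
  then show ?case by (auto simp: chain_def intro: truth_tautology)
next
  case (Cons p ps)
  obtain d y where p: "p = (d, y)" by (cases p)
  have "sat (truth \<D> a) (t + length x + d) y ps" by (rule Cons.IH) (use Cons.prems p in simp)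
  moreover have "chain (truth \<D> a) t x" using Cons.prems by (auto simp: chain_def p intro: truth_tautology)
  ultimately show ?case by (auto simp: p intro!: exI[of _ "t + length x + d"])
qed

text \<open>Neither letter has edges and no atom holds in both. Two such positive examples therefore
  characterise the queries with only tautological labels.\<close>

lemma two_atoms:
  assumes "A \<noteq> B" "eli_holds {Unary A c} a r" "eli_holds {Unary B c} a r"
  shows "eli_holds {} a r"
  using assms(2,3)
proof (induction r arbitrary: a)
  case (Exists S r)
  then show ?case by (cases S) (auto simp: eli_holds_Exists)
qed (use assms(1) in auto)

text \<open>The alternatives in the last clause control the number of blocks to be covered: without
  lone conjuncts one frontier instance covers sequences of any length; otherwise \<open>L\<close>
  repetitions are used, enough for \<open>length qs \<le> L\<close>, which strict distances imply by
  \<open>short\<close>.\<close>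

lemma characterising_examples:
  fixes x :: "('u::infinite, 'b) eli list"
  assumes nf: "nf x ps" and L: "total_size x ps \<le> L"
  obtains E where "is_example_set E" "fits_query x ps E" "examples_size E \<le> size_bound L"
    "\<And>y qs. nf y qs \<Longrightarrow> fits_query y qs E \<Longrightarrow>
      \<not> (\<exists>i. lone x ps i) \<or> length qs \<le> L \<or> (\<forall>v<length qs. 1 \<le> gap qs v) \<Longrightarrow> same_truth x ps y qs"
proof (cases "\<exists>r\<in>labels x ps. \<not> eli_entails Top r")
  case True
  obtain F :: "('u, 'b) eli \<Rightarrow> ('u, 'b) data_instance set" where F: "\<And>r. frontier r (F r)"
    using frontier_exists by metis
  have finF: "finite (F r)" for r using F[of r] by (simp add: frontier_def)
  define safe where "safe = (\<not> (\<exists>i. lone x ps i))"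
  have L1: "1 \<le> L" using L length_size[of x ps] nf_ne[OF nf] by fastforce
  have "\<exists>\<psi>. 0 < i \<and> i \<le> length ps \<and> length (block x ps i) = 1 \<longrightarrow>
      set \<psi> \<subseteq> F (hd (block x ps i)) \<and> \<psi> \<noteq> [] \<and> length \<psi> \<le> L * L \<and>
      (\<forall>n. safe \<or> n \<le> L \<longrightarrow> covers \<psi> (hd (block x ps i)) n)" for i
  proof (cases "0 < i \<and> i \<le> length ps \<and> length (block x ps i) = 1")
    case True
    let ?r = "hd (block x ps i)"
    have top: "\<not> eli_entails Top ?r" using nfD(2)[OF nf] True by blast
    show ?thesis
    proof (cases safe)
      case s: True
      hence "\<not> (\<exists>p1 p2. eli_equivalent ?r (And p1 p2) \<and> \<not> eli_entails p1 ?r \<and> \<not> eli_entails p2 ?r)"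
        using True unfolding safe_def lone_def by blast
      then obtain \<phi> where "\<phi> \<in> F ?r" "\<forall>n. covers [\<phi>] ?r n" using covers_prime[OF F top] by blast
      thus ?thesis using L1 by (intro exI[of _ "[\<phi>]"]) (auto simp: Suc_le_eq)
    next
      case s: False
      obtain fs where fs: "set fs = F ?r" "length fs = card (F ?r)"
        using finite_distinct_list[OF finF] distinct_card by metis
      have "?r \<in> labels x ps"
        unfolding labels_block using True by (intro exI[of _ i] conjI exI[of _ 0]) (auto simp: length_1_nth)
      hence "length fs \<le> L" using F[of ?r] fs label_size L by (fastforce simp: frontier_def)
      hence "length (concat (replicate L fs)) \<le> L * L"
        by (simp add: length_concat sum_list_replicate)
      \<comment> \<open>\<open>Top\<close> is strictly weaker than the label, so the frontier has an
        instance for it.\<close>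
      moreover have "fs \<noteq> []" using F[of ?r] top fs eli_entails_Top[of ?r] by (fastforce simp: frontier_def)
      hence "concat (replicate L fs) \<noteq> []" using L1 by (cases L) auto
      moreover have "set (concat (replicate L fs)) \<subseteq> F ?r" using fs by auto
      ultimately show ?thesis
        using covers_repeated[OF F fs(1)] s by (intro exI[of _ "concat (replicate L fs)"]) auto
    qed
  qed blast
  then obtain \<psi> where choice: "\<And>i. 0 < i \<Longrightarrow> i \<le> length ps \<Longrightarrow> length (block x ps i) = 1 \<Longrightarrow>
      set (\<psi> i) \<subseteq> F (hd (block x ps i)) \<and> \<psi> i \<noteq> [] \<and> length (\<psi> i) \<le> L * L \<and>
      (\<forall>n. safe \<or> n \<le> L \<longrightarrow> covers (\<psi> i) (hd (block x ps i)) n)" by metis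
  have "finite (labels x ps)" by (simp add: labels_def)
  moreover have "finite (set1_eli r)" for r :: "('u, 'b) eli" by (induction r) auto
  ultimately have "finite (\<Union>r\<in>labels x ps. set1_eli r)" by blast
  then obtain Z where Z: "Z \<notin> (\<Union>r\<in>labels x ps. set1_eli r)"
    using ex_new_if_finite[OF infinite_UNIV] by blast
  interpret examples x ps F \<psi> "L * L" Z
    by unfold_locales (use nf F True Z choice in auto)
  have "(N + 2 + (N * (N * N + 1) + N)) * B \<le> size_bound L"
    unfolding B_def C_def size_bound_def using L by (intro mult_le_mono add_mono power_mono le_refl) auto
  hence "examples_size E \<le> size_bound L" using examples_size_E by linarith
  moreover have "same_truth x ps y qs" if y: "nf y qs" "fits_query y qs E"
     and c: "\<not> (\<exists>i. lone x ps i) \<or> length qs \<le> L \<or> (\<forall>v<length qs. 1 \<le> gap qs v)" for y qs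
  proof (rule unique[OF y])
    have "length qs \<le> L" if "\<forall>v<length qs. 1 \<le> gap qs v" using short[OF y that] L by linarith
    hence "safe \<or> length qs \<le> L" using c unfolding safe_def by blast
    thus "covers (\<psi> i) (hd (block x ps i)) n"
      if "0 < i" "i \<le> length ps" "length (block x ps i) = 1" "n \<le> length qs" for i n
      using choice[OF that(1-3)] le_trans[OF that(4)] by blast
  qed
  ultimately show ?thesis using that is_example_set_E fits_E by blast
next
  case False
  obtain A B :: 'u where AB: "A \<noteq> B"
    using ex_new_if_finite[OF infinite_UNIV, of "{undefined}"] by auto
  define E :: "('u, 'b) examples" where "E = ({([{Unary A 0}], 0), ([{Unary B 0}], 0)}, {})"
  have "is_example_set E"
    by (auto simp: E_def is_example_set_def is_temporal_data_def temporal_inds_def inds_def)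
  moreover have all: "sat (truth \<D> a) t x ps" for \<D> a t
    using False by (intro sat_tautologies) blast
  hence "fits_query x ps E" by (simp add: fits_query_def E_def)
  moreover have "examples_size E \<le> size_bound L"
  proof -
    have "examples_size E = 2" using AB by (simp add: E_def examples_size_def data_size_def)
    also have "2 \<le> size_bound L" by (simp add: size_bound_def algebra_simps)
    finally show ?thesis .
  qed
  moreover have "same_truth x ps y qs" if y: "fits_query y qs E" for y qs
  proof -
    have top: "eli_entails Top r" if r: "r \<in> labels y qs" for r
    proof (rule ccontr)
      assume n: "\<not> eli_entails Top r"
      have "eli_holds {Unary C 0} 0 r" if C: "sat (truth [{Unary C 0}] 0) 0 y qs" for C
      proof -
        obtain s where s: "\<And>v. v \<le> length qs \<Longrightarrow> chain (truth [{Unary C 0}] 0) (s v) (block y qs v)"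
          using C unfolding sat_iff_starts by blast
        obtain v j where v: "v \<le> length qs" "j < length (block y qs v)" "r = block y qs v ! j"
          using r unfolding labels_block by blast
        have "eli_holds (at_time [{Unary C 0}] (s v + j)) 0 r"
          using s[OF v(1)] v by (auto simp: chain_def truth_def)
        thus ?thesis using n eli_holds_empty by (auto simp: at_time_def split: if_splits)
      qed
      hence "eli_holds {Unary A 0} 0 r" "eli_holds {Unary B 0} 0 r"
        using y by (simp_all add: fits_query_def E_def)
      hence "eli_holds {} 0 r" by (rule two_atoms[OF AB])
      thus False using n eli_holds_empty by blast
    qed
    have "sat (truth \<D> a) t y qs" for \<D> a t by (intro sat_tautologies top)
    thus ?thesis using all by (simp add: same_truth_def)
  qed
  ultimately show ?thesis using that by blast
qed

lemma fits_represents: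
  "represents x ps q \<Longrightarrow> is_example_set E \<Longrightarrow> fits q E \<longleftrightarrow> fits_query x ps E"
  by (fastforce simp: represents_def fits_def fits_query_def is_example_set_def)

text \<open>The alternatives stand for safe queries, classes of bounded query size and classes
  without reflexive diamond; \<open>represented_nf\<close> turns each into a condition on the normal
  form of the fitting query.\<close>

lemma characterised:
  fixes x :: "('u::infinite, 'b) eli list"
  assumes nf: "nf x ps" and L: "total_size x ps \<le> L" and rep: "represents x ps q"
    and short: "\<And>q'. q' \<in> \<Q> \<Longrightarrow> \<not> (\<exists>i. lone x ps i) \<or> query_size q' \<le> L \<or> DiaR \<notin> fst ` set (snd q')"
  shows "\<exists>E. uniquely_characterises E q \<Q> \<and> examples_size E \<le> size_bound L"
proof -
  obtain E where E: "is_example_set E" "fits_query x ps E" "examples_size E \<le> size_bound L"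
    and unique: "\<And>y qs. nf y qs \<Longrightarrow> fits_query y qs E \<Longrightarrow>
      \<not> (\<exists>i. lone x ps i) \<or> length qs \<le> L \<or> (\<forall>v<length qs. 1 \<le> gap qs v) \<Longrightarrow> same_truth x ps y qs"
    by (rule characterising_examples[OF nf L]) blast
  have "equivalent q q'" if q': "q' \<in> \<Q>" "fits q' E" for q'
  proof -
    obtain y qs where y: "nf y qs" "represents y qs q'" "total_size y qs \<le> query_size q'"
      "DiaR \<notin> fst ` set (snd q') \<Longrightarrow> \<forall>v<length qs. 1 \<le> gap qs v"
      using represented_nf by blast
    have "length qs < total_size y qs" using length_size nf_ne[OF y(1)] by blast
    hence "\<not> (\<exists>i. lone x ps i) \<or> length qs \<le> L \<or> (\<forall>v<length qs. 1 \<le> gap qs v)"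
      using short[OF q'(1)] y(3,4) by (meson le_trans less_imp_le_nat)
    hence "same_truth x ps y qs" using unique[OF y(1)] q'(2) fits_represents[OF y(2) E(1)] by blast
    hence "represents x ps q'" using y(2) by (simp add: represents_def same_truth_def)
    thus ?thesis using equivalent_represents rep by blast
  qed
  moreover have "fits q E" using fits_represents[OF rep E(1)] E(2) by blast
  ultimately show ?thesis using E unfolding uniquely_characterises_def by blast
qed

theorem theorem27:
  shows
    "(\<forall>q \<in> (path_queries {Next, DiaR} :: ('u::infinite, 'b::infinite) path_query set).
        uniquely_characterisable q (path_queries {Next, DiaR}) \<longleftrightarrow> safe q) \<and>
     (\<exists>f :: nat poly.
        \<forall>q \<in> (path_queries {Next, DiaR} :: ('u, 'b) path_query set).
          uniquely_characterisable q (path_queries {Next, DiaR}) \<longrightarrow>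
          (\<exists>E. uniquely_characterises E q (path_queries {Next, DiaR}) \<and>
               examples_size E \<le> poly f (query_size q))) \<and>
     polynomially_characterisable_bounded
       (path_queries {Next, DiaR} :: ('u, 'b) path_query set) \<and>
     polynomially_characterisable
       (path_queries {Next, Dia} :: ('u, 'b) path_query set)"
proof (intro conjI)
  \<comment> \<open>No normal form of a characterisable query has a lone conjunct. This applies in
    particular to one of size at most \<open>query_size q\<close>, which gives the polynomial
    bound.\<close>
  have lone: "\<not> (\<exists>i. lone x ps i)"
    if "uniquely_characterisable q (path_queries {Next, DiaR})" "nf x ps" "represents x ps q"
    for q :: "('u, 'b) path_query" and x ps
    using lone_not_characterisable that unfolding uniquely_characterisable_def by blast
  show "\<forall>q \<in> (path_queries {Next, DiaR} :: ('u, 'b) path_query set).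
        uniquely_characterisable q (path_queries {Next, DiaR}) \<longleftrightarrow> safe q"
  proof (intro ballI iffI)
    fix q :: "('u, 'b) path_query"
    assume c: "uniquely_characterisable q (path_queries {Next, DiaR})"
    obtain x ps where "nf x ps" "represents x ps q" using represented_nf by blast
    thus "safe q" using lone[OF c] safe_iff by blast
  next
    fix q :: "('u, 'b) path_query"
    assume "safe q"
    then obtain x ps where x: "nf x ps" "represents x ps q" "\<not> (\<exists>i. lone x ps i)" using safe_iff by blast
    show "uniquely_characterisable q (path_queries {Next, DiaR})"
      using characterised[OF x(1) le_refl x(2)] x(3) unfolding uniquely_characterisable_def by blast
  qed
  show "\<exists>f :: nat poly. \<forall>q \<in> (path_queries {Next, DiaR} :: ('u, 'b) path_query set).
          uniquely_characterisable q (path_queries {Next, DiaR}) \<longrightarrow>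
          (\<exists>E. uniquely_characterises E q (path_queries {Next, DiaR}) \<and> examples_size E \<le> poly f (query_size q))"
  proof (intro exI[of _ bound_poly] ballI impI)
    fix q :: "('u, 'b) path_query"
    assume c: "uniquely_characterisable q (path_queries {Next, DiaR})"
    obtain x ps where x: "nf x ps" "represents x ps q" "total_size x ps \<le> query_size q"
      using represented_nf by blast
    show "\<exists>E. uniquely_characterises E q (path_queries {Next, DiaR}) \<and> examples_size E \<le> poly bound_poly (query_size q)"
      unfolding poly_bound_poly using characterised[OF x(1,3,2)] lone[OF c x(1,2)] by blast
  qed
  show "polynomially_characterisable_bounded (path_queries {Next, DiaR} :: ('u, 'b) path_query set)"
    unfolding polynomially_characterisable_bounded_def poly_bound_poly
  proof (intro exI[of _ bound_poly] allI ballI)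
    fix n and q :: "('u, 'b) path_query"
    assume q: "q \<in> bounded_queries (path_queries {Next, DiaR}) n"
    obtain x ps where x: "nf x ps" "represents x ps q" "total_size x ps \<le> query_size q"
      using represented_nf by blast
    have "total_size x ps \<le> n" using x(3) q by (simp add: bounded_queries_def)
    thus "\<exists>E. uniquely_characterises E q (bounded_queries (path_queries {Next, DiaR}) n) \<and>
        examples_size E \<le> poly bound_poly n"
      unfolding poly_bound_poly using x by (intro characterised) (auto simp: bounded_queries_def)
  qed
  show "polynomially_characterisable (path_queries {Next, Dia} :: ('u, 'b) path_query set)"
    unfolding polynomially_characterisable_def
  proof (intro exI[of _ bound_poly] ballI)
    fix q :: "('u, 'b) path_query"
    obtain x ps where x: "nf x ps" "represents x ps q" "total_size x ps \<le> query_size q"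
      using represented_nf by blast
    show "\<exists>E. uniquely_characterises E q (path_queries {Next, Dia}) \<and> examples_size E \<le> poly bound_poly (query_size q)"
      unfolding poly_bound_poly
    proof (rule characterised[OF x(1,3,2)])
      fix q' :: "('u, 'b) path_query"
      assume "q' \<in> path_queries {Next, Dia}"
      hence "fst ` set (snd q') \<subseteq> {Next, Dia}" unfolding path_queries_def by (simp add: case_prod_unfold)
      hence "DiaR \<notin> fst ` set (snd q')" by blast
      thus "\<not> (\<exists>i. lone x ps i) \<or> query_size q' \<le> query_size q \<or> DiaR \<notin> fst ` set (snd q')" by blast
    qed
  qed
qed

end
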